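(* Let $1\le p<\infty$ with conjugate index $p'$, let $(\Omega,\Sigma,\mu)$ be a finite measure space, and let $X=X(\mu)$ be an order continuous $p$-convex Banach function space over $\mu$ with $p$-convexity constant equal to $1$. Let $B_0: X\times X_{[p/p']}\to X_{[p]}$ be the bilinear map $B_0(f,g)=f\cdot g$ (pointwise product). Then the following assertions are equivalent. (1) For every rank one operator $T: X_{[p]}\to X_{[p]}$, $$\sup_{f\in B_X}\bigl\|\,|f^p+T(f^p)|^{1/p}\bigr\|_X^p=1+\|T\|.$$ (2) For every rank one operator $T: X_{[p]}\to X_{[p]}$, $$\|B_0+T\circ B_0\|=1+\|T\|.$$ (3) For every $z\in S_{X_{[p]}}$, for every $x'\in S_{(X_{[p]})'}$ and for every $\varepsilon>0$ there is an element $(f,g)\in S((B_0)_{x'},\varepsilon)$ such that $$\|z+B_0(f,g)\|_{X_{[p]}}\ge 2-2\varepsilon.$$ (4) Each weakly compact symmetric bilinear map $B: X\times X_{[p/p']}\to X_{[p]}$ satisfies the equation $$\|B_0+B\|=1+\|B\|.$$ (5) $X_{[p]}$ has the Daugavet property.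
   Context: All spaces are real. $B_E$, $S_E$ denote the closed unit ball and the unit sphere of a Banach space $E$, and $E'$ its dual. Operators are continuous and linear; bilinear maps are continuous, with norm $\|B\|=\sup\{\|B(x,y)\|: x\in B_X,y\in B_Y\}$. A Banach space $E$ has the Daugavet property if $\|\mathrm{Id}+Q\|=1+\|Q\|$ for every rank one operator $Q: E\to E$. A Banach function space $X(\mu)$ over $\mu$ is an order ideal of $L^0(\mu)$ (the $\mu$-a.e. equivalence classes of real measurable functions) that is a Banach space with a lattice norm and contains $\chi_A$ for every $A\in\Sigma$ of finite measure. It is $p$-convex with constant $1$ if $\|(\sum_{i=1}^n|f_i|^p)^{1/p}\|_X\le(\sum_{i=1}^n\|f_i\|_X^p)^{1/p}$ for all finite sequences $(f_i)_{i=1}^n$ in $X$. For $r>0$, the $r$-th power of $X$ is $X_{[r]}=\{h\in L^0(\mu): |h|^{1/r}\in X\}$ with $\|h\|_{X_{[r]}}=\||h|^{1/r}\|_X^r$. Here $1/p+1/p'=1$, so $p/p'=p-1$; for $p=1$ one has $p/p'=0$ and $X_{[0]}$ is understood as $L^\infty(\mu)$. (Under the stated assumptions $X_{[p]}$ and $X_{[p/p']}$ are Banach function spaces.) For a function $f$, $f^p$ denotes the sign preserving power $f^p=\mathrm{sign}\{f\}\,|f|^p$. For a norm one bilinear form $b: X\times Y\to\mathbb R$ and $\varepsilon>0$, $S(b,\varepsilon)=\{(x,y): x\in B_X,\ y\in B_Y,\ b(x,y)\ge1-\varepsilon\}$. For $x'\in S_{(X_{[p]})'}$, $(B_0)_{x'}$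 is the bilinear form $(f,g)\mapsto\langle B_0(f,g),x'\rangle/\|\langle B_0,x'\rangle\|$, where $\langle B_0,x'\rangle(f,g)=\langle B_0(f,g),x'\rangle$. A bilinear map $B: X\times Y\to Z$ is weakly compact if the norm closure of $B(B_X\times B_Y)$ is weakly compact. For Banach function spaces $X(\mu),Y(\mu),Z(\mu)$ over $\mu$, a continuous bilinear map $B: X(\mu)\times Y(\mu)\to Z(\mu)$ is called symmetric if $B(\chi_A,\chi_C)=B(\chi_{A\cap C},\chi_{A\cup C})$ for all $A,C\in\Sigma$. *)

theory Defs
  imports "HOL-Analysis.Analysis" "HOL-Probability.Essential_Supremum"
begin

text \<open>
  Elements of \<open>L\<^sup>0(\<mu>)\<close> are represented by measurable functions, and equality in \<open>L\<^sup>0(\<mu>)\<close> is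
  equality almost everywhere. A space of (classes of) functions is thus a set of measurable
  functions together with a functional that is a norm modulo a.e. equality; values of that
  functional outside the set are irrelevant. Maps between such spaces are maps on representatives
  whose algebraic laws hold a.e.; boundedness makes all the maps considered below compatible with
  a.e. equality, so they are exactly the maps induced by operators between spaces of classes.
\<close>

record 'a fspace =
  elems :: "('a \<Rightarrow> real) set"
  fnorm :: "('a \<Rightarrow> real) \<Rightarrow> real"

definition fball :: "'a fspace \<Rightarrow> ('a \<Rightarrow> real) set" where
  "fball E = {f \<in> elems E. fnorm E f \<le> 1}"

definition fsphere :: "'a fspace \<Rightarrow> ('a \<Rightarrow> real) set" where
  "fsphere E = {f \<in> elems E. fnorm E f = 1}"


section \<open>Banach function spaces\<close>

definition banach_function_space :: "'a measure \<Rightarrow> 'a fspace \<Rightarrow> bool" where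
  "banach_function_space M X \<longleftrightarrow>
     elems X \<subseteq> borel_measurable M \<and>
     (\<forall>f\<in>elems X. \<forall>g\<in>elems X. (\<lambda>x. f x + g x) \<in> elems X \<and>
        fnorm X (\<lambda>x. f x + g x) \<le> fnorm X f + fnorm X g) \<and>
     (\<forall>c. \<forall>f\<in>elems X. (\<lambda>x. c * f x) \<in> elems X \<and>
        fnorm X (\<lambda>x. c * f x) = \<bar>c\<bar> * fnorm X f) \<and>
     (\<forall>f\<in>elems X. 0 \<le> fnorm X f \<and> (fnorm X f = 0 \<longleftrightarrow> (AE x in M. f x = 0))) \<and>
     (\<forall>f\<in>elems X. \<forall>g\<in>borel_measurable M. (AE x in M. \<bar>g x\<bar> \<le> \<bar>f x\<bar>) \<longrightarrow>
        g \<in> elems X \<and> fnorm X g \<le> fnorm X f) \<and>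
     (\<forall>A\<in>sets M. emeasure M A < \<infinity> \<longrightarrow> indicat_real A \<in> elems X) \<and>
     (\<forall>u :: nat \<Rightarrow> 'a \<Rightarrow> real.
        (\<forall>n. u n \<in> elems X) \<and>
        (\<forall>e>0. \<exists>k. \<forall>m\<ge>k. \<forall>n\<ge>k. fnorm X (\<lambda>x. u m x - u n x) < e) \<longrightarrow>
        (\<exists>f\<in>elems X. (\<lambda>n. fnorm X (\<lambda>x. u n x - f x)) \<longlonglongrightarrow> 0))"

text \<open>
  Order continuity is required along sequences, as is usual for Banach function spaces; over a
  finite measure it is equivalent to the version with downward directed families.
\<close>

definition order_continuous :: "'a measure \<Rightarrow> 'a fspace \<Rightarrow> bool" where
  "order_continuous M X \<longleftrightarrow>
     (\<forall>u :: nat \<Rightarrow> 'a \<Rightarrow> real.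
        (\<forall>n. u n \<in> elems X) \<and>
        (AE x in M. decseq (\<lambda>n. u n x) \<and> (\<lambda>n. u n x) \<longlonglongrightarrow> 0) \<longrightarrow>
        (\<lambda>n. fnorm X (u n)) \<longlonglongrightarrow> 0)"

definition p_convex_const_1 :: "real \<Rightarrow> 'a fspace \<Rightarrow> bool" where
  "p_convex_const_1 p X \<longleftrightarrow>
     (\<forall>(n::nat) f. (\<forall>i<n. f i \<in> elems X) \<longrightarrow>
        fnorm X (\<lambda>x. (\<Sum>i<n. \<bar>f i x\<bar> powr p) powr (1 / p))
          \<le> (\<Sum>i<n. fnorm X (f i) powr p) powr (1 / p))"

definition L_infty :: "'a measure \<Rightarrow> 'a fspace" where
  "L_infty M =
     \<lparr> elems = {h \<in> borel_measurable M. esssup M (\<lambda>x. ereal \<bar>h x\<bar>) < \<infinity>},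
       fnorm = (\<lambda>h. real_of_ereal (esssup M (\<lambda>x. ereal \<bar>h x\<bar>))) \<rparr>"

text \<open>The power \<open>X\<^sub>[\<^sub>r\<^sub>]\<close> for \<open>r \<ge> 0\<close>, with \<open>X\<^sub>[\<^sub>0\<^sub>] = L\<^sup>\<infinity>(\<mu>)\<close> by convention.\<close>

definition fpower :: "'a measure \<Rightarrow> 'a fspace \<Rightarrow> real \<Rightarrow> 'a fspace" where
  "fpower M X r =
     (if r = 0 then L_infty M
      else \<lparr> elems = {h \<in> borel_measurable M. (\<lambda>x. \<bar>h x\<bar> powr (1 / r)) \<in> elems X},
             fnorm = (\<lambda>h. fnorm X (\<lambda>x. \<bar>h x\<bar> powr (1 / r)) powr r) \<rparr>)"

definition sign_powr :: "('a \<Rightarrow> real) \<Rightarrow> real \<Rightarrow> 'a \<Rightarrow> real" where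
  "sign_powr f p = (\<lambda>x. sgn (f x) * \<bar>f x\<bar> powr p)"


section \<open>Operators, functionals and bilinear maps\<close>

definition bounded_op ::
    "'a measure \<Rightarrow> 'a fspace \<Rightarrow> 'a fspace \<Rightarrow> (('a \<Rightarrow> real) \<Rightarrow> 'a \<Rightarrow> real) \<Rightarrow> bool" where
  "bounded_op M E F T \<longleftrightarrow>
     (\<forall>f\<in>elems E. T f \<in> elems F) \<and>
     (\<forall>f\<in>elems E. \<forall>g\<in>elems E. AE x in M. T (\<lambda>y. f y + g y) x = T f x + T g x) \<and>
     (\<forall>c. \<forall>f\<in>elems E. AE x in M. T (\<lambda>y. c * f y) x = c * T f x) \<and>
     (\<exists>C. \<forall>f\<in>elems E. fnorm F (T f) \<le> C * fnorm E f)"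

definition op_norm ::
    "'a fspace \<Rightarrow> 'a fspace \<Rightarrow> (('a \<Rightarrow> real) \<Rightarrow> 'a \<Rightarrow> real) \<Rightarrow> real" where
  "op_norm E F T = (SUP f\<in>fball E. fnorm F (T f))"

text \<open>The range of a rank one operator is one-dimensional (in particular not \<open>{0}\<close>).\<close>

definition rank_one_op ::
    "'a measure \<Rightarrow> 'a fspace \<Rightarrow> 'a fspace \<Rightarrow> (('a \<Rightarrow> real) \<Rightarrow> 'a \<Rightarrow> real) \<Rightarrow> bool" where
  "rank_one_op M E F T \<longleftrightarrow>
     bounded_op M E F T \<and>
     (\<exists>f\<in>elems E. \<not> (AE x in M. T f x = 0)) \<and>
     (\<exists>z\<in>elems F. \<forall>f\<in>elems E. \<exists>c. AE x in M. T f x = c * z x)"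

definition daugavet_property :: "'a measure \<Rightarrow> 'a fspace \<Rightarrow> bool" where
  "daugavet_property M E \<longleftrightarrow>
     (\<forall>Q. rank_one_op M E E Q \<longrightarrow>
        op_norm E E (\<lambda>f x. f x + Q f x) = 1 + op_norm E E Q)"

definition dual :: "'a fspace \<Rightarrow> (('a \<Rightarrow> real) \<Rightarrow> real) set" where
  "dual E = {\<phi>.
     (\<forall>f\<in>elems E. \<forall>g\<in>elems E. \<phi> (\<lambda>x. f x + g x) = \<phi> f + \<phi> g) \<and>
     (\<forall>c. \<forall>f\<in>elems E. \<phi> (\<lambda>x. c * f x) = c * \<phi> f) \<and>
     (\<exists>C. \<forall>f\<in>elems E. \<bar>\<phi> f\<bar> \<le> C * fnorm E f)}"

definition dual_norm :: "'a fspace \<Rightarrow> (('a \<Rightarrow> real) \<Rightarrow> real) \<Rightarrow> real" where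
  "dual_norm E \<phi> = (SUP f\<in>fball E. \<bar>\<phi> f\<bar>)"

definition dual_sphere :: "'a fspace \<Rightarrow> (('a \<Rightarrow> real) \<Rightarrow> real) set" where
  "dual_sphere E = {\<phi> \<in> dual E. dual_norm E \<phi> = 1}"

definition bounded_bilinear_map ::
    "'a measure \<Rightarrow> 'a fspace \<Rightarrow> 'a fspace \<Rightarrow> 'a fspace \<Rightarrow>
     (('a \<Rightarrow> real) \<Rightarrow> ('a \<Rightarrow> real) \<Rightarrow> 'a \<Rightarrow> real) \<Rightarrow> bool" where
  "bounded_bilinear_map M X Y Z B \<longleftrightarrow>
     (\<forall>f\<in>elems X. \<forall>g\<in>elems Y. B f g \<in> elems Z) \<and>
     (\<forall>f\<in>elems X. \<forall>f'\<in>elems X. \<forall>g\<in>elems Y.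
        AE x in M. B (\<lambda>y. f y + f' y) g x = B f g x + B f' g x) \<and>
     (\<forall>f\<in>elems X. \<forall>g\<in>elems Y. \<forall>g'\<in>elems Y.
        AE x in M. B f (\<lambda>y. g y + g' y) x = B f g x + B f g' x) \<and>
     (\<forall>c. \<forall>f\<in>elems X. \<forall>g\<in>elems Y. AE x in M. B (\<lambda>y. c * f y) g x = c * B f g x) \<and>
     (\<forall>c. \<forall>f\<in>elems X. \<forall>g\<in>elems Y. AE x in M. B f (\<lambda>y. c * g y) x = c * B f g x) \<and>
     (\<exists>C. \<forall>f\<in>elems X. \<forall>g\<in>elems Y. fnorm Z (B f g) \<le> C * fnorm X f * fnorm Y g)"

definition bilin_norm ::
    "'a fspace \<Rightarrow> 'a fspace \<Rightarrow> 'a fspace \<Rightarrow>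
     (('a \<Rightarrow> real) \<Rightarrow> ('a \<Rightarrow> real) \<Rightarrow> 'a \<Rightarrow> real) \<Rightarrow> real" where
  "bilin_norm X Y Z B = (SUP (f, g) \<in> fball X \<times> fball Y. fnorm Z (B f g))"

definition bilin_form_norm ::
    "'a fspace \<Rightarrow> 'a fspace \<Rightarrow> (('a \<Rightarrow> real) \<Rightarrow> ('a \<Rightarrow> real) \<Rightarrow> real) \<Rightarrow> real" where
  "bilin_form_norm X Y b = (SUP (f, g) \<in> fball X \<times> fball Y. \<bar>b f g\<bar>)"

definition slice ::
    "'a fspace \<Rightarrow> 'a fspace \<Rightarrow> (('a \<Rightarrow> real) \<Rightarrow> ('a \<Rightarrow> real) \<Rightarrow> real) \<Rightarrow> real \<Rightarrow>
     (('a \<Rightarrow> real) \<times> ('a \<Rightarrow> real)) set" where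
  "slice X Y b \<epsilon> = {(f, g). f \<in> fball X \<and> g \<in> fball Y \<and> b f g \<ge> 1 - \<epsilon>}"

definition normalized_form ::
    "'a fspace \<Rightarrow> 'a fspace \<Rightarrow> (('a \<Rightarrow> real) \<Rightarrow> ('a \<Rightarrow> real) \<Rightarrow> 'a \<Rightarrow> real) \<Rightarrow>
     (('a \<Rightarrow> real) \<Rightarrow> real) \<Rightarrow> ('a \<Rightarrow> real) \<Rightarrow> ('a \<Rightarrow> real) \<Rightarrow> real" where
  "normalized_form X Y B \<phi> f g = \<phi> (B f g) / bilin_form_norm X Y (\<lambda>f g. \<phi> (B f g))"

definition weak_topology :: "'a fspace \<Rightarrow> ('a \<Rightarrow> real) topology" where
  "weak_topology E =
     topology_generated_by {{f \<in> elems E. \<phi> f \<in> U} | \<phi> U. \<phi> \<in> dual E \<and> open U}"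

definition norm_closure :: "'a fspace \<Rightarrow> ('a \<Rightarrow> real) set \<Rightarrow> ('a \<Rightarrow> real) set" where
  "norm_closure E S = {h \<in> elems E. \<forall>e>0. \<exists>k\<in>S. fnorm E (\<lambda>x. h x - k x) < e}"

text \<open>
  The weak topology on representatives is the pullback of the one on classes, and norm closures are
  closed under a.e. equality, so compactness here is compactness of the set of classes.
\<close>

definition weakly_compact_bilinear ::
    "'a fspace \<Rightarrow> 'a fspace \<Rightarrow> 'a fspace \<Rightarrow>
     (('a \<Rightarrow> real) \<Rightarrow> ('a \<Rightarrow> real) \<Rightarrow> 'a \<Rightarrow> real) \<Rightarrow> bool" where
  "weakly_compact_bilinear X Y Z B \<longleftrightarrow>
     compactin (weak_topology Z) (norm_closure Z {B f g | f g. f \<in> fball X \<and> g \<in> fball Y})"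

definition symmetric_bilinear ::
    "'a measure \<Rightarrow> (('a \<Rightarrow> real) \<Rightarrow> ('a \<Rightarrow> real) \<Rightarrow> 'a \<Rightarrow> real) \<Rightarrow> bool" where
  "symmetric_bilinear M B \<longleftrightarrow>
     (\<forall>A\<in>sets M. \<forall>C\<in>sets M. AE x in M.
        B (indicat_real A) (indicat_real C) x =
        B (indicat_real (A \<inter> C)) (indicat_real (A \<union> C)) x)"

definition prod_map :: "('a \<Rightarrow> real) \<Rightarrow> ('a \<Rightarrow> real) \<Rightarrow> 'a \<Rightarrow> real" where
  "prod_map f g = (\<lambda>x. f x * g x)"

end

(*
  Pointwise multiplication maps the product of the unit balls of X and X_[p/p'] onto the unit
  ball of X_[p], and the sign preserving power maps the unit ball of X onto it; so (1), (2)
  and (5) are the same statement about X_[p].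

  A bounded bilinear map that is symmetric vanishes on indicators of disjoint sets, hence by
  order continuity and density it factors through the product as T o B_0 with T bounded on X_[p].
  It remains to see that weakly compact T satisfy the Daugavet equation as soon as slices behave as in (3).
  Fix y in the ball. Using (3), choose v_1, v_2, ... in the ball such that every
  |T y + v_1 + ... + v_n| is nearly |T y| + n. If T u stayed away from T y for all u with
  |T y + u| nearly |T y| + 1, one could also choose functionals phi_n separating T y from
  T v_1, ..., T v_n, and pick each v_{n+1} in a slice which forces the averages of T v_i to
  approach T y on every phi_j. A weak cluster point of the averages then contradicts
  Hahn-Banach. So there is u with T u close to T y and |u + T u| close to 1 + |T y|.
*)

theory Submission
  imports Defs
begin

section \<open>Sublinear functionals and the Hahn-Banach theorem\<close>

text \<open>The classical argument for weakly compact operators takes a denting point of the image,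
  so that a single slice of the ball is carried into a set of small diameter. Condition (3) provides
  slices, but each controls one functional of \<open>T u\<close>, while norm closeness of
  \<open>T u\<close> to \<open>T y\<close> involves all of them. Here approachability replaces the
  denting point: Hahn-Banach produces the functionals one at a time, and each new vector is taken
  from one slice of a weighted combination of all earlier functionals, which steers every coordinate
  of the averages at once. Working with representatives means that norms have a kernel and operators
  are linear only a.e. Functionals kill that kernel, so testing against the dual restores exact
  linearity; the abstract part therefore treats a set of functions with a seminorm. For function
  spaces two facts carry the weight: p-convexity with constant 1 is the triangle inequality of the
  p-th power, and each \<open>h\<close> in that power has an explicit factorization through X and
  the power \<open>p - 1\<close>, which is p/p', with norm control.\<close>

locale function_space =
  fixes E :: "'a fspace"
  assumes add_mem: "\<lbrakk>f \<in> elems E; g \<in> elems E\<rbrakk> \<Longrightarrow> (\<lambda>x. f x + g x) \<in> elems E"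
    and norm_add: "\<lbrakk>f \<in> elems E; g \<in> elems E\<rbrakk> \<Longrightarrow>
      fnorm E (\<lambda>x. f x + g x) \<le> fnorm E f + fnorm E g"
    and scale_mem: "f \<in> elems E \<Longrightarrow> (\<lambda>x. c * f x) \<in> elems E"
    and norm_scale: "f \<in> elems E \<Longrightarrow> fnorm E (\<lambda>x. c * f x) = \<bar>c\<bar> * fnorm E f"
    and elems_nonempty: "elems E \<noteq> {}"
begin

abbreviation N where "N \<equiv> fnorm E"
abbreviation V where "V \<equiv> elems E"

lemma zero_mem: "(\<lambda>x. 0) \<in> V"
  using elems_nonempty scale_mem[of _ 0] by auto

lemma norm_zero: "N (\<lambda>x. 0) = 0"
  using norm_scale[OF zero_mem, of 0] by simp

lemma minus_mem: "f \<in> V \<Longrightarrow> (\<lambda>x. - f x) \<in> V"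
  using scale_mem[of f "-1"] by simp

lemma norm_minus: "f \<in> V \<Longrightarrow> N (\<lambda>x. - f x) = N f"
  using norm_scale[of f "-1"] by simp

lemma diff_mem: "\<lbrakk>f \<in> V; g \<in> V\<rbrakk> \<Longrightarrow> (\<lambda>x. f x - g x) \<in> V"
  using add_mem[OF _ minus_mem] by simp

lemma norm_diff: "\<lbrakk>f \<in> V; g \<in> V\<rbrakk> \<Longrightarrow> N (\<lambda>x. f x - g x) \<le> N f + N g"
  using norm_add[OF _ minus_mem, of f g] by (simp add: norm_minus)

lemma norm_diff_commute: "\<lbrakk>f \<in> V; g \<in> V\<rbrakk> \<Longrightarrow> N (\<lambda>x. f x - g x) = N (\<lambda>x. g x - f x)"
  using norm_minus[OF diff_mem, of g f] by simp

lemma norm_triangle_diff: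
  assumes "f \<in> V" "g \<in> V" "h \<in> V"
  shows "N (\<lambda>x. f x - h x) \<le> N (\<lambda>x. f x - g x) + N (\<lambda>x. g x - h x)"
  using norm_add[OF diff_mem diff_mem, of f g g h] assms by simp

lemma norm_le_diff: "\<lbrakk>f \<in> V; g \<in> V\<rbrakk> \<Longrightarrow> N f \<le> N g + N (\<lambda>x. f x - g x)"
  using norm_add[OF _ diff_mem, of g f g] by simp

lemma norm_nonneg: "f \<in> V \<Longrightarrow> 0 \<le> N f"
  using norm_diff[of f f] by (simp add: norm_zero)

lemma sum_mem: "(\<And>i. i \<in> I \<Longrightarrow> f i \<in> V) \<Longrightarrow> (\<lambda>x. \<Sum>i\<in>I. f i x) \<in> V"
  by (induction I rule: infinite_finite_induct) (simp_all add: zero_mem add_mem)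

lemma norm_sum: "(\<And>i. i \<in> I \<Longrightarrow> f i \<in> V) \<Longrightarrow> N (\<lambda>x. \<Sum>i\<in>I. f i x) \<le> (\<Sum>i\<in>I. N (f i))"
proof (induction I rule: infinite_finite_induct)
  case (insert i I)
  then have "N (\<lambda>x. f i x + (\<Sum>i\<in>I. f i x)) \<le> N (f i) + N (\<lambda>x. \<Sum>i\<in>I. f i x)"
    by (intro norm_add sum_mem) auto
  with insert show ?case by simp
qed (simp_all add: norm_zero)

definition sublinear :: "(('a \<Rightarrow> real) \<Rightarrow> real) \<Rightarrow> bool" where
  "sublinear r \<longleftrightarrow> (\<forall>f\<in>V. \<forall>g\<in>V. r (\<lambda>x. f x + g x) \<le> r f + r g) \<and>
     (\<forall>c\<ge>0. \<forall>f\<in>V. r (\<lambda>x. c * f x) \<le> c * r f)"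

lemma sublinear_add: "\<lbrakk>sublinear r; f \<in> V; g \<in> V\<rbrakk> \<Longrightarrow> r (\<lambda>x. f x + g x) \<le> r f + r g"
  by (simp add: sublinear_def)

lemma sublinear_scale:
  assumes "sublinear r" "f \<in> V" "c > 0"
  shows "r (\<lambda>x. c * f x) = c * r f"
proof (rule antisym)
  show "r (\<lambda>x. c * f x) \<le> c * r f" using assms by (simp add: sublinear_def)
  have "r (\<lambda>x. inverse c * (c * f x)) \<le> inverse c * r (\<lambda>x. c * f x)"
    using assms scale_mem[of f c] unfolding sublinear_def
    by (metis inverse_nonnegative_iff_nonnegative less_eq_real_def)
  also have "(\<lambda>x. inverse c * (c * f x)) = f" using assms by (simp add: fun_eq_iff)
  finally show "c * r f \<le> r (\<lambda>x. c * f x)" using assms by (simp add: field_simps)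
qed

lemma sublinear_zero: "sublinear r \<Longrightarrow> r (\<lambda>x. 0) = 0"
  using sublinear_scale[OF _ zero_mem, of r 2] by simp

lemma sublinear_ge_minus: "\<lbrakk>sublinear r; f \<in> V\<rbrakk> \<Longrightarrow> - r (\<lambda>x. - f x) \<le> r f"
  using sublinear_add[OF _ _ minus_mem, of r f f] by (simp add: sublinear_zero)

lemma sublinear_norm: "sublinear N"
  by (simp add: sublinear_def norm_add norm_scale)

definition convex_subset :: "('a \<Rightarrow> real) set \<Rightarrow> bool" where
  "convex_subset D \<longleftrightarrow> D \<subseteq> V \<and> D \<noteq> {} \<and>
     (\<forall>f\<in>D. \<forall>g\<in>D. \<forall>s\<ge>0. \<forall>t\<ge>0. s + t = 1 \<longrightarrow> (\<lambda>x. s * f x + t * g x) \<in> D)"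

lemma convex_subsetD:
  "\<lbrakk>convex_subset D; f \<in> D; g \<in> D; 0 \<le> s; 0 \<le> t; s + t = 1\<rbrakk> \<Longrightarrow> (\<lambda>x. s * f x + t * g x) \<in> D"
  by (simp add: convex_subset_def)

text \<open>A Mazur-Orlicz construction: the infimum of \<open>r (w + t * c) - t * d\<close> over
  \<open>t \<ge> 0\<close> and \<open>c\<close> in \<open>D\<close> is the largest sublinear
  functional below \<open>r\<close> that is at most \<open>- d\<close> on the negatives of
  \<open>D\<close>. A linear functional below it is then at least \<open>d\<close> on
  \<open>D\<close>. Singletons \<open>D\<close> serve the Hahn-Banach theorem, larger ones the
  separation of convex sets.\<close>

lemma sublinear_lowered:
  assumes r: "sublinear r" and D: "convex_subset D" and d: "\<And>c. c \<in> D \<Longrightarrow> d \<le> r c"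
  obtains q where "sublinear q" "\<And>f. f \<in> V \<Longrightarrow> q f \<le> r f" "\<And>c. c \<in> D \<Longrightarrow> q (\<lambda>x. - c x) \<le> - d"
proof -
  define F where "F w = (\<lambda>(t, c). r (\<lambda>x. w x + t * c x) - t * d)" for w
  define I where "I = {0::real..} \<times> D"
  define q where "q w = (INF z\<in>I. F w z)" for w
  have DV: "c \<in> V" if "c \<in> D" for c using D that by (auto simp: convex_subset_def)
  obtain c0 where c0: "c0 \<in> D" using D by (auto simp: convex_subset_def)
  \<comment> \<open>The hypothesis \<open>d \<le> r c\<close> enters here: it keeps the infimum
    finite.\<close>
  have lower: "- r (\<lambda>x. - w x) \<le> F w z" if "w \<in> V" "z \<in> I" for w z
  proof -
    obtain t c where z: "z = (t, c)" "t \<ge> 0" "c \<in> D" using \<open>z \<in> I\<close> by (auto simp: I_def)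
    have wtc: "(\<lambda>x. w x + t * c x) \<in> V" by (intro add_mem scale_mem) (use that z DV in auto)
    have "t * d \<le> r (\<lambda>x. t * c x)"
    proof (cases "t = 0")
      case True then show ?thesis using sublinear_zero[OF r] by simp
    next
      case False
      then show ?thesis using z d[of c] sublinear_scale[OF r DV, of c t] by simp
    qed
    also have "(\<lambda>x. t * c x) = (\<lambda>x. (w x + t * c x) + (- w x))" by simp
    also have "r \<dots> \<le> r (\<lambda>x. w x + t * c x) + r (\<lambda>x. - w x)"
      by (rule sublinear_add[OF r wtc minus_mem[OF \<open>w \<in> V\<close>]])
    finally show ?thesis by (simp add: F_def z)
  qed
  have le: "q w \<le> F w z" if "w \<in> V" "z \<in> I" for w z
    unfolding q_def using that lower by (intro cINF_lower) (auto intro!: bdd_belowI2)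
  have lt: "\<exists>z\<in>I. F w z < s" if "q w < s" "w \<in> V" for w s
    using that c0 lower unfolding q_def
    by (subst (asm) cINF_less_iff) (auto intro!: bdd_belowI2 simp: I_def)
  have add: "q (\<lambda>x. f x + g x) \<le> q f + q g" if fg: "f \<in> V" "g \<in> V" for f g
  proof (rule field_le_epsilon)
    fix e :: real assume "e > 0"
    obtain t1 c1 where 1: "t1 \<ge> 0" "c1 \<in> D" "F f (t1, c1) < q f + e/2"
      using lt[of f "q f + e/2"] \<open>e > 0\<close> fg by (auto simp: I_def)
    obtain t2 c2 where 2: "t2 \<ge> 0" "c2 \<in> D" "F g (t2, c2) < q g + e/2"
      using lt[of g "q g + e/2"] \<open>e > 0\<close> fg by (auto simp: I_def)
    \<comment> \<open>Convexity merges a multiple of \<open>c1\<close> and a multiple of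
      \<open>c2\<close> into one multiple of a member of \<open>D\<close>; if both weights vanish,
      any member serves.\<close>
    have "\<exists>c\<in>D. \<forall>x. (t1 + t2) * c x = t1 * c1 x + t2 * c2 x"
    proof (cases "t1 + t2 = 0")
      case True
      then have "t1 = 0" "t2 = 0" using 1 2 by linarith+
      then show ?thesis using 1 by auto
    next
      case False
      define c where "c = (\<lambda>x. t1 / (t1 + t2) * c1 x + t2 / (t1 + t2) * c2 x)"
      have "t1 / (t1 + t2) + t2 / (t1 + t2) = 1" using False by (simp add: add_divide_distrib[symmetric])
      then have "c \<in> D" unfolding c_def using 1 2 by (intro convex_subsetD[OF D]) simp_all
      moreover have "(t1 + t2) * c x = t1 * c1 x + t2 * c2 x" for x
      proof -
        have "c x = (t1 * c1 x + t2 * c2 x) / (t1 + t2)" by (simp add: c_def add_divide_distrib)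
        then show ?thesis using False by simp
      qed
      ultimately show ?thesis by blast
    qed
    then obtain c where c: "c \<in> D" "\<And>x. (t1 + t2) * c x = t1 * c1 x + t2 * c2 x" by blast
    have "q (\<lambda>x. f x + g x) \<le> F (\<lambda>x. f x + g x) (t1 + t2, c)"
      using 1 2 c fg by (intro le add_mem) (auto simp: I_def)
    also have "\<dots> = r (\<lambda>x. (f x + t1 * c1 x) + (g x + t2 * c2 x)) - (t1 + t2) * d"
      by (simp add: F_def c(2) add_ac)
    also have "\<dots> \<le> F f (t1, c1) + F g (t2, c2)"
      using sublinear_add[OF r, of "\<lambda>x. f x + t1 * c1 x" "\<lambda>x. g x + t2 * c2 x"] fg 1 2
      by (simp add: F_def add_mem scale_mem DV algebra_simps)
    finally show "q (\<lambda>x. f x + g x) \<le> q f + q g + e" using 1 2 by linarith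
  qed
  have scale_pos: "q (\<lambda>x. a * f x) \<le> a * q f" if f: "f \<in> V" and a: "a > 0" for a f
  proof (rule field_le_epsilon)
    fix e :: real assume "e > 0"
    obtain t c where 1: "t \<ge> 0" "c \<in> D" "F f (t, c) < q f + e/a"
      using lt[of f "q f + e/a"] \<open>e > 0\<close> f a by (auto simp: I_def)
    have "q (\<lambda>x. a * f x) \<le> F (\<lambda>x. a * f x) (a * t, c)"
      using 1 f a by (intro le scale_mem) (auto simp: I_def)
    also have "\<dots> = r (\<lambda>x. a * (f x + t * c x)) - a * t * d"
      by (simp add: F_def algebra_simps)
    also have "\<dots> = a * F f (t, c)"
      using sublinear_scale[OF r, of "\<lambda>x. f x + t * c x" a] f 1 a
      by (simp add: F_def add_mem scale_mem DV algebra_simps)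
    also have "\<dots> \<le> a * (q f + e / a)" using 1 a by simp
    finally show "q (\<lambda>x. a * f x) \<le> a * q f + e" using a by (simp add: algebra_simps)
  qed
  have below: "q f \<le> r f" if "f \<in> V" for f
    using le[OF that, of "(0, c0)"] c0 by (simp add: I_def F_def)
  have "q (\<lambda>x. 0) \<le> 0" using below[OF zero_mem] sublinear_zero[OF r] by simp
  then have "sublinear q"
    unfolding sublinear_def using add scale_pos by (auto simp: order.order_iff_strict)
  moreover have "q (\<lambda>x. - c x) \<le> - d" if "c \<in> D" for c
    using le[OF minus_mem[OF DV[OF that]], of "(1, c)"] that sublinear_zero[OF r]
    by (simp add: I_def F_def)
  ultimately show ?thesis using that below by blast
qed

definition linear_functional :: "(('a \<Rightarrow> real) \<Rightarrow> real) \<Rightarrow> bool" where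
  "linear_functional \<phi> \<longleftrightarrow> (\<forall>f\<in>V. \<forall>g\<in>V. \<phi> (\<lambda>x. f x + g x) = \<phi> f + \<phi> g) \<and>
     (\<forall>c. \<forall>f\<in>V. \<phi> (\<lambda>x. c * f x) = c * \<phi> f)"

text \<open>Hahn-Banach: a minimal sublinear functional is linear, since lowering it along a single
  vector must leave it unchanged.\<close>

lemma minimal_sublinear_linear:
  assumes r: "sublinear r"
    and min: "\<And>q. \<lbrakk>sublinear q; \<And>f. f \<in> V \<Longrightarrow> q f \<le> r f\<rbrakk> \<Longrightarrow> \<forall>f\<in>V. q f = r f"
  shows "linear_functional r"
proof -
  have odd: "r (\<lambda>x. - h x) = - r h" if h: "h \<in> V" for h
  proof -
    have "convex_subset {h}"
      using h by (auto simp: convex_subset_def distrib_right[symmetric])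
    then obtain q where q: "sublinear q" "\<And>f. f \<in> V \<Longrightarrow> q f \<le> r f" "q (\<lambda>x. - h x) \<le> - r h"
      using sublinear_lowered[OF r, of "{h}" "r h"] by auto
    then have "r (\<lambda>x. - h x) \<le> - r h" using min[OF q(1,2)] minus_mem[OF h] by auto
    then show ?thesis using sublinear_ge_minus[OF r h] by linarith
  qed
  have "r (\<lambda>x. f x + g x) = r f + r g" if "f \<in> V" "g \<in> V" for f g
  proof -
    have "r f \<le> r (\<lambda>x. f x + g x) + r (\<lambda>x. - g x)"
      using sublinear_add[OF r add_mem minus_mem, OF that that(2)] by simp
    then show ?thesis using odd[OF that(2)] sublinear_add[OF r that] by linarith
  qed
  moreover have "r (\<lambda>x. c * f x) = c * r f" if f: "f \<in> V" for c f
  proof (cases c "0::real" rule: linorder_cases)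
    case less
    then show ?thesis
      using sublinear_scale[OF r f, of "-c"] odd[OF scale_mem[OF f, of "-c"]] by simp
  qed (use sublinear_scale[OF r f] sublinear_zero[OF r] in auto)
  ultimately show ?thesis by (simp add: linear_functional_def)
qed

text \<open>Zorn's lemma for the sublinear functionals below \<open>q\<close>, with the order
  reversed so that a maximal element is a minimal functional. Members of \<open>A\<close> vanish
  outside \<open>V\<close>, so the order, which compares values at all functions, depends on
  \<open>V\<close> only.\<close>

lemma sublinear_dominates_linear:
  assumes q: "sublinear q"
  obtains \<phi> where "linear_functional \<phi>" "\<And>f. f \<in> V \<Longrightarrow> \<phi> f \<le> q f"
proof -
  define A where "A = {r. sublinear r \<and> (\<forall>f\<in>V. r f \<le> q f) \<and> (\<forall>f. f \<notin> V \<longrightarrow> r f = 0)}"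
  define P where "P r s \<longleftrightarrow> (\<forall>f. s f \<le> r f)" for r s :: "('a \<Rightarrow> real) \<Rightarrow> real"
  define q0 where "q0 f = (if f \<in> V then q f else 0)" for f
  have q0: "q0 \<in> A" using q by (auto simp: A_def q0_def sublinear_def add_mem scale_mem)
  have "partial_order_on A (relation_of P A)"
  proof (rule partial_order_on_relation_ofI)
    fix a b c assume "P a b" "P b c"
    then show "P a c" unfolding P_def by (meson order_trans)
  next
    fix a b assume "P a b" "P b a"
    then show "a = b" unfolding P_def by (intro ext antisym) auto
  qed (simp add: P_def)
  moreover have "\<exists>u\<in>A. \<forall>a\<in>C. P a u" if C: "C \<in> Chains (relation_of P A)" for C
  proof (cases "C = {}")
    case True then show ?thesis using q0 by auto
  next
    case False
    have CA: "C \<subseteq> A" using C Chains_relation_of by blast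
    have tot: "P a b \<or> P b a" if "a \<in> C" "b \<in> C" for a b
      using C that by (auto simp: Chains_def relation_of_def)
    have lower: "- q (\<lambda>x. - f x) \<le> a f" if "a \<in> C" "f \<in> V" for a f
    proof -
      have "a (\<lambda>x. - f x) \<le> q (\<lambda>x. - f x)" "sublinear a"
        using CA that minus_mem[OF that(2)] by (auto simp: A_def)
      then show ?thesis using sublinear_ge_minus[of a f] that by linarith
    qed
    \<comment> \<open>The pointwise infimum of the chain is finite by the common lower bound
      \<open>- q (- f)\<close>. Subadditivity uses totality: near minimizers at \<open>f\<close> and
      at \<open>g\<close> are replaced by the smaller of the two.\<close>
    define u where "u f = (if f \<in> V then INF a\<in>C. a f else 0)" for f
    have u_le: "u f \<le> a f" if "a \<in> C" "f \<in> V" for a f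
      using that lower unfolding u_def by (auto intro!: cINF_lower bdd_belowI2)
    have u_lt: "\<exists>a\<in>C. a f < s" if "u f < s" "f \<in> V" for f s
      using that lower False unfolding u_def
      by (simp, subst (asm) cINF_less_iff) (auto intro!: bdd_belowI2)
    have "u (\<lambda>x. f x + g x) \<le> u f + u g" if fg: "f \<in> V" "g \<in> V" for f g
    proof (rule field_le_epsilon)
      fix e :: real assume "e > 0"
      obtain a where a: "a \<in> C" "a f < u f + e/2" using u_lt[of f "u f + e/2"] fg \<open>e > 0\<close> by auto
      obtain b where b: "b \<in> C" "b g < u g + e/2" using u_lt[of g "u g + e/2"] fg \<open>e > 0\<close> by auto
      obtain c where c: "c \<in> C" "P a c" "P b c" using tot[OF a(1) b(1)] a b by (auto simp: P_def)
      have "u (\<lambda>x. f x + g x) \<le> c (\<lambda>x. f x + g x)" using u_le c add_mem fg by blast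
      also have "\<dots> \<le> c f + c g" using CA c fg sublinear_add by (auto simp: A_def)
      also have "\<dots> \<le> a f + b g" using c by (simp add: P_def add_mono)
      finally show "u (\<lambda>x. f x + g x) \<le> u f + u g + e" using a b by linarith
    qed
    moreover have "u (\<lambda>x. c * f x) \<le> c * u f" if f: "f \<in> V" and c: "c \<ge> 0" for c f
    proof (cases "c = 0")
      case True
      obtain a where "a \<in> C" using False by auto
      then show ?thesis using True u_le[of a "\<lambda>x. 0"] zero_mem CA sublinear_zero[of a]
        by (auto simp: A_def)
    next
      case False
      with c have c: "c > 0" by simp
      show ?thesis
      proof (rule field_le_epsilon)
        fix e :: real assume "e > 0"
        obtain a where a: "a \<in> C" "a f < u f + e/c"
          using u_lt[of f "u f + e/c"] f \<open>e > 0\<close> c by auto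
        have "u (\<lambda>x. c * f x) \<le> a (\<lambda>x. c * f x)" using u_le a scale_mem f by blast
        also have "\<dots> = c * a f" using CA a f c sublinear_scale by (auto simp: A_def)
        also have "\<dots> \<le> c * (u f + e/c)" using a c by simp
        finally show "u (\<lambda>x. c * f x) \<le> c * u f + e" using c by (simp add: algebra_simps)
      qed
    qed
    moreover have "u f \<le> q f" if "f \<in> V" for f
    proof -
      obtain a where "a \<in> C" using False by auto
      then show ?thesis using u_le[of a f] CA that by (force simp: A_def)
    qed
    ultimately have "u \<in> A" by (simp add: A_def sublinear_def u_def)
    moreover have "P a u" if "a \<in> C" for a
      using u_le[OF that] CA that by (auto simp: P_def A_def u_def)
    ultimately show ?thesis by blast
  qed
  ultimately obtain m where m: "m \<in> A" "\<forall>a\<in>A. P m a \<longrightarrow> a = m"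
    using predicate_Zorn[of A P] by blast
  have "linear_functional m"
  proof (rule minimal_sublinear_linear)
    show "sublinear m" using m by (simp add: A_def)
  next
    fix s assume s: "sublinear s" "\<And>f. f \<in> V \<Longrightarrow> s f \<le> m f"
    define s0 where "s0 f = (if f \<in> V then s f else 0)" for f
    have "sublinear s0" using s(1) by (simp add: sublinear_def s0_def add_mem scale_mem)
    moreover have "s0 f \<le> q f" if "f \<in> V" for f
      using s(2)[OF that] m(1) that by (fastforce simp: A_def s0_def)
    ultimately have "s0 \<in> A" by (simp add: A_def s0_def)
    moreover have "P m s0" using s m by (auto simp: P_def s0_def A_def)
    ultimately have "s0 = m" using m by blast
    moreover have "\<forall>f\<in>V. s f = s0 f" by (simp add: s0_def)
    ultimately show "\<forall>f\<in>V. s f = m f" by simp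
  qed
  then show ?thesis using that[of m] m by (simp add: A_def)
qed

section \<open>Duality and the weak topology\<close>

lemma dualD:
  assumes "\<phi> \<in> dual E"
  shows dual_add: "\<lbrakk>f \<in> V; g \<in> V\<rbrakk> \<Longrightarrow> \<phi> (\<lambda>x. f x + g x) = \<phi> f + \<phi> g"
    and dual_scale: "f \<in> V \<Longrightarrow> \<phi> (\<lambda>x. c * f x) = c * \<phi> f"
  using assms by (auto simp: dual_def)

lemma dual_zero: "\<phi> \<in> dual E \<Longrightarrow> \<phi> (\<lambda>x. 0) = 0"
  using dual_scale[OF _ zero_mem, of \<phi> 0] by simp

lemma dual_minus: "\<lbrakk>\<phi> \<in> dual E; f \<in> V\<rbrakk> \<Longrightarrow> \<phi> (\<lambda>x. - f x) = - \<phi> f"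
  using dual_scale[of \<phi> f "-1"] by simp

lemma dual_diff: "\<lbrakk>\<phi> \<in> dual E; f \<in> V; g \<in> V\<rbrakk> \<Longrightarrow> \<phi> (\<lambda>x. f x - g x) = \<phi> f - \<phi> g"
  using dual_add[OF _ _ minus_mem, of \<phi> f g] by (simp add: dual_minus[of \<phi>])

lemma dual_sum:
  "\<lbrakk>\<phi> \<in> dual E; \<And>i. i \<in> I \<Longrightarrow> f i \<in> V\<rbrakk> \<Longrightarrow> \<phi> (\<lambda>x. \<Sum>i\<in>I. f i x) = (\<Sum>i\<in>I. \<phi> (f i))"
proof (induction I rule: infinite_finite_induct)
  case (insert i I)
  then have "\<phi> (\<lambda>x. f i x + (\<Sum>i\<in>I. f i x)) = \<phi> (f i) + \<phi> (\<lambda>x. \<Sum>i\<in>I. f i x)"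
    by (intro dual_add sum_mem) auto
  with insert show ?case by simp
qed (simp_all add: dual_zero[of \<phi>])

lemma dual_bound:
  assumes "\<phi> \<in> dual E"
  shows "\<exists>C\<ge>0. \<forall>f\<in>V. \<bar>\<phi> f\<bar> \<le> C * N f"
proof -
  obtain C where C: "\<forall>f\<in>V. \<bar>\<phi> f\<bar> \<le> C * N f" using assms by (auto simp: dual_def)
  have "\<bar>\<phi> f\<bar> \<le> \<bar>C\<bar> * N f" if "f \<in> V" for f
  proof -
    have "\<bar>\<phi> f\<bar> \<le> C * N f" using C that by blast
    also have "\<dots> \<le> \<bar>C\<bar> * N f" using norm_nonneg[OF that] by (intro mult_right_mono) auto
    finally show ?thesis .
  qed
  then show ?thesis by (intro exI[of _ "\<bar>C\<bar>"]) auto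
qed

lemma dual_cong:
  assumes "\<phi> \<in> dual E" "f \<in> V" "g \<in> V" "N (\<lambda>x. f x - g x) = 0"
  shows "\<phi> f = \<phi> g"
proof -
  obtain C where C: "C \<ge> 0" "\<And>f. f \<in> V \<Longrightarrow> \<bar>\<phi> f\<bar> \<le> C * N f" using dual_bound[OF assms(1)] by blast
  from C(2)[OF diff_mem[OF assms(2,3)]] show ?thesis
    using assms by (simp add: dual_diff[OF assms(1)])
qed

lemma dualI:
  assumes "linear_functional \<phi>" "\<And>f. f \<in> V \<Longrightarrow> \<phi> f \<le> C * N f"
  shows "\<phi> \<in> dual E" "\<And>f. f \<in> V \<Longrightarrow> \<bar>\<phi> f\<bar> \<le> C * N f"
proof -
  show bd: "\<bar>\<phi> f\<bar> \<le> C * N f" if f: "f \<in> V" for f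
  proof -
    have "\<phi> (\<lambda>x. (-1) * f x) = (-1) * \<phi> f"
      using assms(1) f unfolding linear_functional_def by blast
    then have "- \<phi> f = \<phi> (\<lambda>x. - f x)" by simp
    also have "\<dots> \<le> C * N f" using assms(2)[OF minus_mem[OF f]] norm_minus[OF f] by simp
    finally show ?thesis using assms(2)[OF f] by linarith
  qed
  then show "\<phi> \<in> dual E" using assms(1) by (auto simp: linear_functional_def dual_def)
qed

lemma dual_lincomb:
  assumes "\<And>j. j \<in> J \<Longrightarrow> \<phi> j \<in> dual E"
  shows "(\<lambda>f. \<Sum>j\<in>J. b j * \<phi> j f) \<in> dual E"
  using assms
proof (induction J rule: infinite_finite_induct)
  case (insert j J)
  have 1: "\<phi> j \<in> dual E" using insert by blast
  have 2: "(\<lambda>f. \<Sum>j\<in>J. b j * \<phi> j f) \<in> dual E" (is "?\<psi> \<in> _") using insert by blast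
  obtain C where C: "C \<ge> 0" "\<And>f. f \<in> V \<Longrightarrow> \<bar>\<phi> j f\<bar> \<le> C * N f" using dual_bound[OF 1] by blast
  obtain D where D: "D \<ge> 0" "\<And>f. f \<in> V \<Longrightarrow> \<bar>?\<psi> f\<bar> \<le> D * N f" using dual_bound[OF 2] by blast
  have "\<bar>b j * \<phi> j f + ?\<psi> f\<bar> \<le> (\<bar>b j\<bar> * C + D) * N f" if "f \<in> V" for f
  proof -
    have "\<bar>b j * \<phi> j f + ?\<psi> f\<bar> \<le> \<bar>b j\<bar> * \<bar>\<phi> j f\<bar> + \<bar>?\<psi> f\<bar>"
      using abs_triangle_ineq[of "b j * \<phi> j f" "?\<psi> f"] by (simp only: abs_mult)
    also have "\<dots> \<le> \<bar>b j\<bar> * (C * N f) + D * N f"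
      using C(2)[OF that] D(2)[OF that] by (intro add_mono mult_left_mono) auto
    finally show ?thesis by (simp add: algebra_simps)
  qed
  then have "\<exists>C. \<forall>f\<in>V. \<bar>b j * \<phi> j f + ?\<psi> f\<bar> \<le> C * N f" by blast
  then have "(\<lambda>f. b j * \<phi> j f + ?\<psi> f) \<in> dual E"
    using dual_add[OF 1] dual_add[OF 2] dual_scale[OF 1] dual_scale[OF 2]
    unfolding dual_def by (simp add: algebra_simps)
  then show ?case using insert by simp
qed (auto simp: dual_def intro!: exI[of _ 0])

text \<open>A linear functional below the norm lowered along \<open>D\<close>: being below the norm
  it has norm at most 1, and its value at \<open>- c\<close> is at most \<open>- d\<close>.\<close>

lemma separating_functional:
  assumes D: "convex_subset D" and d: "\<And>c. c \<in> D \<Longrightarrow> d \<le> N c"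
  shows "\<exists>\<phi>\<in>dual E. (\<forall>f\<in>V. \<bar>\<phi> f\<bar> \<le> N f) \<and> (\<forall>c\<in>D. d \<le> \<phi> c)"
proof -
  obtain q where q: "sublinear q" "\<And>f. f \<in> V \<Longrightarrow> q f \<le> N f" "\<And>c. c \<in> D \<Longrightarrow> q (\<lambda>x. - c x) \<le> - d"
    using sublinear_lowered[OF sublinear_norm D d] by blast
  obtain \<phi> where \<phi>: "linear_functional \<phi>" "\<And>f. f \<in> V \<Longrightarrow> \<phi> f \<le> q f"
    using sublinear_dominates_linear[OF q(1)] by blast
  have le: "\<phi> f \<le> 1 * N f" if "f \<in> V" for f using \<phi>(2)[OF that] q(2)[OF that] by linarith
  note dual = dualI[OF \<phi>(1) le]
  have "d \<le> \<phi> c" if "c \<in> D" for c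
  proof -
    have "c \<in> V" using D that by (auto simp: convex_subset_def)
    then show ?thesis
      using q(3)[OF that] \<phi>(2)[OF minus_mem[of c]] dual_minus[OF dual(1)] by force
  qed
  with dual show ?thesis by auto
qed

lemma norming_functional:
  assumes "f \<in> V"
  shows "\<exists>\<phi>\<in>dual E. (\<forall>g\<in>V. \<bar>\<phi> g\<bar> \<le> N g) \<and> \<phi> f = N f"
proof -
  have "convex_subset {f}" using assms by (auto simp: convex_subset_def distrib_right[symmetric])
  from separating_functional[OF this, of "N f"] obtain \<phi> where
    \<phi>: "\<phi> \<in> dual E" "\<And>f. f \<in> V \<Longrightarrow> \<bar>\<phi> f\<bar> \<le> N f" "N f \<le> \<phi> f" by auto
  have "\<phi> f = N f" using \<phi>(2)[OF assms] \<phi>(3) by linarith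
  with \<phi> show ?thesis by blast
qed

lemma zero_in_ball: "(\<lambda>x. 0) \<in> fball E"
  by (simp add: fball_def zero_mem norm_zero)

lemma ball_memD: "f \<in> fball E \<Longrightarrow> f \<in> V" "f \<in> fball E \<Longrightarrow> N f \<le> 1"
  by (auto simp: fball_def)

lemma dual_norm_upper: "\<lbrakk>\<phi> \<in> dual E; f \<in> fball E\<rbrakk> \<Longrightarrow> \<bar>\<phi> f\<bar> \<le> dual_norm E \<phi>"
proof -
  assume a: "\<phi> \<in> dual E" "f \<in> fball E"
  obtain C where C: "C \<ge> 0" "\<And>f. f \<in> V \<Longrightarrow> \<bar>\<phi> f\<bar> \<le> C * N f" using dual_bound[OF a(1)] by blast
  have "\<bar>\<phi> g\<bar> \<le> C" if "g \<in> fball E" for g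
    using C(2)[of g] mult_left_mono[OF ball_memD(2)[OF that] C(1)] ball_memD(1)[OF that] by linarith
  then show ?thesis
    unfolding dual_norm_def using a by (intro cSUP_upper bdd_aboveI2) auto
qed

lemma dual_norm_bound:
  assumes "\<phi> \<in> dual E" "f \<in> V"
  shows "\<bar>\<phi> f\<bar> \<le> dual_norm E \<phi> * N f"
proof (cases "N f = 0")
  case True
  obtain C where C: "C \<ge> 0" "\<And>f. f \<in> V \<Longrightarrow> \<bar>\<phi> f\<bar> \<le> C * N f" using dual_bound[OF assms(1)] by blast
  show ?thesis using True C(2)[OF assms(2)] by simp
next
  case False
  then have pos: "N f > 0" using norm_nonneg[OF assms(2)] by simp
  have "(\<lambda>x. inverse (N f) * f x) \<in> fball E"
    using assms pos by (simp add: fball_def scale_mem norm_scale)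
  from dual_norm_upper[OF assms(1) this] have "inverse (N f) * \<bar>\<phi> f\<bar> \<le> dual_norm E \<phi>"
    using pos by (simp only: dual_scale[OF assms] abs_mult) simp
  then show ?thesis using pos by (simp add: field_simps)
qed

lemma dual_norm_le:
  assumes "\<And>f. f \<in> fball E \<Longrightarrow> \<bar>\<phi> f\<bar> \<le> C"
  shows "dual_norm E \<phi> \<le> C"
  unfolding dual_norm_def using assms zero_in_ball by (intro cSUP_least) auto

lemma dual_norm_scale:
  assumes "\<phi> \<in> dual E" "c > 0"
  shows "(\<lambda>f. c * \<phi> f) \<in> dual E" "dual_norm E (\<lambda>f. c * \<phi> f) = c * dual_norm E \<phi>"
proof -
  show D: "(\<lambda>f. c * \<phi> f) \<in> dual E" using dual_lincomb[of "{0::nat}" "\<lambda>_. \<phi>" "\<lambda>_. c"] assms by simp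
  show "dual_norm E (\<lambda>f. c * \<phi> f) = c * dual_norm E \<phi>"
  proof (rule antisym)
    show "dual_norm E (\<lambda>f. c * \<phi> f) \<le> c * dual_norm E \<phi>"
      using dual_norm_upper[OF assms(1)] assms(2) by (intro dual_norm_le) (simp add: abs_mult)
    have "dual_norm E \<phi> \<le> dual_norm E (\<lambda>f. c * \<phi> f) / c"
      using dual_norm_upper[OF D] assms(2)
      by (intro dual_norm_le) (simp add: abs_mult field_simps)
    then show "c * dual_norm E \<phi> \<le> dual_norm E (\<lambda>f. c * \<phi> f)"
      using assms(2) by (simp add: field_simps)
  qed
qed

lemma dual_norm_less:
  assumes "\<phi> \<in> dual E" "s < dual_norm E \<phi>"
  obtains f where "f \<in> fball E" "s < \<phi> f"
proof -
  obtain f where f: "f \<in> fball E" "s < \<bar>\<phi> f\<bar>"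
    using assms dual_norm_le[of \<phi> s] by (meson not_le)
  have "(\<lambda>x. - f x) \<in> fball E" "\<phi> (\<lambda>x. - f x) = - \<phi> f"
    using ball_memD[OF f(1)] assms by (auto simp: fball_def minus_mem norm_minus dual_minus[OF assms(1)])
  then show ?thesis using f that[of f] that[of "\<lambda>x. - f x"] by (cases "\<phi> f \<ge> 0") auto
qed

section \<open>The weak topology on representatives\<close>

lemma topspace_weak: "topspace (weak_topology E) = V"
proof -
  have "(\<lambda>f. 0) \<in> dual E" by (auto simp: dual_def intro!: exI[of _ 0])
  then have "V \<in> {{f \<in> V. \<phi> f \<in> U} |\<phi> U. \<phi> \<in> dual E \<and> open U}"
    by (auto intro!: exI[of _ "\<lambda>f. 0"] exI[of _ UNIV])
  then show ?thesis unfolding weak_topology_def topology_generated_by_topspace by blast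
qed

lemma openin_weak_basic:
  "\<lbrakk>\<phi> \<in> dual E; open U\<rbrakk> \<Longrightarrow> openin (weak_topology E) {f \<in> V. \<phi> f \<in> U}"
  unfolding weak_topology_def by (intro topology_generated_by_Basis) auto

text \<open>Functionals agree on functions at distance zero, and this passes from subbasic sets to
  all open sets. It lets a cover of one representative per class cover the whole class.\<close>

lemma openin_weak_saturated:
  assumes "openin (weak_topology E) U" "f \<in> U" "g \<in> V" "N (\<lambda>x. f x - g x) = 0"
  shows "g \<in> U"
proof -
  have "generate_topology_on {{f \<in> V. \<phi> f \<in> U} |\<phi> U. \<phi> \<in> dual E \<and> open U} U"
    using assms(1) unfolding weak_topology_def by (rule openin_topology_generated_by)
  then show ?thesis using assms(2)
  proof induction
    case (Basis S)
    then obtain \<phi> W where "S = {f \<in> V. \<phi> f \<in> W}" "\<phi> \<in> dual E" by blast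
    then show ?case using dual_cong[of \<phi> f g] assms Basis by auto
  qed auto
qed

text \<open>Otherwise every point of \<open>K\<close> has a neighbourhood visited finitely often,
  and finitely many of these cover \<open>K\<close>. A cluster point, the same for all functionals,
  is enough later; no convergent subsequence is extracted.\<close>

lemma compactin_weak_cluster:
  assumes K: "compactin (weak_topology E) K" and k: "\<And>n::nat. k n \<in> K"
  obtains v where "v \<in> K"
    "\<And>\<phi> d m. \<lbrakk>\<phi> \<in> dual E; d > 0\<rbrakk> \<Longrightarrow> \<exists>n\<ge>m. \<bar>\<phi> (k n) - \<phi> v\<bar> < d"
proof -
  have KV: "K \<subseteq> V" using compactin_subset_topspace[OF K] topspace_weak by simp
  have "\<exists>v\<in>K. \<forall>U. openin (weak_topology E) U \<and> v \<in> U \<longrightarrow> infinite {n. k n \<in> U}"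
  proof (rule ccontr)
    assume "\<not> ?thesis"
    then have "\<forall>v\<in>K. \<exists>U. openin (weak_topology E) U \<and> v \<in> U \<and> finite {n. k n \<in> U}" by blast
    then obtain U where U: "\<And>v. v \<in> K \<Longrightarrow> openin (weak_topology E) (U v)"
      "\<And>v. v \<in> K \<Longrightarrow> v \<in> U v" "\<And>v. v \<in> K \<Longrightarrow> finite {n. k n \<in> U v}" by metis
    have cover: "\<exists>F. finite F \<and> F \<subseteq> \<U> \<and> K \<subseteq> \<Union>F"
      if "\<forall>W\<in>\<U>. openin (weak_topology E) W" "K \<subseteq> \<Union>\<U>" for \<U>
      using K that by (simp add: compactin_def)
    have "\<forall>W\<in>U ` K. openin (weak_topology E) W" using U(1) by simp
    moreover have "K \<subseteq> \<Union> (U ` K)" using U(2) by auto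
    ultimately have "\<exists>F. finite F \<and> F \<subseteq> U ` K \<and> K \<subseteq> \<Union>F" by (rule cover)
    then obtain F where F: "finite F" "F \<subseteq> U ` K" "K \<subseteq> \<Union>F" by blast
    have "n \<in> (\<Union>W\<in>F. {n. k n \<in> W})" for n using subsetD[OF F(3) k[of n]] by auto
    then have "UNIV \<subseteq> (\<Union>W\<in>F. {n. k n \<in> W})" by blast
    moreover have "finite (\<Union>W\<in>F. {n. k n \<in> W})" using F U(3) by (intro finite_UN_I) auto
    ultimately show False using finite_subset infinite_UNIV_nat by blast
  qed
  then obtain v where v: "v \<in> K"
    "\<And>U. openin (weak_topology E) U \<Longrightarrow> v \<in> U \<Longrightarrow> infinite {n. k n \<in> U}" by blast
  have "\<exists>n\<ge>m. \<bar>\<phi> (k n) - \<phi> v\<bar> < d" if \<phi>: "\<phi> \<in> dual E" and "d > 0" for \<phi> d m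
  proof -
    have "infinite {n. k n \<in> {f \<in> V. \<phi> f \<in> ball (\<phi> v) d}}"
      using v(1) KV \<open>d > 0\<close> by (intro v(2) openin_weak_basic[OF \<phi>]) auto
    then obtain n where "n \<ge> m" "k n \<in> {f \<in> V. \<phi> f \<in> ball (\<phi> v) d}"
      unfolding infinite_nat_iff_unbounded_le by blast
    then show ?thesis by (auto simp: dist_real_def abs_minus_commute)
  qed
  with v(1) that show ?thesis by blast
qed

text \<open>Condition (3) after the pair \<open>(f, g)\<close> has been replaced by its product, so
  that it speaks of one space only.\<close>

definition slice_condition :: bool where
  "slice_condition \<longleftrightarrow> (\<forall>z\<in>fsphere E. \<forall>\<phi>\<in>dual_sphere E. \<forall>\<epsilon>>0.
     \<exists>h\<in>fball E. \<phi> h \<ge> 1 - \<epsilon> \<and> N (\<lambda>x. z x + h x) \<ge> 2 - 2 * \<epsilon>)"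

text \<open>For \<open>t \<le> 1\<close> remove \<open>(1 - t) * z\<close> from
  \<open>z + h\<close>; for \<open>t > 1\<close> remove \<open>(t - 1) * h\<close> from
  \<open>t * (z + h)\<close>. The losses \<open>e\<close> and \<open>t * e\<close> are both at most
  \<open>(t + 1) * e\<close>, because the norm of \<open>z + h\<close> is at most 2 and this forces
  \<open>e \<ge> 0\<close>.\<close>

lemma norm_add_scaled_ge:
  assumes z: "z \<in> V" "N z \<le> 1" and h: "h \<in> V" "N h \<le> 1" and t: "t \<ge> 0"
    and zh: "N (\<lambda>x. z x + h x) \<ge> 2 - e"
  shows "N (\<lambda>x. t * z x + h x) \<ge> t + 1 - (t + 1) * e"
proof (cases "t \<le> 1")
  case True
  have "N (\<lambda>x. z x + h x) \<le> N (\<lambda>x. t * z x + h x) + N (\<lambda>x. (z x + h x) - (t * z x + h x))"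
    using z h by (intro norm_le_diff add_mem scale_mem) auto
  also have "(\<lambda>x. (z x + h x) - (t * z x + h x)) = (\<lambda>x. (1 - t) * z x)" by (simp add: algebra_simps)
  also have "N \<dots> \<le> 1 - t"
    using norm_scale[OF z(1), of "1 - t"] mult_left_mono[OF z(2), of "1 - t"] True by simp
  finally have "N (\<lambda>x. t * z x + h x) \<ge> t + 1 - e" using zh by linarith
  moreover have "N (\<lambda>x. z x + h x) \<le> 2" using norm_add[OF z(1) h(1)] z h by linarith
  moreover have "0 \<le> N (\<lambda>x. t * z x + h x)" using z h by (intro norm_nonneg add_mem scale_mem) auto
  ultimately show ?thesis
  proof -
    assume a: "N (\<lambda>x. t * z x + h x) \<ge> t + 1 - e" "N (\<lambda>x. z x + h x) \<le> 2"
    then have "e \<ge> 0" using zh by linarith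
    then have "t * e \<ge> 0" using t by simp
    then show ?thesis using a by (simp add: algebra_simps)
  qed
next
  case False
  have "t * (2 - e) \<le> t * N (\<lambda>x. z x + h x)" using zh t by (intro mult_left_mono) auto
  also have "\<dots> = N (\<lambda>x. t * (z x + h x))" using norm_scale[OF add_mem] z h t by simp
  also have "\<dots> \<le> N (\<lambda>x. t * z x + h x) + N (\<lambda>x. t * (z x + h x) - (t * z x + h x))"
    using z h by (intro norm_le_diff add_mem scale_mem) auto
  also have "(\<lambda>x. t * (z x + h x) - (t * z x + h x)) = (\<lambda>x. (t - 1) * h x)" by (simp add: algebra_simps)
  also have "N \<dots> \<le> t - 1"
    using norm_scale[OF h(1), of "t - 1"] mult_left_mono[OF h(2), of "t - 1"] False by simp
  finally have a: "N (\<lambda>x. t * z x + h x) \<ge> t + 1 - t * e" by (simp add: algebra_simps)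
  have "N (\<lambda>x. z x + h x) \<le> 2" using norm_add[OF z(1) h(1)] z h by linarith
  then have "e \<ge> 0" using zh by linarith
  then show ?thesis using a by (simp add: algebra_simps)
qed

text \<open>The slice condition freed of normalizations: \<open>a\<close> and \<open>\<phi>\<close>
  are arbitrary. A vector that almost attains the norm of \<open>\<phi>\<close> does at least as
  well as any \<open>y\<close> in the ball, up to \<open>\<delta>\<close>. The vector
  \<open>f0\<close> supplies a point of the sphere when \<open>a\<close> is null.\<close>

lemma slice_condition_ball:
  assumes S: "slice_condition" and ne: "f0 \<in> V" "N f0 \<noteq> 0"
    and a: "a \<in> V" and \<phi>: "\<phi> \<in> dual E" and y: "y \<in> fball E" and \<delta>: "\<delta> > 0" and \<eta>: "\<eta> > 0"
  obtains v where "v \<in> fball E" "\<phi> v \<ge> \<phi> y - \<delta>" "N (\<lambda>x. a x + v x) \<ge> N a + 1 - \<eta>"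
proof -
  have unit: "(\<lambda>x. inverse (N f) * f x) \<in> fsphere E" if "f \<in> V" "N f \<noteq> 0" for f
    using that norm_nonneg[OF that(1)] by (auto simp: fsphere_def scale_mem norm_scale)
  obtain z where z: "z \<in> fsphere E" "a = (\<lambda>x. N a * z x) \<or> N a = 0"
  proof (cases "N a = 0")
    case True then show ?thesis using unit[OF ne] that by blast
  next
    case False
    then have "a = (\<lambda>x. N a * (inverse (N a) * a x))" by (simp add: fun_eq_iff)
    then show ?thesis using unit[OF a False] that by blast
  qed
  have zV: "z \<in> V" "N z = 1" using z by (auto simp: fsphere_def)
  \<comment> \<open>A functional of norm zero vanishes on the ball, so any functional of norm one,
    such as one norming \<open>z\<close>, may stand in for its normalization.\<close>
  have "\<exists>\<psi>\<in>dual_sphere E. \<phi> = (\<lambda>f. dual_norm E \<phi> * \<psi> f) \<or> (\<forall>f\<in>fball E. \<phi> f = 0)"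
  proof (cases "dual_norm E \<phi> = 0")
    case True
    then have "\<forall>f\<in>fball E. \<phi> f = 0" using dual_norm_upper[OF \<phi>] by fastforce
    moreover obtain \<psi> where \<psi>: "\<psi> \<in> dual E" "\<And>g. g \<in> V \<Longrightarrow> \<bar>\<psi> g\<bar> \<le> N g" "\<psi> z = N z"
      using norming_functional[OF zV(1)] by blast
    have "dual_norm E \<psi> = 1"
    proof (rule antisym)
      show "dual_norm E \<psi> \<le> 1" using \<psi>(2) by (intro dual_norm_le) (force simp: fball_def)
      show "1 \<le> dual_norm E \<psi>" using dual_norm_upper[OF \<psi>(1), of z] \<psi> zV by (simp add: fball_def)
    qed
    ultimately show ?thesis using \<psi> by (auto simp: dual_sphere_def)
  next
    case False
    have pos: "dual_norm E \<phi> > 0"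
      using False dual_norm_upper[OF \<phi> zero_in_ball] by linarith
    then have "(\<lambda>f. inverse (dual_norm E \<phi>) * \<phi> f) \<in> dual_sphere E"
      using dual_norm_scale[OF \<phi>, of "inverse (dual_norm E \<phi>)"] by (simp add: dual_sphere_def)
    moreover have "\<phi> = (\<lambda>f. dual_norm E \<phi> * (inverse (dual_norm E \<phi>) * \<phi> f))"
      using False by (simp add: fun_eq_iff)
    ultimately show ?thesis by (intro bexI[of _ "\<lambda>f. inverse (dual_norm E \<phi>) * \<phi> f"]) auto
  qed
  then obtain \<psi> where \<psi>: "\<psi> \<in> dual_sphere E"
    "\<phi> = (\<lambda>f. dual_norm E \<phi> * \<psi> f) \<or> (\<forall>f\<in>fball E. \<phi> f = 0)" by blast
  define M where "M = 1 + dual_norm E \<phi>"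
  have dn: "dual_norm E \<phi> \<ge> 0" using dual_norm_upper[OF \<phi> zero_in_ball] by linarith
  \<comment> \<open>The first bound limits the loss in \<open>\<phi>\<close>; the 1 in
    \<open>M\<close> keeps the denominator positive. The second is the loss
    \<open>(N a + 1) * (2 * e)\<close> of \<open>norm_add_scaled_ge\<close> solved for
    \<open>\<eta>\<close>.\<close>
  define e where "e = min (\<delta> / M) (\<eta> / (2 * (N a + 1)))"
  have Na: "N a \<ge> 0" using norm_nonneg[OF a] .
  have e: "e > 0" "e \<le> \<delta> / M" "e \<le> \<eta> / (2 * (N a + 1))" using \<delta> \<eta> dn Na by (auto simp: e_def M_def)
  obtain h where h: "h \<in> fball E" "\<psi> h \<ge> 1 - e" "N (\<lambda>x. z x + h x) \<ge> 2 - 2 * e"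
    using S z(1) \<psi>(1) e(1) unfolding slice_condition_def by blast
  note hV = ball_memD[OF h(1)]
  have "\<phi> h \<ge> \<phi> y - \<delta>"
    using \<psi>(2)
  proof
    assume eq: "\<phi> = (\<lambda>f. dual_norm E \<phi> * \<psi> f)"
    have "dual_norm E \<phi> * e \<le> \<delta>"
      using e(1,2) dn by (simp add: M_def field_simps)
    moreover have "dual_norm E \<phi> * (1 - e) \<le> dual_norm E \<phi> * \<psi> h"
      using h(2) dn by (intro mult_left_mono) auto
    moreover have "\<phi> y \<le> dual_norm E \<phi>" using dual_norm_upper[OF \<phi> y] by linarith
    moreover have "\<phi> h = dual_norm E \<phi> * \<psi> h" using eq by metis
    ultimately show ?thesis by (simp add: algebra_simps)
  qed (use h y \<delta> in simp)
  moreover have "N (\<lambda>x. a x + h x) \<ge> N a + 1 - \<eta>"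
  proof -
    have *: "(N a + 1) * (2 * e) \<le> \<eta>" using e(3) Na by (simp add: field_simps)
    have ge: "N (\<lambda>x. N a * z x + h x) \<ge> N a + 1 - (N a + 1) * (2 * e)"
      using norm_add_scaled_ge[OF zV(1) _ hV Na h(3)] zV by simp
    from z(2) show ?thesis
    proof
      assume "a = (\<lambda>x. N a * z x)"
      then have "(\<lambda>x. a x + h x) = (\<lambda>x. N a * z x + h x)" by (metis (no_types))
      then show ?thesis using ge * by simp
    next
      assume 0: "N a = 0"
      have "N (\<lambda>x. N a * z x + h x) \<le> N (\<lambda>x. a x + h x) + N (\<lambda>x. (N a * z x + h x) - (a x + h x))"
        using a zV hV by (intro norm_le_diff add_mem scale_mem) auto
      also have "(\<lambda>x. (N a * z x + h x) - (a x + h x)) = (\<lambda>x. - a x)" by (simp add: 0)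
      finally show ?thesis using ge * 0 norm_minus[OF a] by simp
    qed
  qed
  ultimately show ?thesis using that h(1) by blast
qed

section \<open>Weakly compact operators and the Daugavet equation\<close>

text \<open>A Blackwell approachability estimate: if each new vector \<open>w n\<close> is nearly
  orthogonal to the weighted history, then the averages of \<open>w\<close> tend to zero on every coordinate.\<close>

lemma approachability:
  fixes c :: "nat \<Rightarrow> nat \<Rightarrow> real"
  assumes bd: "\<And>j i. \<bar>c j i\<bar> \<le> M"
    and step: "\<And>n. (\<Sum>j<n. (1/4)^j * (\<Sum>i<n. c j i) * c j n) \<le> 1"
  shows "(\<lambda>n. (\<Sum>i<n. c j i) / n) \<longlonglongrightarrow> 0"
proof -
  \<comment> \<open>A weighted square of the partial sums that admits one new coordinate at each
    step. If \<open>Q\<close> grows at most linearly, the squared average of each fixed coordinate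
    is of order \<open>1 / n\<close>.\<close>
  define Q where "Q n = (\<Sum>j<n. (1/4)^j * (\<Sum>i<n. c j i)\<^sup>2)" for n
  \<comment> \<open>The growth per step: 2 from the doubled cross term, twice the square of
    \<open>M\<close> from the new entries of the old coordinates, whose weights sum to at most 2,
    and once that square from the new coordinate.\<close>
  define D where "D = 2 + 3 * M\<^sup>2"
  have M: "M \<ge> 0" using bd[of 0 0] by linarith
  have sq: "(c j i)\<^sup>2 \<le> M\<^sup>2" for j i using bd[of j i] by (simp add: abs_le_square_iff[symmetric])
  have expand: "(\<Sum>j<n. w j * (a j + b j)\<^sup>2) = (\<Sum>j<n. w j * (a j)\<^sup>2) + 2 * (\<Sum>j<n. w j * a j * b j)
      + (\<Sum>j<n. w j * (b j)\<^sup>2)" for n and w a b :: "nat \<Rightarrow> real"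
    by (simp add: power2_sum distrib_left sum.distrib sum_distrib_left mult_ac)
  have Q: "Q n \<le> D * n" for n
  proof (induction n)
    case (Suc n)
    have "Q (Suc n) = (\<Sum>j<n. (1/4)^j * ((\<Sum>i<n. c j i) + c j n)\<^sup>2)
        + (1/4)^n * (\<Sum>i<Suc n. c n i)\<^sup>2" by (simp add: Q_def)
    also have "(\<Sum>j<n. (1/4)^j * ((\<Sum>i<n. c j i) + c j n)\<^sup>2) =
        Q n + 2 * (\<Sum>j<n. (1/4)^j * (\<Sum>i<n. c j i) * c j n) + (\<Sum>j<n. (1/4)^j * (c j n)\<^sup>2)"
      unfolding Q_def by (rule expand)
    also have "(\<Sum>j<n. (1/4)^j * (c j n)\<^sup>2) \<le> (\<Sum>j<n. (1/4)^j * M\<^sup>2)"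
      using sq by (intro sum_mono mult_left_mono) auto
    also have "(\<Sum>j<n. (1/4::real)^j * M\<^sup>2) = (\<Sum>j<n. (1/4)^j) * M\<^sup>2"
      by (simp add: sum_distrib_right)
    also have "\<dots> \<le> 2 * M\<^sup>2"
    proof (rule mult_right_mono)
      have "(\<Sum>j<n. (1/4::real)^j) = 4/3 - 4/3 * (1/4)^n" by (induction n) auto
      then show "(\<Sum>j<n. (1/4::real)^j) \<le> 2" using zero_le_power[of "1/4::real" n] by linarith
    qed simp
    also have "(1/4)^n * (\<Sum>i<Suc n. c n i)\<^sup>2 \<le> M\<^sup>2"
    proof -
      have "\<bar>\<Sum>i<Suc n. c n i\<bar> \<le> (\<Sum>i<Suc n. \<bar>c n i\<bar>)" by (rule sum_abs)
      also have "\<dots> \<le> (\<Sum>i<Suc n. M)" by (intro sum_mono bd)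
      also have "\<dots> = real (Suc n) * M" by simp
      \<comment> \<open>The new coordinate enters with \<open>n + 1\<close> entries already summed;
        its weight \<open>(1/4)^n\<close> is chosen to cancel the square of this bound.\<close>
      also have "\<dots> \<le> 2 ^ n * M"
      proof (rule mult_right_mono[OF _ M])
        show "real (Suc n) \<le> 2 ^ n"
          using Suc_leI[OF less_exp[of n]] by (metis of_nat_le_iff of_nat_numeral of_nat_power)
      qed
      finally have "(\<Sum>i<Suc n. c n i)\<^sup>2 \<le> (2 ^ n * M)\<^sup>2" by (rule power2_le_iff_abs_le[THEN iffD2, rotated]) (simp add: M)
      also have "\<dots> = (2 ^ n * 2 ^ n) * M\<^sup>2" by (simp add: power2_eq_square)
      also have "\<dots> = 4 ^ n * M\<^sup>2" unfolding power_mult_distrib[symmetric] by simp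
      finally show ?thesis by (simp add: field_simps)
    qed
    finally show ?case using step[of n] Suc by (simp add: D_def algebra_simps)
  qed (simp add: Q_def)
  have D: "D \<ge> 0" by (simp add: D_def)
  have "((\<Sum>i<n. c j i) / n)\<^sup>2 \<le> 4 ^ j * D / n" if "n > j" for n
  proof -
    have "(1/4)^j * (\<Sum>i<n. c j i)\<^sup>2 \<le> Q n"
      unfolding Q_def using that by (intro member_le_sum) auto
    also note Q[of n]
    finally have "(\<Sum>i<n. c j i)\<^sup>2 \<le> 4 ^ j * D * n" by (simp add: field_simps)
    then show ?thesis using that by (simp add: power_divide field_simps power2_eq_square)
  qed
  then have "\<forall>\<^sub>F n in sequentially. norm (((\<Sum>i<n. c j i) / n)\<^sup>2) \<le> 4 ^ j * D / n"
    by (intro eventually_sequentiallyI[of "Suc j"]) auto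
  then have "(\<lambda>n. ((\<Sum>i<n. c j i) / n)\<^sup>2) \<longlonglongrightarrow> 0"
    by (rule Lim_null_comparison) (rule lim_const_over_n)
  from tendsto_real_sqrt[OF this] have "(\<lambda>n. \<bar>(\<Sum>i<n. c j i) / n\<bar>) \<longlonglongrightarrow> 0" by simp
  then show ?thesis by (rule tendsto_rabs_zero_cancel)
qed

text \<open>\<open>T\<close> is linear only up to functions of norm zero; composing it with a functional restores
  exact linearity.\<close>

definition operator_mod_null :: "(('a \<Rightarrow> real) \<Rightarrow> 'a \<Rightarrow> real) \<Rightarrow> real \<Rightarrow> bool" where
  "operator_mod_null T C \<longleftrightarrow> (\<forall>f\<in>V. T f \<in> V) \<and>
     (\<forall>f\<in>V. \<forall>g\<in>V. N (\<lambda>x. T (\<lambda>y. f y + g y) x - (T f x + T g x)) = 0) \<and>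
     (\<forall>c. \<forall>f\<in>V. N (\<lambda>x. T (\<lambda>y. c * f y) x - c * T f x) = 0) \<and>
     (\<forall>f\<in>V. N (T f) \<le> C * N f) \<and> 0 \<le> C"

lemma operator_mod_nullD:
  assumes "operator_mod_null T C"
  shows op_mem: "f \<in> V \<Longrightarrow> T f \<in> V"
    and op_norm_bound: "f \<in> V \<Longrightarrow> N (T f) \<le> C * N f"
    and op_const_nonneg: "0 \<le> C"
    and op_add: "\<lbrakk>f \<in> V; g \<in> V\<rbrakk> \<Longrightarrow> N (\<lambda>x. T (\<lambda>y. f y + g y) x - (T f x + T g x)) = 0"
    and op_scale: "f \<in> V \<Longrightarrow> N (\<lambda>x. T (\<lambda>y. c * f y) x - c * T f x) = 0"
  using assms unfolding operator_mod_null_def by blast+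

lemma dual_op_add:
  assumes T: "operator_mod_null T C" and "\<phi> \<in> dual E" "f \<in> V" "g \<in> V"
  shows "\<phi> (T (\<lambda>y. f y + g y)) = \<phi> (T f) + \<phi> (T g)"
proof -
  have "\<phi> (T (\<lambda>y. f y + g y)) = \<phi> (\<lambda>x. T f x + T g x)"
    by (rule dual_cong[OF assms(2)]) (intro op_mem[OF T] add_mem op_add[OF T] assms)+
  then show ?thesis using assms op_mem[OF T] by (simp add: dual_add[OF assms(2)])
qed

lemma dual_op_scale:
  assumes T: "operator_mod_null T C" and "\<phi> \<in> dual E" "f \<in> V"
  shows "\<phi> (T (\<lambda>y. c * f y)) = c * \<phi> (T f)"
proof -
  have "\<phi> (T (\<lambda>y. c * f y)) = \<phi> (\<lambda>x. c * T f x)"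
    by (rule dual_cong[OF assms(2)]) (intro op_mem[OF T] scale_mem op_scale[OF T] assms)+
  then show ?thesis using assms op_mem[OF T] by (simp add: dual_scale[OF assms(2)])
qed

lemma dual_op:
  assumes T: "operator_mod_null T C" and \<phi>: "\<phi> \<in> dual E"
  shows "(\<lambda>f. \<phi> (T f)) \<in> dual E"
proof -
  obtain D where D: "D \<ge> 0" "\<And>f. f \<in> V \<Longrightarrow> \<bar>\<phi> f\<bar> \<le> D * N f" using dual_bound[OF \<phi>] by blast
  have "\<bar>\<phi> (T f)\<bar> \<le> (D * C) * N f" if "f \<in> V" for f
    using D(2)[OF op_mem[OF T that]] mult_left_mono[OF op_norm_bound[OF T that] D(1)]
    by (simp add: algebra_simps)
  then have "\<exists>K. \<forall>f\<in>V. \<bar>\<phi> (T f)\<bar> \<le> K * N f" by blast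
  then show ?thesis
    using dual_op_add[OF T \<phi>] dual_op_scale[OF T \<phi>] by (simp add: dual_def)
qed

text \<open>Evaluate a functional norming the defect: composed with it, \<open>T\<close> is exactly
  linear, and what remains is \<open>(1 - (s + t)) * \<phi> (T h)\<close>, which is zero.\<close>

lemma norm_diff_op_lincomb:
  assumes T: "operator_mod_null T C" and "f \<in> V" "g \<in> V" "h \<in> V" "s + t = 1"
  shows "N (\<lambda>x. (s * (T f x - T h x) + t * (T g x - T h x)) - (T (\<lambda>y. s * f y + t * g y) x - T h x)) = 0"
    (is "N ?k = 0")
proof -
  note mem = op_mem[OF T] add_mem scale_mem diff_mem
  have kV: "?k \<in> V" by (intro mem assms)
  obtain \<phi> where \<phi>: "\<phi> \<in> dual E" "\<And>h. h \<in> V \<Longrightarrow> \<bar>\<phi> h\<bar> \<le> N h" "\<phi> ?k = N ?k"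
    using norming_functional[OF kV] by blast
  have "\<phi> ?k = s * (\<phi> (T f) - \<phi> (T h)) + t * (\<phi> (T g) - \<phi> (T h))
      - (s * \<phi> (T f) + t * \<phi> (T g) - \<phi> (T h))"
    using assms by (simp add: dual_add[OF \<phi>(1)] dual_diff[OF \<phi>(1)] dual_scale[OF \<phi>(1)] mem
        dual_op_add[OF T \<phi>(1)] dual_op_scale[OF T \<phi>(1)])
  also have "\<dots> = (1 - (s + t)) * \<phi> (T h)" by (simp add: algebra_simps)
  finally show ?thesis using \<phi>(3) assms(5) by simp
qed

text \<open>In the proof by contradiction, \<open>P\<close> collects the requirements on the next pair of a vector
  \<open>v n\<close> and a functional \<open>\<phi> n\<close>: the \<open>v i\<close> span an \<open>\<ell>\<^sub>1\<close>-like cone together with \<open>T y\<close>,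
  \<open>\<phi> n\<close> keeps \<open>T y\<close> away from \<open>T (v i)\<close> for \<open>i \<le> n\<close>, and the last inequality is the
  hypothesis of the approachability estimate.\<close>

lemma weakly_compact_hits:
  assumes S: "slice_condition" and ne: "f0 \<in> V" "N f0 \<noteq> 0"
    and T: "operator_mod_null T C" and K: "compactin (weak_topology E) K"
    and TK: "\<And>f. f \<in> fball E \<Longrightarrow> T f \<in> K"
    and y: "y \<in> fball E" and e: "e > 0"
  shows "\<exists>u\<in>fball E. N (\<lambda>x. T y x + u x) \<ge> N (T y) + 1 - e \<and> N (\<lambda>x. T u x - T y x) < e"
proof (rule ccontr)
  assume none: "\<not> ?thesis"
  have far: "N (\<lambda>x. T u x - T y x) \<ge> e"
    if "u \<in> fball E" "N (\<lambda>x. T y x + u x) \<ge> N (T y) + 1 - e" for u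
    using none that by (meson not_le)
  have yV: "y \<in> V" and TyV: "T y \<in> V" using ball_memD[OF y] op_mem[OF T] by auto
  define P where "P F n r \<longleftrightarrow> fst r \<in> fball E \<and>
      N (\<lambda>x. (T y x + (\<Sum>i<n. fst (F i) x)) + fst r x) \<ge>
        N (\<lambda>x. T y x + (\<Sum>i<n. fst (F i) x)) + 1 - e/2 * (1/2)^Suc n \<and>
      snd r \<in> dual E \<and> (\<forall>f\<in>V. \<bar>snd r f\<bar> \<le> N f) \<and>
      (\<forall>i<n. snd r (T (fst (F i))) - snd r (T y) \<ge> e) \<and> snd r (T (fst r)) - snd r (T y) \<ge> e \<and>
      (\<Sum>j<n. (1/4)^j * (\<Sum>i<n. snd (F j) (T (fst (F i))) - snd (F j) (T y))
          * (snd (F j) (T (fst r)) - snd (F j) (T y))) \<le> 1"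
    for F :: "nat \<Rightarrow> ('a \<Rightarrow> real) \<times> (('a \<Rightarrow> real) \<Rightarrow> real)" and n r
  have "\<exists>F. \<forall>n. P F n (F n)"
  proof (rule dependent_wellorder_choice)
    fix r F G and n :: nat
    assume "\<And>m. m < n \<Longrightarrow> F m = (G m :: ('a \<Rightarrow> real) \<times> (('a \<Rightarrow> real) \<Rightarrow> real))"
    then show "P F n r = P G n r" unfolding P_def by simp
  next
    fix n F assume hist: "\<And>m. m < n \<Longrightarrow> P F m (F m)"
    define v where "v i = fst (F i)" for i
    define \<phi> where "\<phi> i = snd (F i)" for i
    have v: "v i \<in> fball E" and \<phi>: "\<phi> i \<in> dual E" if "i < n" for i
      using hist[OF that] by (auto simp: P_def v_def \<phi>_def)
    have vV: "v i \<in> V" if "i < n" for i using ball_memD v[OF that] by blast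
    define a where "a m = (\<lambda>x. T y x + (\<Sum>i<m. v i x))" for m
    have aV: "a m \<in> V" if "m \<le> n" for m
      unfolding a_def using that by (intro add_mem sum_mem TyV vV) auto
    \<comment> \<open>The errors \<open>e/2 * (1/2)^Suc m\<close> sum to less than
      \<open>e/2\<close>, so at every stage the norm stays within \<open>e/2\<close> of its upper
      bound \<open>N (T y) + m\<close>.\<close>
    have a_ge: "N (a m) \<ge> N (T y) + m - e/2 * (1 - (1/2)^m)" if "m \<le> n" for m
      using that
    proof (induction m)
      case (Suc m)
      then have "N (a (Suc m)) \<ge> N (a m) + 1 - e/2 * (1/2)^Suc m"
        using hist[of m] by (simp add: P_def a_def v_def add.assoc)
      with Suc show ?case by (simp add: algebra_simps)
    qed (simp add: a_def)
    \<comment> \<open>Up to a factor 2 this is the negative gradient of the potential in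
      \<open>approachability\<close>. A vector \<open>w\<close> at which the combined functional is
      at least its value at \<open>y\<close> minus 1 satisfies the last clause of \<open>P\<close>,
      and such \<open>w\<close> form a set that the slice condition can reach.\<close>
    define b where "b j = - ((1/4)^j * (\<Sum>i<n. \<phi> j (T (v i)) - \<phi> j (T y)))" for j :: nat
    have "(\<lambda>f. \<Sum>j<n. b j * \<phi> j (T f)) \<in> dual E"
      using dual_lincomb[of "{..<n}" "\<lambda>j f. \<phi> j (T f)" b] dual_op[OF T \<phi>] by simp
    then obtain w where w: "w \<in> fball E"
      "(\<Sum>j<n. b j * \<phi> j (T w)) \<ge> (\<Sum>j<n. b j * \<phi> j (T y)) - 1"
      "N (\<lambda>x. a n x + w x) \<ge> N (a n) + 1 - e/2 * (1/2)^Suc n"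
      using slice_condition_ball[OF S ne aV, of n _ y 1 "e/2 * (1/2)^Suc n"] y e by auto
    have wV: "w \<in> V" using ball_memD w by blast
    have "N (\<lambda>x. a n x + w x) \<ge> N (T y) + n + 1 - e/2 * (1 - (1/2)^Suc n)"
      using w(3) a_ge[of n] by (simp add: algebra_simps)
    moreover have "e/2 * (1 - (1/2)^Suc n) \<le> e/2" using e by (simp add: algebra_simps)
    ultimately have big: "N (\<lambda>x. a n x + w x) \<ge> N (T y) + n + 1 - e/2" by linarith
    \<comment> \<open>One functional norming the whole sum. Each summand contributes at most its
      upper bound, so the total defect \<open>e/2\<close> also bounds the defect of each:
      \<open>T y\<close>, \<open>w\<close> and all \<open>v i\<close> are nearly normed by
      \<open>\<psi>\<close>.\<close>
    obtain \<psi> where \<psi>: "\<psi> \<in> dual E" "\<And>g. g \<in> V \<Longrightarrow> \<bar>\<psi> g\<bar> \<le> N g"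
      "\<psi> (\<lambda>x. a n x + w x) = N (\<lambda>x. a n x + w x)"
      using norming_functional[OF add_mem[OF aV[OF order_refl] wV]] by blast
    have sum\<psi>: "\<psi> (T y) + (\<Sum>i<n. \<psi> (v i)) + \<psi> w \<ge> N (T y) + n + 1 - e/2"
    proof -
      have "\<psi> (\<lambda>x. a n x + w x) = \<psi> (a n) + \<psi> w" by (rule dual_add[OF \<psi>(1) aV wV]) simp
      moreover have "\<psi> (a n) = \<psi> (T y) + \<psi> (\<lambda>x. \<Sum>i<n. v i x)"
        unfolding a_def by (rule dual_add[OF \<psi>(1) TyV sum_mem]) (simp add: vV)
      moreover have "\<psi> (\<lambda>x. \<Sum>i<n. v i x) = (\<Sum>i<n. \<psi> (v i))"
        by (rule dual_sum[OF \<psi>(1)]) (simp add: vV)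
      ultimately show ?thesis using big \<psi>(3) by linarith
    qed
    have \<psi>_ball: "\<psi> u \<le> 1" if "u \<in> fball E" for u using \<psi>(2)[of u] ball_memD[OF that] by linarith
    have \<psi>Ty: "\<psi> (T y) \<le> N (T y)" using \<psi>(2)[OF TyV] by linarith
    have sum_le: "(\<Sum>i<n. \<psi> (v i)) \<le> n" using sum_mono[of "{..<n}" "\<lambda>i. \<psi> (v i)" "\<lambda>_. 1"] v \<psi>_ball by simp
    have lowTy: "\<psi> (T y) \<ge> N (T y) - e/2" using sum\<psi> sum_le \<psi>_ball[OF w(1)] by linarith
    have low_w: "\<psi> w \<ge> 1 - e/2" using sum\<psi> sum_le \<psi>Ty by linarith
    have low_v: "\<psi> (v i) \<ge> 1 - e/2" if "i < n" for i
    proof -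
      have "(\<Sum>i<n. \<psi> (v i)) = \<psi> (v i) + (\<Sum>i\<in>{..<n}-{i}. \<psi> (v i))"
        using that by (intro sum.remove) auto
      also have "(\<Sum>i\<in>{..<n}-{i}. \<psi> (v i)) \<le> (\<Sum>i\<in>{..<n}-{i}. 1)"
        using v \<psi>_ball by (intro sum_mono) auto
      also have "\<dots> = real n - 1" using that by (simp add: of_nat_diff)
      finally show ?thesis using sum\<psi> \<psi>Ty \<psi>_ball[OF w(1)] by linarith
    qed
    \<comment> \<open>The differences \<open>T u - T y\<close> over a slice of
      \<open>\<psi>\<close>, enlarged by null functions since \<open>T\<close> respects convex
      combinations only up to those.\<close>
    define D where "D = {g \<in> V. \<exists>u\<in>fball E. \<psi> u \<ge> 1 - e/2 \<and> N (\<lambda>x. g x - (T u x - T y x)) = 0}"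
    have D_in: "(\<lambda>x. T u x - T y x) \<in> D" if "u \<in> fball E" "\<psi> u \<ge> 1 - e/2" for u
      using that ball_memD op_mem[OF T] TyV unfolding D_def
      by (auto simp: diff_mem norm_zero intro!: bexI[of _ u])
    \<comment> \<open>On \<open>T y\<close> and on \<open>u\<close> the functional
      \<open>\<psi>\<close> loses at most \<open>e/2\<close> each, so the norm of
      \<open>T y + u\<close> is large enough for \<open>far\<close>.\<close>
    have D_far: "e \<le> N g" if gD: "g \<in> D" for g
    proof -
      obtain u where u: "u \<in> fball E" "\<psi> u \<ge> 1 - e/2" "N (\<lambda>x. g x - (T u x - T y x)) = 0" "g \<in> V"
        using gD by (auto simp: D_def)
      have uV: "u \<in> V" using u ball_memD by blast
      have "\<psi> (\<lambda>x. T y x + u x) \<le> N (\<lambda>x. T y x + u x)"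
        using \<psi>(2)[OF add_mem[OF TyV uV]] by linarith
      then have "N (\<lambda>x. T y x + u x) \<ge> N (T y) + 1 - e"
        using dual_add[OF \<psi>(1) TyV uV] lowTy u(2) by linarith
      then have "e \<le> N (\<lambda>x. T u x - T y x)" using far u by blast
      also have "\<dots> \<le> N g + N (\<lambda>x. (T u x - T y x) - g x)"
        by (intro norm_le_diff diff_mem op_mem[OF T] uV yV u)
      also have "N (\<lambda>x. (T u x - T y x) - g x) = 0"
        using norm_diff_commute[of "\<lambda>x. T u x - T y x" g] u uV op_mem[OF T] TyV by (simp add: diff_mem)
      finally show ?thesis by simp
    qed
    have "convex_subset D"
      unfolding convex_subset_def
    proof (intro conjI ballI allI impI)
      show "D \<subseteq> V" by (auto simp: D_def)
      show "D \<noteq> {}" using D_in[OF w(1) low_w] by blast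
      fix g h and s t :: real
      assume gh: "g \<in> D" "h \<in> D" and st: "0 \<le> s" "0 \<le> t" "s + t = 1"
      obtain u where u: "u \<in> fball E" "\<psi> u \<ge> 1 - e/2" "N (\<lambda>x. g x - (T u x - T y x)) = 0" "g \<in> V"
        using gh by (auto simp: D_def)
      obtain u' where u': "u' \<in> fball E" "\<psi> u' \<ge> 1 - e/2" "N (\<lambda>x. h x - (T u' x - T y x)) = 0" "h \<in> V"
        using gh by (auto simp: D_def)
      define z where "z = (\<lambda>x. s * u x + t * u' x)"
      have uV: "u \<in> V" "N u \<le> 1" "u' \<in> V" "N u' \<le> 1" using ball_memD u(1) u'(1) by auto
      have zV: "z \<in> V" unfolding z_def using uV by (intro add_mem scale_mem)
      have "N z \<le> s * N u + t * N u'"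
        unfolding z_def using norm_add[of "\<lambda>x. s * u x" "\<lambda>x. t * u' x"] uV st
        by (simp add: scale_mem norm_scale)
      also have "\<dots> \<le> s * 1 + t * 1" using uV st by (intro add_mono mult_left_mono) auto
      finally have z_ball: "z \<in> fball E" using zV st by (simp add: fball_def)
      have "\<psi> z = s * \<psi> u + t * \<psi> u'"
        unfolding z_def using uV by (simp add: dual_add[OF \<psi>(1)] dual_scale[OF \<psi>(1)] scale_mem)
      moreover have "s * \<psi> u + t * \<psi> u' \<ge> s * (1 - e/2) + t * (1 - e/2)"
        using u u' st by (intro add_mono mult_left_mono) auto
      ultimately have \<psi>z: "\<psi> z \<ge> 1 - e/2" using st(3) by (simp flip: distrib_right)
      note mem = add_mem scale_mem diff_mem op_mem[OF T] uV zV yV u(4) u'(4)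
      let ?lin = "\<lambda>x. s * (T u x - T y x) + t * (T u' x - T y x)"
      have "N (\<lambda>x. (s * g x + t * h x) - (T z x - T y x))
          \<le> N (\<lambda>x. (s * g x + t * h x) - ?lin x) + N (\<lambda>x. ?lin x - (T z x - T y x))"
        by (intro norm_triangle_diff mem)
      also have "N (\<lambda>x. ?lin x - (T z x - T y x)) = 0"
        using norm_diff_op_lincomb[OF T uV(1,3) yV st(3)] by (simp add: z_def)
      also have "(\<lambda>x. (s * g x + t * h x) - ?lin x) =
          (\<lambda>x. s * (g x - (T u x - T y x)) + t * (h x - (T u' x - T y x)))"
        by (simp add: algebra_simps)
      also have "N \<dots> \<le> N (\<lambda>x. s * (g x - (T u x - T y x))) + N (\<lambda>x. t * (h x - (T u' x - T y x)))"
        by (intro norm_add mem)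
      also have "\<dots> = 0" using u(3) u'(3) by (simp add: norm_scale mem)
      finally have "N (\<lambda>x. (s * g x + t * h x) - (T z x - T y x)) = 0"
        using norm_nonneg[of "\<lambda>x. (s * g x + t * h x) - (T z x - T y x)"] by (simp add: mem)
      then show "(\<lambda>x. s * g x + t * h x) \<in> D"
        using z_ball \<psi>z by (auto simp: D_def mem)
    qed
    \<comment> \<open>The next functional. All earlier \<open>v i\<close> and the new
      \<open>w\<close> lie in the slice of \<open>\<psi>\<close>, so \<open>\<theta>\<close>
      separates each of their images from \<open>T y\<close> by \<open>e\<close>.\<close>
    from separating_functional[OF this D_far] obtain \<theta>
      where \<theta>: "\<theta> \<in> dual E" "\<And>f. f \<in> V \<Longrightarrow> \<bar>\<theta> f\<bar> \<le> N f" "\<And>g. g \<in> D \<Longrightarrow> e \<le> \<theta> g" by blast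
    have \<theta>D: "\<theta> (T u) - \<theta> (T y) \<ge> e" if "u \<in> fball E" "\<psi> u \<ge> 1 - e/2" for u
      using \<theta>(3)[OF D_in[OF that]] ball_memD(1)[OF that(1)] op_mem[OF T] TyV
      by (simp add: dual_diff[OF \<theta>(1)])
    have "(\<Sum>j<n. (1/4)^j * (\<Sum>i<n. \<phi> j (T (v i)) - \<phi> j (T y)) * (\<phi> j (T w) - \<phi> j (T y)))
        = (\<Sum>j<n. b j * \<phi> j (T y)) - (\<Sum>j<n. b j * \<phi> j (T w))"
      unfolding sum_subtractf[symmetric] by (intro sum.cong) (simp_all add: b_def algebra_simps)
    also have "\<dots> \<le> 1" using w(2) by linarith
    finally have "P F n (w, \<theta>)"
      using w(1) w(3)[unfolded a_def] \<theta>(1,2) \<theta>D[OF w(1) low_w] \<theta>D[OF v low_v]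
      by (simp add: P_def v_def[symmetric] \<phi>_def[symmetric])
    then show "\<exists>r. P F n r" by blast
  qed
  then obtain F where F: "\<And>n. P F n (F n)" by blast
  define v where "v i = fst (F i)" for i
  define \<phi> where "\<phi> i = snd (F i)" for i
  have v: "v n \<in> fball E" and \<phi>: "\<phi> n \<in> dual E" and \<phi>_le: "\<And>f. f \<in> V \<Longrightarrow> \<bar>\<phi> n f\<bar> \<le> N f"
    and step: "(\<Sum>j<n. (1/4)^j * (\<Sum>i<n. \<phi> j (T (v i)) - \<phi> j (T y))
          * (\<phi> j (T (v n)) - \<phi> j (T y))) \<le> 1"
    and below: "\<And>i. i < n \<Longrightarrow> \<phi> n (T (v i)) - \<phi> n (T y) \<ge> e"
    and diag: "\<phi> n (T (v n)) - \<phi> n (T y) \<ge> e" for n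
    using F[of n] by (auto simp: P_def v_def \<phi>_def)
  have sep: "\<phi> n (T (v i)) - \<phi> n (T y) \<ge> e" if "i \<le> n" for i n
    using below[of i n] diag[of n] that by (cases "i = n") auto
  have vV: "v n \<in> V" for n using v ball_memD by blast
  have bd: "\<bar>\<phi> j (T (v i)) - \<phi> j (T y)\<bar> \<le> 2 * C" for i j
  proof -
    have "\<bar>\<phi> j (T u)\<bar> \<le> C" if "u \<in> fball E" for u
      using \<phi>_le[of "T u" j] op_norm_bound[OF T, of u] ball_memD[OF that] op_mem[OF T]
        mult_left_mono[of "N u" 1 C] op_const_nonneg[OF T] by force
    from this[OF v[of i]] this[OF y] show ?thesis by linarith
  qed
  have lim: "(\<lambda>n. (\<Sum>i<n. \<phi> j (T (v i)) - \<phi> j (T y)) / n) \<longlonglongrightarrow> 0" for j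
    using approachability[of "\<lambda>j i. \<phi> j (T (v i)) - \<phi> j (T y)", OF bd step] .
  \<comment> \<open>Averages of the first \<open>n + 1\<close> vectors, so that none is
    empty.\<close>
  define avg where "avg n = (\<lambda>x. \<Sum>i<Suc n. inverse (Suc n) * v i x)" for n
  have avgV: "avg n \<in> V" for n unfolding avg_def by (intro sum_mem scale_mem vV)
  have "N (avg n) \<le> 1" for n
  proof -
    have "N (avg n) \<le> (\<Sum>i<Suc n. N (\<lambda>x. inverse (Suc n) * v i x))"
      unfolding avg_def by (intro norm_sum scale_mem vV)
    also have "\<dots> \<le> (\<Sum>i<Suc n. inverse (Suc n))"
    proof (rule sum_mono)
      fix i
      have "inverse (Suc n) * N (v i) \<le> inverse (Suc n) * 1"
        using ball_memD(2)[OF v] by (intro mult_left_mono) auto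
      then show "N (\<lambda>x. inverse (Suc n) * v i x) \<le> inverse (Suc n)"
        unfolding norm_scale[OF vV] by simp
    qed
    also have "\<dots> = 1" by simp
    finally show ?thesis .
  qed
  then have avg: "avg n \<in> fball E" for n using avgV by (simp add: fball_def)
  have dual_avg: "\<theta> (T (avg n)) - \<theta> (T y) = (\<Sum>i<Suc n. \<theta> (T (v i)) - \<theta> (T y)) / Suc n"
    if \<theta>: "\<theta> \<in> dual E" for \<theta> n
  proof -
    have "\<theta> (T (avg n)) = (\<Sum>i<Suc n. \<theta> (T (\<lambda>x. inverse (Suc n) * v i x)))"
      unfolding avg_def by (rule dual_sum[OF dual_op[OF T \<theta>]]) (intro scale_mem vV)
    also have "\<dots> = (\<Sum>i<Suc n. inverse (Suc n) * \<theta> (T (v i)))"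
      by (intro sum.cong refl dual_op_scale[OF T \<theta> vV])
    also have "\<dots> = (\<Sum>i<Suc n. \<theta> (T (v i))) / Suc n"
      unfolding sum_distrib_left[symmetric] by (simp add: divide_inverse)
    finally show ?thesis by (simp add: sum_subtractf diff_divide_distrib)
  qed
  obtain k where k: "k \<in> K"
    "\<And>\<theta> d m. \<lbrakk>\<theta> \<in> dual E; d > 0\<rbrakk> \<Longrightarrow> \<exists>n\<ge>m. \<bar>\<theta> (T (avg n)) - \<theta> k\<bar> < d"
    using compactin_weak_cluster[OF K, of "\<lambda>n. T (avg n)"] TK[OF avg] by blast
  have kV: "k \<in> V" using k(1) compactin_subset_topspace[OF K] topspace_weak by auto
  \<comment> \<open>For fixed \<open>j\<close> the values of \<open>\<phi> j\<close> along the
    averages converge to its value at \<open>T y\<close>, and a cluster point inherits the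
    limit.\<close>
  have \<phi>k: "\<phi> j k = \<phi> j (T y)" for j
  proof (rule ccontr)
    assume "\<phi> j k \<noteq> \<phi> j (T y)"
    then have d: "\<bar>\<phi> j k - \<phi> j (T y)\<bar> / 2 > 0" (is "?d > 0") by simp
    have "(\<lambda>n. \<phi> j (T (avg n)) - \<phi> j (T y)) \<longlonglongrightarrow> 0"
      unfolding dual_avg[OF \<phi>] using lim[of j, THEN LIMSEQ_Suc] by simp
    then obtain m where m: "\<And>n. n \<ge> m \<Longrightarrow> \<bar>\<phi> j (T (avg n)) - \<phi> j (T y)\<bar> < ?d"
      using LIMSEQ_D[OF _ d] by fastforce
    obtain n where "n \<ge> m" "\<bar>\<phi> j (T (avg n)) - \<phi> j k\<bar> < ?d" using k(2)[OF \<phi> d] by blast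
    with m[of n] show False by (auto simp: abs_if split: if_splits)
  qed
  \<comment> \<open>The index may depend on \<open>g\<close>; the larger of two indices keeps the
    set convex. It contains \<open>T (avg n) - k\<close>, because no \<open>\<phi> m\<close>
    distinguishes \<open>k\<close> from \<open>T y\<close>, and for \<open>m \<ge> n\<close> it
    separates \<open>T y\<close> from the images of \<open>v 0, ..., v n\<close>. A functional
    separating \<open>D\<close> from 0 then keeps all averages away from their cluster
    point.\<close>
  define D where "D = {g \<in> V. \<exists>n. \<forall>m\<ge>n. \<phi> m g \<ge> e}"
  have "convex_subset D"
    unfolding convex_subset_def
  proof (intro conjI ballI allI impI)
    show "D \<subseteq> V" by (auto simp: D_def)
    have "\<phi> m (\<lambda>x. T (v 0) x - T y x) \<ge> e" for m
      using sep[of 0 m] by (simp add: dual_diff[OF \<phi>] op_mem[OF T] vV yV)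
    then have "(\<lambda>x. T (v 0) x - T y x) \<in> D"
      by (simp add: D_def diff_mem op_mem[OF T] vV yV)
    then show "D \<noteq> {}" by blast
    fix g h and s t :: real
    assume gh: "g \<in> D" "h \<in> D" and st: "0 \<le> s" "0 \<le> t" "s + t = 1"
    obtain n1 n2 where n: "\<And>m. m \<ge> n1 \<Longrightarrow> \<phi> m g \<ge> e" "\<And>m. m \<ge> n2 \<Longrightarrow> \<phi> m h \<ge> e"
      and V: "g \<in> V" "h \<in> V" using gh by (auto simp: D_def)
    have "\<phi> m (\<lambda>x. s * g x + t * h x) \<ge> e" if "m \<ge> max n1 n2" for m
    proof -
      have "e = s * e + t * e" using st(3) by (simp flip: distrib_right)
      also have "\<dots> \<le> s * \<phi> m g + t * \<phi> m h"
        using n[of m] that st by (intro add_mono mult_left_mono) auto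
      finally show ?thesis using V by (simp add: dual_add[OF \<phi>] dual_scale[OF \<phi>] scale_mem)
    qed
    then have "\<exists>n. \<forall>m\<ge>n. \<phi> m (\<lambda>x. s * g x + t * h x) \<ge> e" by blast
    then show "(\<lambda>x. s * g x + t * h x) \<in> D" using V by (simp add: D_def add_mem scale_mem)
  qed
  moreover have "e \<le> N g" if gD: "g \<in> D" for g
  proof -
    obtain n where "\<phi> n g \<ge> e" "g \<in> V" using gD by (auto simp: D_def)
    with \<phi>_le[of g n] show ?thesis by linarith
  qed
  ultimately obtain \<theta> where \<theta>: "\<theta> \<in> dual E" "\<And>g. g \<in> D \<Longrightarrow> e \<le> \<theta> g"
    using separating_functional[of D e] by blast
  have "\<theta> (T (avg n)) - \<theta> k \<ge> e" for n
  proof -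
    have "\<phi> m (\<lambda>x. T (avg n) x - k x) \<ge> e" if "m \<ge> n" for m
    proof -
      have "real (Suc n) * e = (\<Sum>i<Suc n. e)" by simp
      also have "\<dots> \<le> (\<Sum>i<Suc n. \<phi> m (T (v i)) - \<phi> m (T y))"
        using that by (intro sum_mono sep) auto
      also have "\<dots> = real (Suc n) * (\<phi> m (T (avg n)) - \<phi> m (T y))"
        by (simp add: dual_avg[OF \<phi>] del: sum.lessThan_Suc of_nat_Suc)
      finally show ?thesis
        using \<phi>k[of m] by (simp add: dual_diff[OF \<phi>] op_mem[OF T] avgV kV)
    qed
    then have "(\<lambda>x. T (avg n) x - k x) \<in> D"
      unfolding D_def by (auto intro!: diff_mem op_mem[OF T] avgV kV)
    from \<theta>(2)[OF this] show ?thesis by (simp add: dual_diff[OF \<theta>(1)] op_mem[OF T] avgV kV)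
  qed
  moreover obtain n where "\<bar>\<theta> (T (avg n)) - \<theta> k\<bar> < e" using k(2)[OF \<theta>(1) e] by blast
  ultimately show False by (smt (verit))
qed

text \<open>Replacing \<open>T y\<close> by \<open>T u\<close> in \<open>T y + u\<close> costs less
  than \<open>e/2\<close>. Since \<open>y\<close> is any point of the ball, \<open>N (T y)\<close>
  may be close to the norm of \<open>T\<close>.\<close>

lemma weakly_compact_daugavet:
  assumes "slice_condition" and "f0 \<in> V" "N f0 \<noteq> 0"
    and T: "operator_mod_null T C" and "compactin (weak_topology E) K"
    and "\<And>f. f \<in> fball E \<Longrightarrow> T f \<in> K" and y: "y \<in> fball E" and e: "e > 0"
  obtains u where "u \<in> fball E" "N (\<lambda>x. u x + T u x) \<ge> 1 + N (T y) - e"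
proof -
  obtain u where u: "u \<in> fball E" "N (\<lambda>x. T y x + u x) \<ge> N (T y) + 1 - e/2"
    "N (\<lambda>x. T u x - T y x) < e/2"
    using weakly_compact_hits[OF assms(1-7), of "e/2"] e by (auto simp: algebra_simps)
  have V: "u \<in> V" "T u \<in> V" "T y \<in> V" using u(1) y ball_memD op_mem[OF T] by auto
  have "N (\<lambda>x. T y x + u x) \<le> N (\<lambda>x. u x + T u x) + N (\<lambda>x. (T y x + u x) - (u x + T u x))"
    using V by (intro norm_le_diff add_mem)
  also have "(\<lambda>x. (T y x + u x) - (u x + T u x)) = (\<lambda>x. T y x - T u x)" by (simp add: algebra_simps)
  also have "N \<dots> = N (\<lambda>x. T u x - T y x)" using V by (intro norm_diff_commute)
  finally show ?thesis using that[OF u(1)] u by linarith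
qed

lemma norm_lincomb:
  assumes "f \<in> V" "g \<in> V" "h \<in> V"
  shows "N (\<lambda>x. (c * f x + d * g x) - h x) \<le> \<bar>c\<bar> * N f + \<bar>d\<bar> * N g + N h"
  using norm_diff[of "\<lambda>x. c * f x + d * g x" h] norm_add[of "\<lambda>x. c * f x" "\<lambda>x. d * g x"] assms
  by (simp add: add_mem scale_mem norm_scale)

text \<open>Up to null functions the closure consists of multiples \<open>c * z\<close>, with
  \<open>c\<close> in a bounded closed set of reals, and \<open>c \<mapsto> c * z\<close> is weakly
  continuous. The coefficient is read off by a functional norming \<open>z\<close>. This makes rank
  one operators weakly compact.\<close>

lemma compactin_weak_line:
  assumes z: "z \<in> V" "N z \<noteq> 0" and S: "S \<subseteq> V"
    and line: "\<And>s. s \<in> S \<Longrightarrow> \<exists>c. N (\<lambda>x. s x - c * z x) = 0"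
    and bd: "\<And>s. s \<in> S \<Longrightarrow> N s \<le> R"
  shows "compactin (weak_topology E) (norm_closure E S)"
proof -
  define K where "K = norm_closure E S"
  have K: "k \<in> K \<longleftrightarrow> k \<in> V \<and> (\<forall>e>0. \<exists>s\<in>S. N (\<lambda>x. k x - s x) < e)" for k
    by (simp add: K_def norm_closure_def)
  have Nz: "N z > 0" using z norm_nonneg[OF z(1)] by simp
  obtain \<psi> where \<psi>: "\<psi> \<in> dual E" "\<And>g. g \<in> V \<Longrightarrow> \<bar>\<psi> g\<bar> \<le> N g" "\<psi> z = N z"
    using norming_functional[OF z(1)] by blast
  define l where "l k = \<psi> k / N z" for k
  have S_line: "N (\<lambda>x. s x - l s * z x) = 0" if s: "s \<in> S" for s
  proof -
    obtain c where c: "N (\<lambda>x. s x - c * z x) = 0" using line[OF s] by blast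
    have "\<psi> s = \<psi> (\<lambda>x. c * z x)"
      using S s z c by (intro dual_cong[OF \<psi>(1)] scale_mem) auto
    then have "l s = c" using z \<psi> by (simp add: l_def dual_scale[OF \<psi>(1)])
    with c show ?thesis by simp
  qed
  have K_line: "N (\<lambda>x. k x - l k * z x) = 0" if k: "k \<in> K" for k
  proof -
    have kV: "k \<in> V" using k K by blast
    have "N (\<lambda>x. k x - l k * z x) \<le> 0 + e" if "e > 0" for e
    proof -
      obtain s where s: "s \<in> S" "N (\<lambda>x. k x - s x) < e/2" using k K \<open>e > 0\<close> half_gt_zero by blast
      have sV: "s \<in> V" using s S by blast
      have "N (\<lambda>x. s x - l k * z x) \<le> N (\<lambda>x. s x - l s * z x) + N (\<lambda>x. l s * z x - l k * z x)"
        by (intro norm_triangle_diff sV scale_mem z)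
      also have "(\<lambda>x. l s * z x - l k * z x) = (\<lambda>x. (l s - l k) * z x)" by (simp add: algebra_simps)
      also have "N \<dots> = \<bar>\<psi> (\<lambda>x. k x - s x)\<bar>"
      proof -
        have "l s - l k = (\<psi> s - \<psi> k) / N z" by (simp add: l_def diff_divide_distrib)
        then have "\<bar>l s - l k\<bar> * N z = \<bar>\<psi> s - \<psi> k\<bar>" using Nz by (simp add: abs_divide)
        then show ?thesis
          unfolding norm_scale[OF z(1)] dual_diff[OF \<psi>(1) kV sV] by (simp add: abs_minus_commute)
      qed
      also have "\<dots> \<le> N (\<lambda>x. k x - s x)" by (rule \<psi>(2)[OF diff_mem[OF kV sV]])
      finally have "N (\<lambda>x. s x - l k * z x) < e/2" using S_line[OF s(1)] s(2) by linarith
      moreover have "N (\<lambda>x. k x - l k * z x) \<le> N (\<lambda>x. k x - s x) + N (\<lambda>x. s x - l k * z x)"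
        by (intro norm_triangle_diff kV sV scale_mem z)
      ultimately show ?thesis using s by linarith
    qed
    then have "N (\<lambda>x. k x - l k * z x) \<le> 0" by (rule field_le_epsilon)
    then show ?thesis using norm_nonneg[OF diff_mem[OF kV scale_mem[OF z(1)]]] by (simp add: antisym)
  qed
  define D where "D = {c. (\<lambda>x. c * z x) \<in> K}"
  have l_D: "l k \<in> D" if k: "k \<in> K" for k
  proof -
    have kV: "k \<in> V" using k K by blast
    have "\<exists>s\<in>S. N (\<lambda>x. l k * z x - s x) < e" if "e > 0" for e
    proof -
      obtain s where s: "s \<in> S" "N (\<lambda>x. k x - s x) < e" using k K \<open>e > 0\<close> by blast
      have sV: "s \<in> V" using s S by blast
      have "N (\<lambda>x. l k * z x - s x) \<le> N (\<lambda>x. l k * z x - k x) + N (\<lambda>x. k x - s x)"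
        by (intro norm_triangle_diff kV sV scale_mem z)
      then have "N (\<lambda>x. l k * z x - s x) < e"
        using K_line[OF k] s(2) norm_diff_commute[OF kV scale_mem[OF z(1)], of "l k"] by linarith
      then show ?thesis using s(1) by blast
    qed
    then show ?thesis using z by (simp add: D_def K scale_mem)
  qed
  have "bounded D"
    unfolding bounded_iff
  proof (intro exI ballI)
    fix c assume "c \<in> D"
    then obtain s where s: "s \<in> S" "N (\<lambda>x. c * z x - s x) < 1"
      unfolding D_def K using zero_less_one by blast
    have "N (\<lambda>x. c * z x) \<le> N s + N (\<lambda>x. c * z x - s x)"
      using s S z by (intro norm_le_diff scale_mem) auto
    then have "\<bar>c\<bar> * N z \<le> R + 1" using bd[OF s(1)] s(2) norm_scale[OF z(1), of c] by linarith
    then show "norm c \<le> (R + 1) / N z" using Nz by (simp add: field_simps)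
  qed
  moreover have "closed D"
    unfolding closure_subset_eq[symmetric]
  proof
    fix c assume c: "c \<in> closure D"
    have "\<exists>s\<in>S. N (\<lambda>x. c * z x - s x) < e" if "e > 0" for e
    proof -
      obtain d where d: "d \<in> D" "dist d c < e / (2 * N z)"
        using c[unfolded closure_approachable, rule_format, of "e / (2 * N z)"] Nz \<open>e > 0\<close> by auto
      then have "\<bar>c - d\<bar> * N z < e/2" using Nz by (simp add: dist_real_def abs_minus_commute field_simps)
      moreover obtain s where s: "s \<in> S" "N (\<lambda>x. d * z x - s x) < e/2"
        using d(1) \<open>e > 0\<close> half_gt_zero unfolding D_def K by blast
      moreover have "N (\<lambda>x. c * z x - s x) \<le> N (\<lambda>x. c * z x - d * z x) + N (\<lambda>x. d * z x - s x)"
        using s S z by (intro norm_triangle_diff scale_mem) auto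
      moreover have "N (\<lambda>x. c * z x - d * z x) = \<bar>c - d\<bar> * N z"
        unfolding left_diff_distrib[symmetric] by (rule norm_scale[OF z(1)])
      ultimately show ?thesis by (intro bexI[OF _ s(1)]) linarith
    qed
    then show "c \<in> D" using z by (simp add: D_def K scale_mem)
  qed
  ultimately have "compactin euclideanreal D" by (simp add: compact_eq_bounded_closed)
  moreover have "continuous_map euclideanreal (weak_topology E) (\<lambda>c x. c * z x)"
    unfolding weak_topology_def
  proof (rule continuous_on_generated_topo)
    fix U assume "U \<in> {{f \<in> V. \<phi> f \<in> W} |\<phi> W. \<phi> \<in> dual E \<and> open W}"
    then obtain \<phi> W where U: "U = {f \<in> V. \<phi> f \<in> W}" "\<phi> \<in> dual E" "open W" by blast
    have "(\<lambda>c x. c * z x) -` U = (\<lambda>c. c * \<phi> z) -` W"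
      using z by (auto simp: U(1) dual_scale[OF U(2)] scale_mem)
    moreover have "open ((\<lambda>c. c * \<phi> z) -` W)" by (intro open_vimage U continuous_intros)
    ultimately show "openin euclideanreal ((\<lambda>c x. c * z x) -` U \<inter> topspace euclideanreal)" by simp
  next
    have "\<Union>{{f \<in> V. \<phi> f \<in> W} |\<phi> W. \<phi> \<in> dual E \<and> open W} = V"
      using topspace_weak unfolding weak_topology_def topology_generated_by_topspace .
    then show "(\<lambda>c x. c * z x) ` topspace euclideanreal \<subseteq> \<Union>{{f \<in> V. \<phi> f \<in> W} |\<phi> W. \<phi> \<in> dual E \<and> open W}"
      using scale_mem[OF z(1)] by auto
  qed
  ultimately have img: "compactin (weak_topology E) ((\<lambda>c x. c * z x) ` D)" by (rule image_compactin)
  \<comment> \<open>The image of \<open>D\<close> holds one representative of each class in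
    \<open>K\<close>; saturation of weakly open sets extends the subcover from it to
    \<open>K\<close>.\<close>
  have "\<exists>F. finite F \<and> F \<subseteq> \<U> \<and> K \<subseteq> \<Union>F"
    if \<U>: "\<And>W. W \<in> \<U> \<Longrightarrow> openin (weak_topology E) W" and cover: "K \<subseteq> \<Union>\<U>" for \<U>
  proof -
    have "(\<lambda>c x. c * z x) ` D \<subseteq> \<Union>\<U>" using cover by (auto simp: D_def)
    then obtain F where F: "finite F" "F \<subseteq> \<U>" "(\<lambda>c x. c * z x) ` D \<subseteq> \<Union>F"
      using compactinD[OF img, of \<U>] \<U> by blast
    have "k \<in> \<Union>F" if k: "k \<in> K" for k
    proof -
      obtain W where W: "W \<in> F" "(\<lambda>x. l k * z x) \<in> W" using F(3) l_D[OF k] by blast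
      have "k \<in> W"
      proof (rule openin_weak_saturated)
        show "openin (weak_topology E) W" using W F \<U> by blast
        show "(\<lambda>x. l k * z x) \<in> W" by (rule W)
        show kV: "k \<in> V" using k K by blast
        show "N (\<lambda>x. l k * z x - k x) = 0"
          using K_line[OF k] norm_diff_commute[OF kV scale_mem[OF z(1)]] by simp
      qed
      then show ?thesis using W by blast
    qed
    then show ?thesis using F by blast
  qed
  moreover have "K \<subseteq> V" using K by blast
  ultimately have "compactin (weak_topology E) K"
    unfolding compactin_def topspace_weak by simp
  then show ?thesis by (simp add: K_def)
qed

end

section \<open>Powers of a p-convex function space\<close>

text \<open>The measure is finite, so bounded functions belong to X; it is nonzero, so essential
  suprema of absolute values are nonnegative and the constant 1 is not null.\<close>

locale pconvex_function_space = finite_measure M for M :: "'a measure" +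
  fixes X :: "'a fspace" and p :: real
  assumes p: "1 \<le> p"
    and nontrivial: "emeasure M (space M) \<noteq> 0"
    and bfs: "banach_function_space M X"
    and oc: "order_continuous M X"
    and pconvex: "p_convex_const_1 p X"
begin

abbreviation Z where "Z \<equiv> fpower M X p"
abbreviation Y where "Y \<equiv> fpower M X (p - 1)"
abbreviation e where "e \<equiv> indicat_real (space M)"

lemma X_measurable [measurable_dest]: "f \<in> elems X \<Longrightarrow> f \<in> borel_measurable M"
  using bfs by (auto simp: banach_function_space_def)

lemma indicator_in_X:
  assumes "A \<in> sets M"
  shows "indicat_real A \<in> elems X"
proof -
  have "\<forall>A\<in>sets M. emeasure M A < \<infinity> \<longrightarrow> indicat_real A \<in> elems X"
    using bfs by (simp add: banach_function_space_def)
  moreover have "emeasure M A < \<infinity>" by (simp add: less_top[symmetric])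
  ultimately show ?thesis using assms by blast
qed

sublocale X: function_space X
proof
  show "elems X \<noteq> {}" using indicator_in_X[OF sets.top] by blast
qed (use bfs in \<open>simp_all add: banach_function_space_def\<close>)

lemma X_zero_iff: "f \<in> elems X \<Longrightarrow> fnorm X f = 0 \<longleftrightarrow> (AE x in M. f x = 0)"
  using bfs by (simp add: banach_function_space_def)

lemma X_ideal:
  assumes "f \<in> elems X" "g \<in> borel_measurable M" "AE x in M. \<bar>g x\<bar> \<le> \<bar>f x\<bar>"
  shows "g \<in> elems X" "fnorm X g \<le> fnorm X f"
proof -
  have "\<forall>f\<in>elems X. \<forall>g\<in>borel_measurable M. (AE x in M. \<bar>g x\<bar> \<le> \<bar>f x\<bar>) \<longrightarrow>
      g \<in> elems X \<and> fnorm X g \<le> fnorm X f"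
    using bfs by (simp add: banach_function_space_def)
  with assms show "g \<in> elems X" "fnorm X g \<le> fnorm X f" by auto
qed

lemma X_cong:
  assumes "f \<in> elems X" "g \<in> borel_measurable M" "AE x in M. \<bar>g x\<bar> = \<bar>f x\<bar>"
  shows "g \<in> elems X" "fnorm X g = fnorm X f"
proof -
  have le: "AE x in M. \<bar>g x\<bar> \<le> \<bar>f x\<bar>" and ge: "AE x in M. \<bar>f x\<bar> \<le> \<bar>g x\<bar>" using assms(3) by auto
  show g: "g \<in> elems X" by (rule X_ideal(1)[OF assms(1,2) le])
  show "fnorm X g = fnorm X f"
    using X_ideal(2)[OF assms(1,2) le] X_ideal(2)[OF g X_measurable[OF assms(1)] ge] by linarith
qed

lemma X_abs:
  assumes "f \<in> elems X"
  shows "(\<lambda>x. \<bar>f x\<bar>) \<in> elems X" "fnorm X (\<lambda>x. \<bar>f x\<bar>) = fnorm X f"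
proof -
  have "(\<lambda>x. \<bar>f x\<bar>) \<in> borel_measurable M" using X_measurable[OF assms] by measurable
  from X_cong[OF assms this] show "(\<lambda>x. \<bar>f x\<bar>) \<in> elems X" "fnorm X (\<lambda>x. \<bar>f x\<bar>) = fnorm X f"
    by simp_all
qed

lemma X_bounded:
  assumes "f \<in> borel_measurable M" "AE x in M. \<bar>f x\<bar> \<le> K"
  shows "f \<in> elems X" "fnorm X f \<le> \<bar>K\<bar> * fnorm X e"
proof -
  have eX: "e \<in> elems X" by (rule indicator_in_X) simp
  have ae: "AE x in M. \<bar>f x\<bar> \<le> \<bar>K * e x\<bar>"
    using assms(2) by (auto simp: indicator_def)
  show "f \<in> elems X" using X_ideal(1)[OF X.scale_mem[OF eX] assms(1) ae] .
  show "fnorm X f \<le> \<bar>K\<bar> * fnorm X e"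
    using X_ideal(2)[OF X.scale_mem[OF eX] assms(1) ae] X.norm_scale[OF eX, of K] by simp
qed

text \<open>Order continuity, applied to \<open>\<bar>w\<bar>\<close> cut off to the sets where
  \<open>\<bar>g\<bar> > n\<close>; these decrease to the empty set because \<open>g\<close> is real
  valued. The level function \<open>g\<close> is separate from \<open>w\<close> because tails in
  \<open>Y\<close> cut a power of \<open>g\<close> at levels of \<open>g\<close>.\<close>

lemma X_tail_tendsto_0:
  assumes w: "w \<in> elems X" and g[measurable]: "g \<in> borel_measurable M"
  shows "(\<lambda>n. fnorm X (\<lambda>x. if \<bar>g x\<bar> > real n then w x else 0)) \<longlonglongrightarrow> 0"
proof -
  note X_measurable[OF w, measurable]
  define u where "u n = (\<lambda>x. if \<bar>g x\<bar> > real n then \<bar>w x\<bar> else 0)" for n :: nat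
  have tail: "(\<lambda>x. if \<bar>g x\<bar> > real n then w x else 0) \<in> elems X" for n
    by (rule X_ideal(1)[OF w]) auto
  have u: "u n \<in> elems X" "fnorm X (u n) = fnorm X (\<lambda>x. if \<bar>g x\<bar> > real n then w x else 0)" for n
    using X_cong[OF tail, of "u n" n] by (auto simp: u_def)
  have "decseq (\<lambda>n. u n x) \<and> (\<lambda>n. u n x) \<longlonglongrightarrow> 0" for x
  proof
    show "decseq (\<lambda>n. u n x)" by (auto simp: decseq_def u_def)
    obtain k :: nat where "\<bar>g x\<bar> \<le> k" using real_arch_simple by blast
    then have "\<forall>\<^sub>F n in sequentially. u n x = 0"
      by (intro eventually_sequentiallyI[of k]) (auto simp: u_def)
    then show "(\<lambda>n. u n x) \<longlonglongrightarrow> 0" by (rule tendsto_eventually)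
  qed
  then have "(\<lambda>n. fnorm X (u n)) \<longlonglongrightarrow> 0" using oc u(1) unfolding order_continuous_def by blast
  then show ?thesis by (simp add: u)
qed

section \<open>The p-th power as a seminormed lattice of functions\<close>

lemma elems_Z: "h \<in> elems Z \<longleftrightarrow> h \<in> borel_measurable M \<and> (\<lambda>x. \<bar>h x\<bar> powr (1 / p)) \<in> elems X"
  using p by (simp add: fpower_def)

lemma fnorm_Z: "fnorm Z h = fnorm X (\<lambda>x. \<bar>h x\<bar> powr (1 / p)) powr p"
  using p by (simp add: fpower_def)

lemma Z_measurable [measurable_dest]: "h \<in> elems Z \<Longrightarrow> h \<in> borel_measurable M"
  by (simp add: elems_Z)

lemma Z_ideal:
  assumes "f \<in> elems Z" "g \<in> borel_measurable M" "AE x in M. \<bar>g x\<bar> \<le> \<bar>f x\<bar>"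
  shows "g \<in> elems Z" "fnorm Z g \<le> fnorm Z f"
proof -
  note assms(2)[measurable]
  have f: "(\<lambda>x. \<bar>f x\<bar> powr (1 / p)) \<in> elems X" using assms(1) by (simp add: elems_Z)
  have ae: "AE x in M. \<bar>\<bar>g x\<bar> powr (1 / p)\<bar> \<le> \<bar>\<bar>f x\<bar> powr (1 / p)\<bar>"
    using assms(3) by eventually_elim (use p in \<open>auto intro: powr_mono2\<close>)
  have m: "(\<lambda>x. \<bar>g x\<bar> powr (1 / p)) \<in> borel_measurable M" by measurable
  show "g \<in> elems Z" using X_ideal(1)[OF f m ae] assms(2) by (simp add: elems_Z)
  show "fnorm Z g \<le> fnorm Z f"
    using X_ideal[OF f m ae] X.norm_nonneg p by (simp add: fnorm_Z powr_mono2)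
qed

lemma Z_zero_iff: "h \<in> elems Z \<Longrightarrow> fnorm Z h = 0 \<longleftrightarrow> (AE x in M. h x = 0)"
  using X_zero_iff[of "\<lambda>x. \<bar>h x\<bar> powr (1 / p)"] by (simp add: fnorm_Z elems_Z)

lemma root_p_add_le: "0 \<le> a \<Longrightarrow> 0 \<le> b \<Longrightarrow> (a powr p + b powr p) powr (1 / p) \<le> 2 * (a + b)" for a b :: real
proof -
  assume ab: "0 \<le> a" "0 \<le> b"
  have "a powr p + b powr p \<le> 2 * (a + b) powr p"
    using ab p powr_mono2[of p a "a + b"] powr_mono2[of p b "a + b"] by linarith
  also have "\<dots> \<le> 2 powr p * (a + b) powr p"
    using p powr_mono[of 1 p 2] by (intro mult_right_mono) auto
  also have "\<dots> = (2 * (a + b)) powr p" by (subst powr_mult) (use ab in auto)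
  finally have "(a powr p + b powr p) powr (1 / p) \<le> ((2 * (a + b)) powr p) powr (1 / p)"
    using p by (intro powr_mono2) auto
  then show ?thesis using ab p by (simp add: powr_powr)
qed

text \<open>With \<open>F\<close> and \<open>G\<close> the p-th roots of
  \<open>\<bar>f\<bar>\<close> and \<open>\<bar>g\<bar>\<close>, the root of
  \<open>\<bar>f + g\<bar>\<close> is at most the p-sum of \<open>F\<close> and \<open>G\<close>, so
  p-convexity with constant 1 for two functions is exactly the triangle inequality here.\<close>

lemma Z_add:
  assumes "f \<in> elems Z" "g \<in> elems Z"
  shows "(\<lambda>x. f x + g x) \<in> elems Z" "fnorm Z (\<lambda>x. f x + g x) \<le> fnorm Z f + fnorm Z g"
proof -
  note Z_measurable[OF assms(1), measurable] Z_measurable[OF assms(2), measurable]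
  define F where "F = (\<lambda>x. \<bar>f x\<bar> powr (1 / p))"
  define G where "G = (\<lambda>x. \<bar>g x\<bar> powr (1 / p))"
  have FG: "F \<in> elems X" "G \<in> elems X" using assms by (auto simp: elems_Z F_def G_def)
  have [measurable]: "F \<in> borel_measurable M" "G \<in> borel_measurable M" using FG X_measurable by auto
  have pow: "F x powr p = \<bar>f x\<bar>" "G x powr p = \<bar>g x\<bar>" for x
    using p by (auto simp: F_def G_def powr_powr)
  define s where "s = (\<lambda>x. (F x powr p + G x powr p) powr (1 / p))"
  \<comment> \<open>p-convexity estimates a norm; membership comes first, from the crude bound
    \<open>2 * (F + G)\<close> and the ideal property.\<close>
  have s: "s \<in> elems X"
  proof (rule X_ideal(1)[OF X.scale_mem[OF X.add_mem[OF FG], of 2]])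
    show "s \<in> borel_measurable M" unfolding s_def by measurable
    show "AE x in M. \<bar>s x\<bar> \<le> \<bar>2 * (F x + G x)\<bar>"
      using root_p_add_le[of "F x" "G x" for x] by (auto simp: s_def F_def G_def)
  qed
  have m: "(\<lambda>x. \<bar>f x + g x\<bar> powr (1 / p)) \<in> borel_measurable M" by measurable
  have ae: "AE x in M. \<bar>\<bar>f x + g x\<bar> powr (1 / p)\<bar> \<le> \<bar>s x\<bar>"
    using p by (auto simp: s_def pow intro!: powr_mono2)
  note sum = X_ideal[OF s m ae]
  show "(\<lambda>x. f x + g x) \<in> elems Z" using sum by (simp add: elems_Z)
  have "fnorm X s \<le> (fnorm X F powr p + fnorm X G powr p) powr (1 / p)"
  proof -
    have "fnorm X (\<lambda>x. (\<Sum>i<2::nat. \<bar>(if i = 0 then F else G) x\<bar> powr p) powr (1 / p))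
        \<le> (\<Sum>i<2::nat. fnorm X (if i = 0 then F else G) powr p) powr (1 / p)"
      using pconvex FG unfolding p_convex_const_1_def by (elim allE[of _ "2::nat"] allE[of _ "\<lambda>i. if i = 0 then F else G"]) auto
    moreover have "\<bar>F x\<bar> = F x" "\<bar>G x\<bar> = G x" for x by (auto simp: F_def G_def)
    ultimately show ?thesis by (simp add: s_def numeral_2_eq_2)
  qed
  with sum(2) have "fnorm X (\<lambda>x. \<bar>f x + g x\<bar> powr (1 / p)) \<le> (fnorm X F powr p + fnorm X G powr p) powr (1 / p)"
    by linarith
  then have "fnorm Z (\<lambda>x. f x + g x) \<le> ((fnorm X F powr p + fnorm X G powr p) powr (1 / p)) powr p"
    unfolding fnorm_Z using p X.norm_nonneg[OF sum(1)] by (intro powr_mono2) auto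
  also have "\<dots> = fnorm Z f + fnorm Z g"
    using p by (simp add: powr_powr fnorm_Z F_def G_def)
  finally show "fnorm Z (\<lambda>x. f x + g x) \<le> fnorm Z f + fnorm Z g" .
qed

sublocale Z: function_space Z
proof
  fix f g :: "'a \<Rightarrow> real" and c :: real
  assume f: "f \<in> elems Z"
  show "(\<lambda>x. f x + g x) \<in> elems Z" "fnorm Z (\<lambda>x. f x + g x) \<le> fnorm Z f + fnorm Z g"
    if "g \<in> elems Z" using Z_add[OF f that] by auto
  have eq: "(\<lambda>x. \<bar>c * f x\<bar> powr (1 / p)) = (\<lambda>x. \<bar>c\<bar> powr (1 / p) * \<bar>f x\<bar> powr (1 / p))"
    by (simp add: abs_mult powr_mult)
  have fX: "(\<lambda>x. \<bar>f x\<bar> powr (1 / p)) \<in> elems X" using f by (simp add: elems_Z)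
  show "(\<lambda>x. c * f x) \<in> elems Z"
    unfolding elems_Z eq using X.scale_mem[OF fX] Z_measurable[OF f] by simp
  show "fnorm Z (\<lambda>x. c * f x) = \<bar>c\<bar> * fnorm Z f"
    unfolding fnorm_Z eq using X.norm_scale[OF fX] X.norm_nonneg[OF fX] p
    by (simp add: powr_mult powr_powr)
next
  have "(\<lambda>x. \<bar>0::real\<bar> powr (1 / p)) \<in> elems X" using X.zero_mem by simp
  then have "(\<lambda>x. 0) \<in> elems Z" unfolding elems_Z by simp
  then show "elems Z \<noteq> {}" by blast
qed

lemma Z_dist_zero_iff:
  "\<lbrakk>f \<in> elems Z; g \<in> elems Z\<rbrakk> \<Longrightarrow> fnorm Z (\<lambda>x. f x - g x) = 0 \<longleftrightarrow> (AE x in M. f x = g x)"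
  using Z_zero_iff[OF Z.diff_mem, of f g] by simp

lemma Z_norm_cong:
  assumes "f \<in> elems Z" "g \<in> elems Z" "AE x in M. f x = g x"
  shows "fnorm Z f = fnorm Z g"
  using assms by (intro antisym Z_ideal(2)) (auto simp: Z_measurable)

section \<open>The power \<open>p - 1\<close>, which is the space of essentially bounded functions
  at \<open>p = 1\<close>\<close>

lemma esssup_abs_ge_0:
  assumes "f \<in> borel_measurable M"
  shows "0 \<le> esssup M (\<lambda>x. ereal \<bar>f x\<bar>)"
proof -
  have "esssup M (\<lambda>x. 0 :: ereal) \<le> esssup M (\<lambda>x. ereal \<bar>f x\<bar>)" by (rule esssup_mono) auto
  then show ?thesis using esssup_const[OF nontrivial, of "0::ereal"] by simp
qed

lemma L_infty_bound:
  assumes "g \<in> elems (L_infty M)"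
  shows "AE x in M. \<bar>g x\<bar> \<le> fnorm (L_infty M) g" "0 \<le> fnorm (L_infty M) g"
proof -
  have g: "g \<in> borel_measurable M" "esssup M (\<lambda>x. ereal \<bar>g x\<bar>) < \<infinity>" (is "?s < _")
    using assms by (auto simp: L_infty_def)
  have "?s = ereal (real_of_ereal ?s)"
    using esssup_abs_ge_0[OF g(1)] g(2) by (cases ?s) auto
  with esssup_AE[of "\<lambda>x. ereal \<bar>g x\<bar>" M] have "AE x in M. ereal \<bar>g x\<bar> \<le> ereal (real_of_ereal ?s)"
    by metis
  then show "AE x in M. \<bar>g x\<bar> \<le> fnorm (L_infty M) g" by (simp add: L_infty_def)
  show "0 \<le> fnorm (L_infty M) g"
    using esssup_abs_ge_0[OF g(1)] by (simp add: L_infty_def real_of_ereal_pos)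
qed

lemma L_inftyI:
  assumes g: "g \<in> borel_measurable M" and K: "AE x in M. \<bar>g x\<bar> \<le> K"
  shows "g \<in> elems (L_infty M)" "fnorm (L_infty M) g \<le> K"
proof -
  have le: "esssup M (\<lambda>x. ereal \<bar>g x\<bar>) \<le> ereal K" (is "?s \<le> _")
    using assms by (intro esssup_I) auto
  then have "?s < \<infinity>" by (meson ereal_infty_less(1) less_le_trans not_le order.strict_trans1 less_ereal.simps(4))
  then show "g \<in> elems (L_infty M)" using g by (simp add: L_infty_def)
  show "fnorm (L_infty M) g \<le> K"
    using le esssup_abs_ge_0[OF g] by (cases ?s) (auto simp: L_infty_def)
qed

lemma Y_cases:
  obtains (bounded) "p = 1" "Y = L_infty M"
  | (power) "p > 1" "\<And>g. g \<in> elems Y \<longleftrightarrow> g \<in> borel_measurable M \<and> (\<lambda>x. \<bar>g x\<bar> powr (1 / (p - 1))) \<in> elems X"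
      "\<And>g. fnorm Y g = fnorm X (\<lambda>x. \<bar>g x\<bar> powr (1 / (p - 1))) powr (p - 1)"
proof (cases "p = 1")
  case True then show ?thesis using bounded by (simp add: fpower_def)
next
  case False
  then show ?thesis using power p by (simp add: fpower_def)
qed

lemma Y_measurable [measurable_dest]: "g \<in> elems Y \<Longrightarrow> g \<in> borel_measurable M"
  by (cases rule: Y_cases) (auto simp: L_infty_def)

lemma Y_norm_nonneg: "g \<in> elems Y \<Longrightarrow> 0 \<le> fnorm Y g"
  by (cases rule: Y_cases) (auto simp: L_infty_bound)

lemma Y_ideal:
  assumes g: "g \<in> elems Y" and g'[measurable]: "g' \<in> borel_measurable M"
    and le: "AE x in M. \<bar>g' x\<bar> \<le> \<bar>g x\<bar>"
  shows "g' \<in> elems Y \<and> fnorm Y g' \<le> fnorm Y g"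
proof (cases rule: Y_cases)
  case bounded
  have "AE x in M. \<bar>g' x\<bar> \<le> fnorm Y g"
    using L_infty_bound(1)[of g] g le bounded by auto
  then show ?thesis using L_inftyI[OF g'] bounded by simp
next
  case power
  have gX: "(\<lambda>x. \<bar>g x\<bar> powr (1 / (p - 1))) \<in> elems X" using g power by blast
  have ae: "AE x in M. \<bar>\<bar>g' x\<bar> powr (1 / (p - 1))\<bar> \<le> \<bar>\<bar>g x\<bar> powr (1 / (p - 1))\<bar>"
    using le by eventually_elim (use power(1) in \<open>auto intro: powr_mono2\<close>)
  have m: "(\<lambda>x. \<bar>g' x\<bar> powr (1 / (p - 1))) \<in> borel_measurable M" by measurable
  show ?thesis
    using X_ideal[OF gX m ae] X.norm_nonneg power(1) g' by (simp add: power(2,3) powr_mono2)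
qed

lemma Y_bounded:
  obtains c where "c \<ge> 0" "\<And>g K. \<lbrakk>g \<in> borel_measurable M; AE x in M. \<bar>g x\<bar> \<le> K; K \<ge> 0\<rbrakk> \<Longrightarrow>
     g \<in> elems Y \<and> fnorm Y g \<le> K * c"
proof (cases rule: Y_cases)
  case bounded
  then show ?thesis using that[of 1] L_inftyI by simp
next
  case power
  show ?thesis
  proof (rule that[of "fnorm X e powr (p - 1)"])
    fix g :: "'a \<Rightarrow> real" and K :: real assume [measurable]: "g \<in> borel_measurable M" and ae: "AE x in M. \<bar>g x\<bar> \<le> K" and K: "K \<ge> 0"
    have m: "(\<lambda>x. \<bar>g x\<bar> powr (1 / (p - 1))) \<in> borel_measurable M" by measurable
    have ae: "AE x in M. \<bar>\<bar>g x\<bar> powr (1 / (p - 1))\<bar> \<le> K powr (1 / (p - 1))"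
      using ae by eventually_elim (use power(1) in \<open>auto intro: powr_mono2\<close>)
    note b = X_bounded[OF m ae]
    have "fnorm Y g \<le> (K powr (1 / (p - 1)) * fnorm X e) powr (p - 1)"
      unfolding power(3) using b X.norm_nonneg power(1) by (intro powr_mono2) auto
    also have "\<dots> = K * fnorm X e powr (p - 1)"
      using power(1) K X.norm_nonneg[OF indicator_in_X] by (simp add: powr_mult powr_powr)
    finally show "g \<in> elems Y \<and> fnorm Y g \<le> K * fnorm X e powr (p - 1)"
      using b by (simp add: power(2))
  qed simp
qed

text \<open>At \<open>p = 1\<close> the tail of an essentially bounded function is null from some
  level on, so the supremum norm causes no obstruction. For \<open>p > 1\<close> it reduces to tails
  in X, cut at levels of \<open>g\<close>.\<close>

lemma Y_tail_tendsto_0: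
  assumes g: "g \<in> elems Y"
  shows "(\<lambda>n. fnorm Y (\<lambda>x. if \<bar>g x\<bar> > real n then g x else 0)) \<longlonglongrightarrow> 0"
proof (cases rule: Y_cases)
  case bounded
  obtain k :: nat where k: "fnorm Y g \<le> k" using real_arch_simple by blast
  have "fnorm Y (\<lambda>x. if \<bar>g x\<bar> > real n then g x else 0) = 0" if "n \<ge> k" for n
  proof -
    note Y_measurable[OF g, measurable]
    have m: "(\<lambda>x. if \<bar>g x\<bar> > real n then g x else 0) \<in> borel_measurable M" by measurable
    have "AE x in M. \<bar>g x\<bar> \<le> fnorm Y g" using L_infty_bound(1)[of g] g bounded by simp
    then have "AE x in M. \<bar>if \<bar>g x\<bar> > real n then g x else 0\<bar> \<le> 0"
      by eventually_elim (use k that in auto)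
    from L_inftyI[OF m this] L_infty_bound(2) bounded show ?thesis by force
  qed
  then have "\<forall>\<^sub>F n in sequentially. fnorm Y (\<lambda>x. if \<bar>g x\<bar> > real n then g x else 0) = 0"
    by (intro eventually_sequentiallyI[of k]) auto
  then show ?thesis by (rule tendsto_eventually)
next
  case power
  note Y_measurable[OF g, measurable]
  have eq: "(\<lambda>x. \<bar>if \<bar>g x\<bar> > real n then g x else 0\<bar> powr (1 / (p - 1))) =
      (\<lambda>x. if \<bar>g x\<bar> > real n then \<bar>g x\<bar> powr (1 / (p - 1)) else 0)" for n :: nat
    by auto
  have gX: "(\<lambda>x. \<bar>g x\<bar> powr (1 / (p - 1))) \<in> elems X" using g power(2) by blast
  have tailX: "(\<lambda>x. if \<bar>g x\<bar> > real n then \<bar>g x\<bar> powr (1 / (p - 1)) else 0) \<in> elems X" for n :: nat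
    by (rule X_ideal(1)[OF gX]) auto
  have "(\<lambda>n. fnorm X (\<lambda>x. if \<bar>g x\<bar> > real n then \<bar>g x\<bar> powr (1 / (p - 1)) else 0) powr (p - 1)) \<longlonglongrightarrow> 0 powr (p - 1)"
    using power(1) X.norm_nonneg[OF tailX]
    by (intro tendsto_powr' X_tail_tendsto_0[OF gX] tendsto_const) auto
  then show ?thesis by (simp add: power(3) eq)
qed

text \<open>The lattice form of Hoelder's inequality. Young's inequality is applied to
  \<open>c * \<bar>u\<bar>\<close> and \<open>d * \<bar>v\<bar>\<close>, and \<open>k\<close> undoes
  the scaling. Taking \<open>c\<close> and \<open>d\<close> to be the inverse norms makes the
  bracket \<open>s + t = 1\<close> and \<open>k\<close> the claimed bound.\<close>

lemma X_log_convex: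
  assumes u: "u \<in> elems X" and v: "v \<in> elems X"
    and w: "w \<in> borel_measurable M" "AE x in M. \<bar>w x\<bar> = \<bar>u x\<bar> powr s * \<bar>v x\<bar> powr t"
    and st: "s > 0" "t > 0" "s + t = 1"
  shows "w \<in> elems X" "fnorm X w \<le> fnorm X u powr s * fnorm X v powr t"
proof -
  have young: "a powr s * b powr t \<le> s * a + t * b" if "a \<ge> 0" "b \<ge> 0" for a b :: real
    using Youngs_inequality_0[of s t a b] that st by (cases "a = 0 \<or> b = 0") auto
  have a: "(\<lambda>x. \<bar>u x\<bar>) \<in> elems X" "fnorm X (\<lambda>x. \<bar>u x\<bar>) = fnorm X u"
    using X_abs[OF u] by auto
  have b: "(\<lambda>x. \<bar>v x\<bar>) \<in> elems X" "fnorm X (\<lambda>x. \<bar>v x\<bar>) = fnorm X v"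
    using X_abs[OF v] by auto
  have cmb: "w \<in> elems X \<and> fnorm X w \<le> k * (s * (c * fnorm X u) + t * (d * fnorm X v))"
    if "c > 0" "d > 0" and k: "k * (c powr s * d powr t) = 1" "k > 0" for c d k
  proof -
    let ?r = "\<lambda>x. k * (s * (c * \<bar>u x\<bar>) + t * (d * \<bar>v x\<bar>))"
    have r: "?r \<in> elems X" by (intro X.scale_mem X.add_mem a b)
    have "AE x in M. \<bar>w x\<bar> \<le> \<bar>?r x\<bar>"
      using w(2)
    proof eventually_elim
      case (elim x)
      have "\<bar>w x\<bar> = k * ((c * \<bar>u x\<bar>) powr s * (d * \<bar>v x\<bar>) powr t)"
        using elim that by (simp add: powr_mult algebra_simps)
      also have "\<dots> \<le> ?r x" using k that young[of "c * \<bar>u x\<bar>" "d * \<bar>v x\<bar>"] by (intro mult_left_mono) auto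
      finally show ?case by linarith
    qed
    note w = X_ideal[OF r w(1) this]
    have "fnorm X ?r \<le> k * (s * (c * fnorm X u) + t * (d * fnorm X v))"
      using X.norm_add[of "\<lambda>x. s * (c * \<bar>u x\<bar>)" "\<lambda>x. t * (d * \<bar>v x\<bar>)"] k that st a b
      by (simp add: X.norm_scale X.add_mem X.scale_mem)
    with w show ?thesis by linarith
  qed
  show wX: "w \<in> elems X" using cmb[of 1 1 1] by simp
  show "fnorm X w \<le> fnorm X u powr s * fnorm X v powr t"
  proof (cases "fnorm X u = 0 \<or> fnorm X v = 0")
    case True
    then have "AE x in M. w x = 0"
    proof
      assume "fnorm X u = 0"
      then have "AE x in M. u x = 0" using X_zero_iff u by simp
      with w(2) show ?thesis by eventually_elim auto
    next
      assume "fnorm X v = 0"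
      then have "AE x in M. v x = 0" using X_zero_iff v by simp
      with w(2) show ?thesis by eventually_elim auto
    qed
    then show ?thesis using X_zero_iff[OF wX] by simp
  next
    case False
    then have pos: "fnorm X u > 0" "fnorm X v > 0"
      using X.norm_nonneg[OF u] X.norm_nonneg[OF v] by linarith+
    have "fnorm X w \<le> (fnorm X u powr s * fnorm X v powr t) *
       (s * (inverse (fnorm X u) * fnorm X u) + t * (inverse (fnorm X v) * fnorm X v))"
      using pos by (intro cmb[THEN conjunct2]) (auto simp: powr_mult[symmetric] powr_powr inverse_eq_divide powr_divide)
    then show ?thesis using pos st by simp
  qed
qed

text \<open>For \<open>p > 1\<close> the p-th root of \<open>\<bar>f * g\<bar>\<close> is a
  geometric mean of \<open>\<bar>f\<bar>\<close> and the root of \<open>\<bar>g\<bar>\<close> that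
  lies in X, with exponents \<open>1 / p\<close> and \<open>(p - 1) / p\<close>. For
  \<open>p = 1\<close> it is multiplication by an essentially bounded function.\<close>

lemma prod_in_Z:
  assumes f: "f \<in> elems X" and g: "g \<in> elems Y"
  shows "(\<lambda>x. f x * g x) \<in> elems Z" "fnorm Z (\<lambda>x. f x * g x) \<le> fnorm X f * fnorm Y g"
proof -
  note X_measurable[OF f, measurable] Y_measurable[OF g, measurable]
  have m: "(\<lambda>x. \<bar>f x * g x\<bar> powr (1 / p)) \<in> borel_measurable M" by measurable
  have "(\<lambda>x. f x * g x) \<in> elems Z \<and> fnorm Z (\<lambda>x. f x * g x) \<le> fnorm X f * fnorm Y g"
  proof (cases rule: Y_cases)
    case bounded
    let ?c = "fnorm Y g"
    have c: "AE x in M. \<bar>g x\<bar> \<le> ?c" "0 \<le> ?c" using L_infty_bound[of g] g bounded by auto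
    from c(1) have "AE x in M. \<bar>f x * g x\<bar> \<le> \<bar>?c * f x\<bar>"
      by eventually_elim (use c(2) in \<open>simp add: abs_mult mult_left_mono mult.commute[of "fnorm Y g"]\<close>)
    then have fg: "(\<lambda>x. f x * g x) \<in> elems X" "fnorm X (\<lambda>x. f x * g x) \<le> ?c * fnorm X f"
      using X_ideal[OF X.scale_mem[OF f], of "\<lambda>x. f x * g x" ?c] X.norm_scale[OF f, of ?c] c by auto
    have "(\<lambda>x. \<bar>f x * g x\<bar> powr (1 / p)) \<in> elems X"
      "fnorm X (\<lambda>x. \<bar>f x * g x\<bar> powr (1 / p)) = fnorm X (\<lambda>x. f x * g x)"
      using X_cong[OF fg(1) m] bounded(1) by auto
    moreover have "fnorm X (\<lambda>x. f x * g x) powr p = fnorm X (\<lambda>x. f x * g x)"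
      using X.norm_nonneg[OF fg(1)] bounded(1) by simp
    ultimately show ?thesis unfolding elems_Z fnorm_Z using fg(2) by (simp add: mult.commute)
  next
    case power
    have gX: "(\<lambda>x. \<bar>g x\<bar> powr (1 / (p - 1))) \<in> elems X" (is "?g \<in> _") using g power(2) by blast
    have "\<bar>\<bar>f x * g x\<bar> powr (1 / p)\<bar> = \<bar>f x\<bar> powr (1 / p) * \<bar>?g x\<bar> powr ((p - 1) / p)" for x
      using power(1) by (simp add: abs_mult powr_mult powr_powr)
    then have "AE x in M. \<bar>\<bar>f x * g x\<bar> powr (1 / p)\<bar> = \<bar>f x\<bar> powr (1 / p) * \<bar>?g x\<bar> powr ((p - 1) / p)"
      by simp
    note w = X_log_convex[OF f gX m this]
    have st: "1 / p > 0" "(p - 1) / p > 0" "1 / p + (p - 1) / p = 1" using power(1) by (auto simp: field_simps)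
    note w = w[OF st]
    have "fnorm Z (\<lambda>x. f x * g x) \<le> (fnorm X f powr (1 / p) * fnorm X ?g powr ((p - 1) / p)) powr p"
      unfolding fnorm_Z using w X.norm_nonneg[OF w(1)] p by (intro powr_mono2) auto
    also have "\<dots> = fnorm X f * fnorm Y g"
      using power(1) X.norm_nonneg[OF f] by (simp add: powr_mult powr_powr power(3))
    finally show ?thesis using w(1) by (simp add: elems_Z)
  qed
  then show "(\<lambda>x. f x * g x) \<in> elems Z" "fnorm Z (\<lambda>x. f x * g x) \<le> fnorm X f * fnorm Y g" by auto
qed

definition factor_X :: "('a \<Rightarrow> real) \<Rightarrow> 'a \<Rightarrow> real" where
  "factor_X h = (\<lambda>x. sgn (h x) * \<bar>h x\<bar> powr (1 / p))"

text \<open>The sign sits in the other factor. Since \<open>0 powr 0 = 0\<close>, at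
  \<open>p = 1\<close> this is the indicator of the set where \<open>h\<close> is nonzero.\<close>

definition factor_Y :: "('a \<Rightarrow> real) \<Rightarrow> 'a \<Rightarrow> real" where
  "factor_Y h = (\<lambda>x. \<bar>h x\<bar> powr ((p - 1) / p))"

lemma factor_prod: "factor_X h x * factor_Y h x = h x"
proof (cases "h x = 0")
  case False
  have "1 / p + (p - 1) / p = 1" using p by (simp add: field_simps)
  then have "\<bar>h x\<bar> powr (1 / p) * \<bar>h x\<bar> powr ((p - 1) / p) = \<bar>h x\<bar>"
    using False by (simp add: powr_add[symmetric])
  then show ?thesis
    by (simp add: factor_X_def factor_Y_def mult.assoc sgn_mult_abs)
qed (simp add: factor_X_def)

lemma factor:
  assumes h: "h \<in> elems Z"
  shows "factor_X h \<in> elems X" "factor_Y h \<in> elems Y"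
    "fnorm X (factor_X h) * fnorm Y (factor_Y h) \<le> fnorm Z h"
    "fnorm X (factor_X h) = fnorm Z h powr (1 / p)"
    "fnorm Z h \<le> 1 \<Longrightarrow> fnorm Y (factor_Y h) \<le> 1"
proof -
  note Z_measurable[OF h, measurable]
  have hX: "(\<lambda>x. \<bar>h x\<bar> powr (1 / p)) \<in> elems X" (is "?h \<in> _") using h by (simp add: elems_Z)
  have abs: "\<bar>factor_X h x\<bar> = \<bar>?h x\<bar>" for x by (auto simp: factor_X_def abs_mult sgn_if)
  have m: "factor_X h \<in> borel_measurable M" unfolding factor_X_def by measurable
  show fX: "factor_X h \<in> elems X" using X_cong(1)[OF hX m] abs by simp
  have nX: "fnorm X (factor_X h) = fnorm X ?h" using X_cong(2)[OF hX m] abs by simp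
  then show nX': "fnorm X (factor_X h) = fnorm Z h powr (1 / p)"
    using p X.norm_nonneg[OF hX] by (simp add: fnorm_Z powr_powr)
  have m: "factor_Y h \<in> borel_measurable M" unfolding factor_Y_def by measurable
  \<comment> \<open>At \<open>p = 1\<close> the exponent \<open>p - 1\<close> vanishes, and the
    plain bound 1 takes the place of the power of the norm.\<close>
  have Y: "factor_Y h \<in> elems Y \<and> fnorm Y (factor_Y h) \<le> fnorm X ?h powr (p - 1)
      \<or> factor_Y h \<in> elems Y \<and> fnorm Y (factor_Y h) \<le> 1 \<and> p = 1"
  proof (cases rule: Y_cases)
    case bounded
    have "AE x in M. \<bar>factor_Y h x\<bar> \<le> 1" unfolding factor_Y_def using bounded(1) by simp
    then show ?thesis using L_inftyI[OF m, of 1] bounded by simp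
  next
    case power
    have "(\<lambda>x. \<bar>factor_Y h x\<bar> powr (1 / (p - 1))) = ?h"
      using power(1) by (simp add: factor_Y_def powr_powr fun_eq_iff)
    then show ?thesis using hX m by (simp add: power(2,3))
  qed
  then show "factor_Y h \<in> elems Y" by blast
  have hp: "fnorm X ?h * fnorm X ?h powr (p - 1) = fnorm Z h"
    using X.norm_nonneg[OF hX] p by (cases "fnorm X ?h = 0") (simp_all add: fnorm_Z powr_mult_base)
  show "fnorm X (factor_X h) * fnorm Y (factor_Y h) \<le> fnorm Z h"
    using Y
  proof (elim disjE conjE)
    assume "fnorm Y (factor_Y h) \<le> fnorm X ?h powr (p - 1)"
    then show ?thesis using hp X.norm_nonneg[OF hX] unfolding nX by (metis mult_left_mono)
  next
    assume "fnorm Y (factor_Y h) \<le> 1" "p = 1"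
    moreover have "fnorm X ?h powr p = fnorm X ?h" using \<open>p = 1\<close> X.norm_nonneg[OF hX] by simp
    ultimately show ?thesis
      unfolding nX fnorm_Z using X.norm_nonneg[OF hX] mult_left_mono[of "fnorm Y (factor_Y h)" 1 "fnorm X ?h"]
      by linarith
  qed
  assume "fnorm Z h \<le> 1"
  then have "fnorm X ?h \<le> 1"
    using nX nX' p Z.norm_nonneg[OF h] powr_le1[of "1 / p" "fnorm Z h"] by simp
  then have "fnorm X ?h powr (p - 1) \<le> 1" using p X.norm_nonneg[OF hX] by (intro powr_le1) auto
  then show "fnorm Y (factor_Y h) \<le> 1" using Y by linarith
qed

lemma prod_map_balls: "(\<lambda>(f, g). prod_map f g) ` (fball X \<times> fball Y) = fball Z"
proof (intro equalityI subsetI)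
  fix h assume "h \<in> (\<lambda>(f, g). prod_map f g) ` (fball X \<times> fball Y)"
  then obtain f g where fg: "f \<in> fball X" "g \<in> fball Y" "h = (\<lambda>x. f x * g x)"
    by (auto simp: prod_map_def)
  then have V: "f \<in> elems X" "g \<in> elems Y" "fnorm X f \<le> 1" "fnorm Y g \<le> 1" by (auto simp: fball_def)
  have "fnorm X f * fnorm Y g \<le> 1"
    using V X.norm_nonneg Y_norm_nonneg by (simp add: mult_le_one)
  then show "h \<in> fball Z" using prod_in_Z[OF V(1,2)] fg by (simp add: fball_def)
next
  fix h assume "h \<in> fball Z"
  then have h: "h \<in> elems Z" "fnorm Z h \<le> 1" by (auto simp: fball_def)
  have "fnorm Z h powr (1 / p) \<le> 1" using h p Z.norm_nonneg[OF h(1)] by (intro powr_le1) auto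
  then have "factor_X h \<in> fball X" "factor_Y h \<in> fball Y" using factor[OF h(1)] h(2) by (auto simp: fball_def)
  moreover have "h = prod_map (factor_X h) (factor_Y h)" by (simp add: prod_map_def factor_prod)
  ultimately show "h \<in> (\<lambda>(f, g). prod_map f g) ` (fball X \<times> fball Y)" by force
qed

text \<open>The inverse of the sign preserving power is \<open>factor_X\<close>, the signed p-th
  root.\<close>

lemma sign_powr_ball: "(\<lambda>f. sign_powr f p) ` fball X = fball Z"
proof (intro equalityI subsetI)
  fix h assume "h \<in> (\<lambda>f. sign_powr f p) ` fball X"
  then obtain f where f: "f \<in> elems X" "fnorm X f \<le> 1" "h = sign_powr f p" by (auto simp: fball_def)
  note X_measurable[OF f(1), measurable]
  have eq: "(\<lambda>x. \<bar>h x\<bar> powr (1 / p)) = (\<lambda>x. \<bar>f x\<bar>)"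
    using p by (auto simp: f(3) sign_powr_def abs_mult powr_mult powr_powr sgn_if fun_eq_iff)
  have a: "(\<lambda>x. \<bar>f x\<bar>) \<in> elems X" "fnorm X (\<lambda>x. \<bar>f x\<bar>) = fnorm X f" using X_abs[OF f(1)] by auto
  have "h \<in> borel_measurable M" unfolding f(3) sign_powr_def by measurable
  moreover have "fnorm X f powr p \<le> 1" using f X.norm_nonneg p by (intro powr_le1) auto
  ultimately show "h \<in> fball Z" by (simp add: fball_def elems_Z fnorm_Z eq a)
next
  fix h assume "h \<in> fball Z"
  then have h: "h \<in> elems Z" "fnorm Z h \<le> 1" by (auto simp: fball_def)
  have "fnorm Z h powr (1 / p) \<le> 1" using h p Z.norm_nonneg[OF h(1)] by (intro powr_le1) auto
  then have "factor_X h \<in> fball X" using factor[OF h(1)] by (auto simp: fball_def)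
  moreover have "h = sign_powr (factor_X h) p"
    using p by (auto simp: sign_powr_def factor_X_def abs_mult powr_mult powr_powr sgn_mult fun_eq_iff sgn_if)
  ultimately show "h \<in> (\<lambda>f. sign_powr f p) ` fball X" by blast
qed

section \<open>Factorization of symmetric bilinear maps\<close>

text \<open>The test functions: they form an algebra contained in both X and \<open>Y\<close>, so
  \<open>B f g\<close> and \<open>B (f * g) e\<close> make sense together, and simple functions
  approximate them uniformly.\<close>

definition ess_bounded :: "('a \<Rightarrow> real) \<Rightarrow> bool" where
  "ess_bounded f \<longleftrightarrow> f \<in> borel_measurable M \<and> (\<exists>k\<ge>0. AE x in M. \<bar>f x\<bar> \<le> k)"

lemma ess_boundedI: "\<lbrakk>f \<in> borel_measurable M; AE x in M. \<bar>f x\<bar> \<le> k; k \<ge> 0\<rbrakk> \<Longrightarrow> ess_bounded f"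
  by (auto simp: ess_bounded_def)

lemma ess_bounded_add:
  assumes "ess_bounded f" "ess_bounded g"
  shows "ess_bounded (\<lambda>x. f x + g x)"
proof -
  obtain k l where "AE x in M. \<bar>f x\<bar> \<le> k" "k \<ge> 0" "AE x in M. \<bar>g x\<bar> \<le> l" "l \<ge> 0"
    and [measurable]: "f \<in> borel_measurable M" "g \<in> borel_measurable M"
    using assms by (auto simp: ess_bounded_def)
  then show ?thesis by (intro ess_boundedI[of _ "k + l"]) auto
qed

lemma ess_bounded_mult:
  assumes "ess_bounded f" "ess_bounded g"
  shows "ess_bounded (\<lambda>x. f x * g x)"
proof -
  obtain k l where kl: "AE x in M. \<bar>f x\<bar> \<le> k" "k \<ge> 0" "AE x in M. \<bar>g x\<bar> \<le> l" "l \<ge> 0"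
    and [measurable]: "f \<in> borel_measurable M" "g \<in> borel_measurable M"
    using assms by (auto simp: ess_bounded_def)
  have "AE x in M. \<bar>f x * g x\<bar> \<le> k * l"
    using kl(1,3) by eventually_elim (use kl in \<open>simp add: abs_mult mult_mono\<close>)
  then show ?thesis using kl by (intro ess_boundedI[of _ "k * l"]) auto
qed

lemma ess_bounded_const: "ess_bounded (\<lambda>x. c)"
  by (rule ess_boundedI[of _ "\<bar>c\<bar>"]) auto

lemma ess_bounded_scale: "ess_bounded f \<Longrightarrow> ess_bounded (\<lambda>x. c * f x)"
  by (rule ess_bounded_mult[OF ess_bounded_const])

lemma ess_bounded_diff: "\<lbrakk>ess_bounded f; ess_bounded g\<rbrakk> \<Longrightarrow> ess_bounded (\<lambda>x. f x - g x)"
  using ess_bounded_add[OF _ ess_bounded_scale[of g "-1"], of f] by simp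

lemma ess_bounded_indicator: "A \<in> sets M \<Longrightarrow> ess_bounded (indicat_real A)"
  by (rule ess_boundedI[of _ 1]) (auto simp: indicator_def)

lemma ess_bounded_mem: "ess_bounded f \<Longrightarrow> f \<in> elems X" "ess_bounded f \<Longrightarrow> f \<in> elems Y"
  using X_bounded(1) Y_bounded unfolding ess_bounded_def by (blast, metis)

text \<open>\<open>L\<close> is linear and continuous for uniform convergence, up to null functions,
  so uniform approximation by simple functions suffices. The bound is phrased by the supremum of
  \<open>f\<close> so that it applies to either argument of \<open>B\<close>.\<close>

lemma vanishing_on_indicators:
  fixes L :: "('a \<Rightarrow> real) \<Rightarrow> 'a \<Rightarrow> real"
  assumes mem: "\<And>f. ess_bounded f \<Longrightarrow> L f \<in> elems Z"
    and add: "\<And>f g. \<lbrakk>ess_bounded f; ess_bounded g\<rbrakk> \<Longrightarrow> AE x in M. L (\<lambda>y. f y + g y) x = L f x + L g x"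
    and scale: "\<And>c f. ess_bounded f \<Longrightarrow> AE x in M. L (\<lambda>y. c * f y) x = c * L f x"
    and bound: "\<And>f k. \<lbrakk>f \<in> borel_measurable M; AE x in M. \<bar>f x\<bar> \<le> k; k \<ge> 0\<rbrakk> \<Longrightarrow> fnorm Z (L f) \<le> k * c"
    and ind: "\<And>A. A \<in> sets M \<Longrightarrow> AE x in M. L (indicat_real A) x = 0"
    and f: "ess_bounded f"
  shows "AE x in M. L f x = 0"
proof -
  have zero: "AE x in M. L (\<lambda>y. 0) x = 0"
    using bound[of "\<lambda>y. 0" 0] mem[OF ess_bounded_const] Z.norm_nonneg[OF mem[OF ess_bounded_const]]
    by (simp add: Z_zero_iff[symmetric] antisym)
  have simple: "ess_bounded (\<lambda>x. \<Sum>i\<in>I. a i * indicat_real (A i) x) \<and>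
      (AE x in M. L (\<lambda>x. \<Sum>i\<in>I. a i * indicat_real (A i) x) x = 0)"
    if "finite I" "\<And>i. i \<in> I \<Longrightarrow> A i \<in> sets M" for I :: "int set" and a A
    using that
  proof (induction I rule: finite_induct)
    case empty
    then show ?case using zero ess_bounded_const[of 0] by simp
  next
    case (insert i I)
    let ?s = "\<lambda>x. \<Sum>i\<in>I. a i * indicat_real (A i) x"
    have i: "ess_bounded (indicat_real (A i))" using insert by (intro ess_bounded_indicator) auto
    have s: "ess_bounded ?s" "AE x in M. L ?s x = 0" using insert by auto
    have "AE x in M. L (\<lambda>x. a i * indicat_real (A i) x + ?s x) x = 0"
      using add[OF ess_bounded_scale[OF i] s(1), of "a i"] scale[OF i, of "a i"] s(2) ind[of "A i"] insert
      by auto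
    moreover have "ess_bounded (\<lambda>x. a i * indicat_real (A i) x + ?s x)"
      using i s by (intro ess_bounded_add ess_bounded_scale)
    moreover have "(\<lambda>x. \<Sum>j\<in>insert i I. a j * indicat_real (A j) x) = (\<lambda>x. a i * indicat_real (A i) x + ?s x)"
      by (simp only: sum.insert[OF insert(1,2)])
    ultimately show ?case by metis
  qed
  obtain k where [measurable]: "f \<in> borel_measurable M" and k: "AE x in M. \<bar>f x\<bar> \<le> k" "k \<ge> 0"
    using f by (auto simp: ess_bounded_def)
  have "fnorm Z (L f) \<le> c / n" if "n > 0" for n :: nat
  proof -
    define A where "A i = {x \<in> space M. \<lfloor>real n * f x\<rfloor> = i}" for i
    define I where "I = {-\<lceil>real n * k\<rceil> - 1 .. \<lceil>real n * k\<rceil>}"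
    \<comment> \<open>\<open>f\<close> rounded down to a multiple of \<open>1 / n\<close>; almost
      every point lies in a level set with index in \<open>I\<close>, because
      \<open>\<bar>n * f\<bar> \<le> n * k\<close>.\<close>
    define s where "s = (\<lambda>x. \<Sum>i\<in>I. (of_int i / n) * indicat_real (A i) x)"
    have "A i \<in> sets M" for i unfolding A_def by measurable
    then have s: "ess_bounded s" "AE x in M. L s x = 0"
      using simple[of I A "\<lambda>i. of_int i / n"] by (auto simp: s_def I_def)
    have close: "AE x in M. \<bar>f x - s x\<bar> \<le> 1 / n"
      using k(1) AE_space
    proof eventually_elim
      case (elim x)
      have bnd: "\<bar>real n * f x\<bar> \<le> real n * k" using elim by (simp add: abs_mult mult_left_mono)
      then have "\<lfloor>real n * f x\<rfloor> \<in> I" unfolding I_def by (simp add: abs_le_iff) linarith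
      moreover have "s x = (\<Sum>i\<in>I. if i = \<lfloor>real n * f x\<rfloor> then of_int i / n else 0)"
        unfolding s_def using elim by (intro sum.cong) (auto simp: A_def indicator_def)
      ultimately have "s x = of_int \<lfloor>real n * f x\<rfloor> / n" by (simp add: I_def)
      then have eq: "real n * (f x - s x) = real n * f x - of_int \<lfloor>real n * f x\<rfloor>"
        using that by (simp add: algebra_simps)
      have "real n * \<bar>f x - s x\<bar> \<le> 1"
      proof -
        have "\<bar>real n * (f x - s x)\<bar> \<le> 1"
          unfolding eq using floor_correct[of "real n * f x"] by linarith
        then show ?thesis by (simp add: abs_mult)
      qed
      then show ?case using that by (simp add: field_simps)
    qed
    have d: "ess_bounded (\<lambda>x. f x - s x)" by (rule ess_bounded_diff[OF f s(1)])
    have "AE x in M. L (\<lambda>x. (f x - s x) + s x) x = L (\<lambda>x. f x - s x) x"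
      using add[OF d s(1)] s(2) by auto
    then have "fnorm Z (L f) = fnorm Z (L (\<lambda>x. f x - s x))"
      using mem[OF f] mem[OF d] by (intro Z_norm_cong) auto
    also have "\<dots> \<le> 1 / n * c"
      using d close by (intro bound) (auto simp: ess_bounded_def)
    finally show ?thesis by simp
  qed
  then have "\<forall>\<^sub>F n in sequentially. fnorm Z (L f) \<le> c / real n"
    by (intro eventually_sequentiallyI[of 1]) auto
  then have "fnorm Z (L f) \<le> 0"
    by (rule tendsto_lowerbound[OF lim_const_over_n]) simp
  then show ?thesis
    using Z_zero_iff[OF mem[OF f]] Z.norm_nonneg[OF mem[OF f]] by (simp add: antisym)
qed

section \<open>From indicators to a linear operator on products\<close>

context
  fixes B :: "('a \<Rightarrow> real) \<Rightarrow> ('a \<Rightarrow> real) \<Rightarrow> 'a \<Rightarrow> real"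
  assumes B: "bounded_bilinear_map M X Y Z B" and sym: "symmetric_bilinear M B"
begin

lemma B_mem: "\<lbrakk>f \<in> elems X; g \<in> elems Y\<rbrakk> \<Longrightarrow> B f g \<in> elems Z"
  using B by (simp add: bounded_bilinear_map_def)

lemma B_add_left: "\<lbrakk>f \<in> elems X; f' \<in> elems X; g \<in> elems Y\<rbrakk> \<Longrightarrow>
    AE x in M. B (\<lambda>y. f y + f' y) g x = B f g x + B f' g x"
  using B by (simp add: bounded_bilinear_map_def)

lemma B_add_right: "\<lbrakk>f \<in> elems X; g \<in> elems Y; g' \<in> elems Y\<rbrakk> \<Longrightarrow>
    AE x in M. B f (\<lambda>y. g y + g' y) x = B f g x + B f g' x"
  using B by (simp add: bounded_bilinear_map_def)

lemma B_scale_left: "\<lbrakk>f \<in> elems X; g \<in> elems Y\<rbrakk> \<Longrightarrow> AE x in M. B (\<lambda>y. c * f y) g x = c * B f g x"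
  using B by (simp add: bounded_bilinear_map_def)

lemma B_scale_right: "\<lbrakk>f \<in> elems X; g \<in> elems Y\<rbrakk> \<Longrightarrow> AE x in M. B f (\<lambda>y. c * g y) x = c * B f g x"
  using B by (simp add: bounded_bilinear_map_def)

lemma B_bound:
  "\<exists>C\<ge>0. \<forall>f\<in>elems X. \<forall>g\<in>elems Y. fnorm Z (B f g) \<le> C * fnorm X f * fnorm Y g"
proof -
  obtain C where C: "\<forall>f\<in>elems X. \<forall>g\<in>elems Y. fnorm Z (B f g) \<le> C * fnorm X f * fnorm Y g"
    using B by (auto simp: bounded_bilinear_map_def)
  have "fnorm Z (B f g) \<le> \<bar>C\<bar> * fnorm X f * fnorm Y g" if "f \<in> elems X" "g \<in> elems Y" for f g
  proof -
    have "C * (fnorm X f * fnorm Y g) \<le> \<bar>C\<bar> * (fnorm X f * fnorm Y g)"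
      using X.norm_nonneg[OF that(1)] Y_norm_nonneg[OF that(2)] by (intro mult_right_mono) auto
    then show ?thesis using C that by (force simp: mult.assoc)
  qed
  then show ?thesis by (intro exI[of _ "\<bar>C\<bar>"]) auto
qed

text \<open>Symmetry makes \<open>B\<close> vanish on indicators of disjoint sets, hence only the intersection matters.\<close>

lemma B_indicator:
  assumes A: "A \<in> sets M" and C: "C \<in> sets M"
  shows "AE x in M. B (indicat_real A) (indicat_real C) x = B (indicat_real (A \<inter> C)) e x"
proof -
  note ind = ess_bounded_mem[OF ess_bounded_indicator]
  have disjoint: "AE x in M. B (indicat_real A) (indicat_real C) x = 0"
    if AC: "A \<in> sets M" "C \<in> sets M" "A \<inter> C = {}" for A C
  proof -
    have "AE x in M. B (indicat_real A) (indicat_real C) x = B (indicat_real {}) (indicat_real (A \<union> C)) x"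
      using sym AC unfolding symmetric_bilinear_def by metis
    moreover have "AE x in M. B (\<lambda>y. 0 * indicat_real {} y) (indicat_real (A \<union> C)) x
        = 0 * B (indicat_real {}) (indicat_real (A \<union> C)) x"
      using AC by (intro B_scale_left ind) auto
    moreover have "(\<lambda>y. 0 * indicat_real {} y) = (indicat_real {} :: 'a \<Rightarrow> real)" by auto
    ultimately show ?thesis by auto
  qed
  have diag: "AE x in M. B (indicat_real A) (indicat_real C) x = B (indicat_real (A \<inter> C)) (indicat_real (A \<inter> C)) x"
    if AC[measurable]: "A \<in> sets M" "C \<in> sets M" for A C
  proof -
    have split: "indicat_real A = (\<lambda>y. indicat_real (A \<inter> C) y + indicat_real (A - C) y)"
      "indicat_real C = (\<lambda>y. indicat_real (A \<inter> C) y + indicat_real (C - A) y)"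
      by (auto simp: indicator_def)
    have "AE x in M. B (indicat_real A) (\<lambda>y. indicat_real (A \<inter> C) y + indicat_real (C - A) y) x
        = B (indicat_real A) (indicat_real (A \<inter> C)) x + B (indicat_real A) (indicat_real (C - A)) x"
      by (intro B_add_right ind) auto
    moreover have "AE x in M. B (\<lambda>y. indicat_real (A \<inter> C) y + indicat_real (A - C) y) (indicat_real (A \<inter> C)) x
        = B (indicat_real (A \<inter> C)) (indicat_real (A \<inter> C)) x + B (indicat_real (A - C)) (indicat_real (A \<inter> C)) x"
      by (intro B_add_left ind) auto
    moreover have "AE x in M. B (indicat_real A) (indicat_real (C - A)) x = 0"
      "AE x in M. B (indicat_real (A - C)) (indicat_real (A \<inter> C)) x = 0"
      by (intro disjoint; auto)+
    ultimately show ?thesis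
      unfolding split[symmetric] by auto
  qed
  have "A \<inter> C \<inter> space M = A \<inter> C" using sets.sets_into_space[OF A] by blast
  \<comment> \<open>Both sides equal the diagonal value at \<open>A \<inter> C\<close>: the right
    one by \<open>diag\<close> with the whole space as second set.\<close>
  then show ?thesis using diag[OF A C] diag[of "A \<inter> C" "space M"] A C by auto
qed

text \<open>The defect \<open>B f g - B (f * g) e\<close> is linear in each argument, so it is
  killed one variable at a time: first \<open>f\<close> varies against an indicator, then
  \<open>g\<close> varies against the fixed \<open>f\<close>.\<close>

lemma B_ess_bounded:
  assumes f: "ess_bounded f" and g: "ess_bounded g"
  shows "AE x in M. B f g x = B (\<lambda>y. f y * g y) e x"
proof -
  note mem = ess_bounded_mem
  note eb = ess_bounded_add ess_bounded_mult ess_bounded_scale ess_bounded_indicator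
  have e: "ess_bounded e" by (rule ess_bounded_indicator) simp
  obtain C where C: "C \<ge> 0" "\<And>f g. \<lbrakk>f \<in> elems X; g \<in> elems Y\<rbrakk> \<Longrightarrow> fnorm Z (B f g) \<le> C * fnorm X f * fnorm Y g"
    using B_bound by blast
  obtain c where c: "c \<ge> 0" "\<And>g K. \<lbrakk>g \<in> borel_measurable M; AE x in M. \<bar>g x\<bar> \<le> K; K \<ge> 0\<rbrakk> \<Longrightarrow>
     g \<in> elems Y \<and> fnorm Y g \<le> K * c" using Y_bounded by blast
  define E where "E = fnorm X e"
  have E: "E \<ge> 0" using X.norm_nonneg[OF mem(1)[OF e]] by (simp add: E_def)
  have est: "fnorm Z (B f g) \<le> k * l * (C * E * c)"
    if "f \<in> borel_measurable M" "AE x in M. \<bar>f x\<bar> \<le> k" "k \<ge> 0"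
      "g \<in> borel_measurable M" "AE x in M. \<bar>g x\<bar> \<le> l" "l \<ge> 0" for f g k l
  proof -
    have "f \<in> elems X" "fnorm X f \<le> k * E" using X_bounded[OF that(1,2)] that(3) by (auto simp: E_def)
    moreover have "g \<in> elems Y" "fnorm Y g \<le> l * c" using c(2) that by auto
    ultimately have "fnorm Z (B f g) \<le> C * (fnorm X f * fnorm Y g)" "fnorm X f * fnorm Y g \<le> (k * E) * (l * c)"
      using C(2)[of f g] Y_norm_nonneg[of g] that(3) E
      by (auto simp only: mult.assoc[of C] intro!: mult_mono mult_nonneg_nonneg)
    moreover have "C * (fnorm X f * fnorm Y g) \<le> C * ((k * E) * (l * c))"
      using calculation(2) C(1) by (rule mult_left_mono)
    ultimately show ?thesis by (simp add: algebra_simps)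
  qed
  have diff_est: "fnorm Z (\<lambda>x. B f g x - B (\<lambda>y. f y * g y) e x) \<le> 2 * (k * l * (C * E * c))"
    if fk: "f \<in> borel_measurable M" "AE x in M. \<bar>f x\<bar> \<le> k" "k \<ge> 0"
      and gl: "g \<in> borel_measurable M" "AE x in M. \<bar>g x\<bar> \<le> l" "l \<ge> 0" for f g k l
  proof -
    have bd: "ess_bounded f" "ess_bounded g" using fk gl by (auto intro: ess_boundedI)
    have fg: "AE x in M. \<bar>f x * g x\<bar> \<le> k * l"
      using fk(2) gl(2) by eventually_elim (use fk gl in \<open>simp add: abs_mult mult_mono\<close>)
    have m: "(\<lambda>x. f x * g x) \<in> borel_measurable M" using fk gl by measurable
    have "fnorm Z (B (\<lambda>y. f y * g y) e) \<le> (k * l) * 1 * (C * E * c)"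
      using fk(3) gl(3) by (intro est m fg) (auto simp: indicator_def)
    moreover have "fnorm Z (\<lambda>x. B f g x - B (\<lambda>y. f y * g y) e x) \<le> fnorm Z (B f g) + fnorm Z (B (\<lambda>y. f y * g y) e)"
      by (intro Z.norm_diff B_mem mem eb bd e)
    ultimately show ?thesis using est[OF fk gl] by simp
  qed
  have left: "AE x in M. B f (indicat_real A) x - B (\<lambda>y. f y * indicat_real A y) e x = 0"
    if A: "A \<in> sets M" and f: "ess_bounded f" for A f
  proof (rule vanishing_on_indicators[where c = "2 * (C * E * c)", OF _ _ _ _ _ f])
    have Ab: "ess_bounded (indicat_real A)" using A by (rule ess_bounded_indicator)
    fix f assume f: "ess_bounded f"
    show "(\<lambda>x. B f (indicat_real A) x - B (\<lambda>y. f y * indicat_real A y) e x) \<in> elems Z"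
      by (intro Z.diff_mem B_mem mem eb f Ab e)
    show "AE x in M. B (\<lambda>y. a * f y) (indicat_real A) x - B (\<lambda>y. a * f y * indicat_real A y) e x =
        a * (B f (indicat_real A) x - B (\<lambda>y. f y * indicat_real A y) e x)" for a
      using B_scale_left[OF mem(1)[OF f] mem(2)[OF Ab], of a]
        B_scale_left[OF mem(1)[OF ess_bounded_mult[OF f Ab]] mem(2)[OF e], of a]
      by eventually_elim (simp add: mult.assoc right_diff_distrib)
    fix g assume g: "ess_bounded g"
    show "AE x in M. B (\<lambda>y. f y + g y) (indicat_real A) x - B (\<lambda>y. (f y + g y) * indicat_real A y) e x =
        (B f (indicat_real A) x - B (\<lambda>y. f y * indicat_real A y) e x) +
        (B g (indicat_real A) x - B (\<lambda>y. g y * indicat_real A y) e x)"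
      using B_add_left[OF mem(1)[OF f] mem(1)[OF g] mem(2)[OF Ab]]
        B_add_left[OF mem(1)[OF ess_bounded_mult[OF f Ab]] mem(1)[OF ess_bounded_mult[OF g Ab]] mem(2)[OF e]]
      by eventually_elim (simp add: distrib_right)
  next
    fix f k assume "f \<in> borel_measurable M" "AE x in M. \<bar>f x\<bar> \<le> k" "k \<ge> (0::real)"
    from diff_est[OF this, of "indicat_real A" 1] A
    show "fnorm Z (\<lambda>x. B f (indicat_real A) x - B (\<lambda>y. f y * indicat_real A y) e x) \<le> k * (2 * (C * E * c))"
      by (simp add: indicator_def algebra_simps)
  next
    fix D assume "D \<in> sets M"
    from B_indicator[OF this A]
    show "AE x in M. B (indicat_real D) (indicat_real A) x - B (\<lambda>y. indicat_real D y * indicat_real A y) e x = 0"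
      by (simp add: indicator_inter_arith[symmetric, abs_def])
  qed
  obtain k where k: "f \<in> borel_measurable M" "AE x in M. \<bar>f x\<bar> \<le> k" "k \<ge> 0"
    using f by (auto simp: ess_bounded_def)
  have "AE x in M. B f g x - B (\<lambda>y. f y * g y) e x = 0"
  proof (rule vanishing_on_indicators[where c = "2 * (k * (C * E * c))", OF _ _ _ _ _ g])
    fix g assume g: "ess_bounded g"
    show "(\<lambda>x. B f g x - B (\<lambda>y. f y * g y) e x) \<in> elems Z"
      by (intro Z.diff_mem B_mem mem eb f g e)
    show "AE x in M. B f (\<lambda>y. a * g y) x - B (\<lambda>y. f y * (a * g y)) e x =
        a * (B f g x - B (\<lambda>y. f y * g y) e x)" for a
      using B_scale_right[OF mem(1)[OF f] mem(2)[OF g], of a]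
        B_scale_left[OF mem(1)[OF ess_bounded_mult[OF f g]] mem(2)[OF e], of a]
      by eventually_elim (simp add: mult.left_commute right_diff_distrib)
    fix h assume h: "ess_bounded h"
    show "AE x in M. B f (\<lambda>y. g y + h y) x - B (\<lambda>y. f y * (g y + h y)) e x =
        (B f g x - B (\<lambda>y. f y * g y) e x) + (B f h x - B (\<lambda>y. f y * h y) e x)"
      using B_add_right[OF mem(1)[OF f] mem(2)[OF g] mem(2)[OF h]]
        B_add_left[OF mem(1)[OF ess_bounded_mult[OF f g]] mem(1)[OF ess_bounded_mult[OF f h]] mem(2)[OF e]]
      by eventually_elim (simp add: distrib_left)
  next
    fix g l assume "g \<in> borel_measurable M" "AE x in M. \<bar>g x\<bar> \<le> l" "l \<ge> (0::real)"
    from diff_est[OF k this]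
    show "fnorm Z (\<lambda>x. B f g x - B (\<lambda>y. f y * g y) e x) \<le> l * (2 * (k * (C * E * c)))"
      by (simp add: algebra_simps)
  next
    fix A assume "A \<in> sets M"
    from left[OF this f]
    show "AE x in M. B f (indicat_real A) x - B (\<lambda>y. f y * indicat_real A y) e x = 0" .
  qed
  then show ?thesis by simp
qed

text \<open>Cut both functions at level \<open>n\<close> and take the product of the bounded parts.
  The same \<open>u\<close> serves the product and the value of \<open>B\<close>: both errors come
  from the tails, and are at most \<open>r n\<close> and \<open>C * r n\<close>.\<close>

lemma B_approx:
  assumes f: "f \<in> elems X" and g: "g \<in> elems Y" and d: "d > 0"
  obtains u where "ess_bounded u" "u \<in> elems Z" "fnorm Z (\<lambda>x. f x * g x - u x) < d"
    "fnorm Z (\<lambda>x. B f g x - B u e x) < d"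
proof -
  note [measurable] = X_measurable[OF f] Y_measurable[OF g]
  obtain C where C: "C \<ge> 0" "\<And>f g. \<lbrakk>f \<in> elems X; g \<in> elems Y\<rbrakk> \<Longrightarrow> fnorm Z (B f g) \<le> C * fnorm X f * fnorm Y g"
    using B_bound by blast
  define ft where "ft n = (\<lambda>x. if \<bar>f x\<bar> > real n then f x else 0)" for n :: nat
  define gt where "gt n = (\<lambda>x. if \<bar>g x\<bar> > real n then g x else 0)" for n :: nat
  define fb where "fb n = (\<lambda>x. if \<bar>f x\<bar> > real n then 0 else f x)" for n :: nat
  define gb where "gb n = (\<lambda>x. if \<bar>g x\<bar> > real n then 0 else g x)" for n :: nat
  have meas [measurable]: "ft n \<in> borel_measurable M" "gt n \<in> borel_measurable M"
    "fb n \<in> borel_measurable M" "gb n \<in> borel_measurable M" for n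
    unfolding ft_def gt_def fb_def gb_def by measurable
  have ft: "ft n \<in> elems X" and fb: "fb n \<in> elems X" "fnorm X (fb n) \<le> fnorm X f" for n
    by (intro X_ideal[OF f meas(1)] X_ideal[OF f meas(3)]; simp add: ft_def fb_def)+
  have gt: "gt n \<in> elems Y" and gb: "gb n \<in> elems Y" for n
    using Y_ideal[OF g meas(2), of n] Y_ideal[OF g meas(4), of n] by (auto simp: gt_def gb_def)
  have f_split: "f = (\<lambda>x. ft n x + fb n x)" and g_split: "g = (\<lambda>x. gt n x + gb n x)" for n
    by (auto simp: ft_def fb_def gt_def gb_def)
  define r where "r n = fnorm X (ft n) * fnorm Y g + fnorm X f * fnorm Y (gt n)" for n
  have "r \<longlonglongrightarrow> 0 * fnorm Y g + fnorm X f * 0"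
    unfolding r_def ft_def gt_def
    by (intro tendsto_intros X_tail_tendsto_0[OF f] Y_tail_tendsto_0[OF g]) measurable
  then have r: "r \<longlonglongrightarrow> 0" by simp
  then have "(\<lambda>n. C * r n) \<longlonglongrightarrow> 0" by (rule tendsto_mult_right_zero)
  then have "\<forall>\<^sub>F n in sequentially. C * r n < d" using d by (rule order_tendstoD(2))
  moreover have "\<forall>\<^sub>F n in sequentially. r n < d" using r d by (rule order_tendstoD(2))
  ultimately have "\<forall>\<^sub>F n in sequentially. C * r n < d \<and> r n < d" by eventually_elim simp
  then obtain n where n: "C * r n < d" "r n < d" by (auto simp: eventually_sequentially)
  have fb_le: "fnorm X (fb n) * fnorm Y (gt n) \<le> fnorm X f * fnorm Y (gt n)"
    using fb(2) Y_norm_nonneg[OF gt] by (rule mult_right_mono)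
  have bdd: "ess_bounded (fb n)" "ess_bounded (gb n)"
    by (intro ess_boundedI[of _ "real n"]; auto simp: fb_def gb_def)+
  define u where "u = (\<lambda>x. fb n x * gb n x)"
  have u: "ess_bounded u" "u \<in> elems Z" unfolding u_def using bdd fb gb prod_in_Z by (auto intro: ess_bounded_mult)
  have e: "ess_bounded e" by (rule ess_bounded_indicator) simp
  have Bu: "B u e \<in> elems Z" by (intro B_mem ess_bounded_mem u e)
  have fg_split: "(\<lambda>x. f x * g x - u x) = (\<lambda>x. ft n x * g x + fb n x * gt n x)"
    by (auto simp: u_def ft_def gt_def fb_def gb_def)
  have "fnorm Z (\<lambda>x. ft n x * g x + fb n x * gt n x) \<le> fnorm Z (\<lambda>x. ft n x * g x) + fnorm Z (\<lambda>x. fb n x * gt n x)"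
    by (intro Z.norm_add prod_in_Z ft g fb gt)
  also have "\<dots> \<le> r n"
    using prod_in_Z(2)[OF ft g, of n] prod_in_Z(2)[OF fb(1) gt, of n n] fb_le by (simp add: r_def)
  finally have 1: "fnorm Z (\<lambda>x. f x * g x - u x) < d" using n unfolding fg_split by simp
  have "AE x in M. B (\<lambda>x. ft n x + fb n x) g x = B (ft n) g x + B (fb n) g x"
    by (rule B_add_left[OF ft fb(1) g])
  moreover have "AE x in M. B (fb n) (\<lambda>x. gt n x + gb n x) x = B (fb n) (gt n) x + B (fb n) (gb n) x"
    by (rule B_add_right[OF fb(1) gt gb])
  moreover have "AE x in M. B (fb n) (gb n) x = B u e x"
    unfolding u_def by (rule B_ess_bounded[OF bdd])
  ultimately have "AE x in M. B f g x - B u e x = B (ft n) g x + B (fb n) (gt n) x"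
    unfolding f_split[of n, symmetric] g_split[of n, symmetric] by eventually_elim simp
  then have "fnorm Z (\<lambda>x. B f g x - B u e x) = fnorm Z (\<lambda>x. B (ft n) g x + B (fb n) (gt n) x)"
    by (intro Z_norm_cong Z.diff_mem Z.add_mem B_mem f g ft fb gt Bu)
  also have "\<dots> \<le> fnorm Z (B (ft n) g) + fnorm Z (B (fb n) (gt n))"
    by (intro Z.norm_add B_mem ft fb g gt)
  also have "\<dots> \<le> C * (fnorm X (ft n) * fnorm Y g) + C * (fnorm X (fb n) * fnorm Y (gt n))"
    using C(2)[OF ft g, of n] C(2)[OF fb(1) gt, of n n] by (simp add: mult.assoc)
  also have "\<dots> \<le> C * r n"
    using mult_left_mono[OF fb_le C(1)] by (simp add: r_def distrib_left)
  finally have 2: "fnorm Z (\<lambda>x. B f g x - B u e x) < d" using n by simp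
  show ?thesis using that[OF u 1 2] .
qed

text \<open>Boundedness of \<open>B\<close> gives an estimate of \<open>B h e\<close> only by the
  norm of \<open>h\<close> in X. Passing to the canonical factors of \<open>h\<close>, which have
  the same product and are bounded when \<open>h\<close> is, turns it into an estimate by the norm
  in \<open>Z\<close>.\<close>

lemma B_ess_bounded_norm:
  "\<exists>C\<ge>0. \<forall>h\<in>elems Z. (ess_bounded h \<longrightarrow> fnorm Z (B h e) \<le> C * fnorm Z h) \<and>
     fnorm Z (B (factor_X h) (factor_Y h)) \<le> C * fnorm Z h"
proof -
  obtain C where C: "C \<ge> 0" "\<And>f g. \<lbrakk>f \<in> elems X; g \<in> elems Y\<rbrakk> \<Longrightarrow> fnorm Z (B f g) \<le> C * fnorm X f * fnorm Y g"
    using B_bound by blast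
  have "(ess_bounded h \<longrightarrow> fnorm Z (B h e) \<le> C * fnorm Z h) \<and>
     fnorm Z (B (factor_X h) (factor_Y h)) \<le> C * fnorm Z h" if h: "h \<in> elems Z" for h
  proof -
    note [measurable] = Z_measurable[OF h]
    have le: "fnorm Z (B (factor_X h) (factor_Y h)) \<le> C * fnorm Z h"
      using C(2)[OF factor(1,2)[OF h]] mult_left_mono[OF factor(3)[OF h] C(1)] by (simp add: mult.assoc)
    moreover have "fnorm Z (B h e) \<le> C * fnorm Z h" if bh: "ess_bounded h"
    proof -
      obtain k where k: "AE x in M. \<bar>h x\<bar> \<le> k" "k \<ge> 0" using bh by (auto simp: ess_bounded_def)
      have pw: "AE x in M. \<bar>h x\<bar> powr t \<le> k powr t" if "t \<ge> 0" for t
        using k(1) by eventually_elim (use that in \<open>auto intro: powr_mono2\<close>)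
      have "ess_bounded (factor_X h)" unfolding factor_X_def
        by (rule ess_boundedI[of _ "k powr (1 / p)"]) (use pw[of "1 / p"] p in \<open>auto simp: abs_mult sgn_if\<close>)
      moreover have "ess_bounded (factor_Y h)" unfolding factor_Y_def
        by (rule ess_boundedI[of _ "k powr ((p - 1) / p)"]) (use pw[of "(p - 1) / p"] p in auto)
      ultimately have "AE x in M. B (factor_X h) (factor_Y h) x = B (\<lambda>y. factor_X h y * factor_Y h y) e x"
        by (rule B_ess_bounded)
      then have "fnorm Z (B (factor_X h) (factor_Y h)) = fnorm Z (B h e)"
        unfolding factor_prod
        by (intro Z_norm_cong B_mem factor h ess_bounded_mem bh ess_bounded_indicator) auto
      then show ?thesis using le by simp
    qed
    ultimately show ?thesis by blast
  qed
  then show ?thesis using C(1) by blast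
qed

text \<open>Linear relations between products pass to the values of \<open>B\<close>. Additivity and
  homogeneity of the induced operator, as well as its independence of the chosen factors, are all
  instances. The products are replaced by bounded functions whose combination \<open>w\<close> is
  small in \<open>Z\<close>, and there \<open>B w e\<close> is controlled by that norm.\<close>

lemma B_lincomb:
  assumes f: "f1 \<in> elems X" "f2 \<in> elems X" "f3 \<in> elems X"
    and g: "g1 \<in> elems Y" "g2 \<in> elems Y" "g3 \<in> elems Y"
    and eq: "AE x in M. c1 * (f1 x * g1 x) + c2 * (f2 x * g2 x) = f3 x * g3 x"
  shows "AE x in M. c1 * B f1 g1 x + c2 * B f2 g2 x = B f3 g3 x"
proof -
  obtain C where C: "C \<ge> 0" "\<And>h. \<lbrakk>h \<in> elems Z; ess_bounded h\<rbrakk> \<Longrightarrow> fnorm Z (B h e) \<le> C * fnorm Z h"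
    using B_ess_bounded_norm by blast
  \<comment> \<open>One share pays for replacing each \<open>B f g\<close> by \<open>B u e\<close>,
    and \<open>C\<close> shares pay for the size of \<open>B w e\<close>.\<close>
  define D where "D = (\<bar>c1\<bar> + \<bar>c2\<bar> + 1) * (1 + C)"
  have D: "D > 0" using C(1) by (simp add: D_def)
  note BZ = B_mem[OF f(1) g(1)] B_mem[OF f(2) g(2)] B_mem[OF f(3) g(3)]
  note PZ = prod_in_Z(1)[OF f(1) g(1)] prod_in_Z(1)[OF f(2) g(2)] prod_in_Z(1)[OF f(3) g(3)]
  note mem = Z.add_mem Z.scale_mem Z.diff_mem BZ PZ
  let ?k = "\<lambda>x. (c1 * B f1 g1 x + c2 * B f2 g2 x) - B f3 g3 x"
  have kZ: "?k \<in> elems Z" by (intro mem)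
  have "fnorm Z ?k \<le> 0 + r" if "r > 0" for r
  proof -
    define d where "d = r / D"
    have d: "d > 0" using that D by (simp add: d_def)
    obtain u1 where u1: "ess_bounded u1" "u1 \<in> elems Z" "fnorm Z (\<lambda>x. f1 x * g1 x - u1 x) < d"
      "fnorm Z (\<lambda>x. B f1 g1 x - B u1 e x) < d" using B_approx[OF f(1) g(1) d] by blast
    obtain u2 where u2: "ess_bounded u2" "u2 \<in> elems Z" "fnorm Z (\<lambda>x. f2 x * g2 x - u2 x) < d"
      "fnorm Z (\<lambda>x. B f2 g2 x - B u2 e x) < d" using B_approx[OF f(2) g(2) d] by blast
    obtain u3 where u3: "ess_bounded u3" "u3 \<in> elems Z" "fnorm Z (\<lambda>x. f3 x * g3 x - u3 x) < d"
      "fnorm Z (\<lambda>x. B f3 g3 x - B u3 e x) < d" using B_approx[OF f(3) g(3) d] by blast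
    note X = ess_bounded_mem(1)[OF u1(1)] ess_bounded_mem(1)[OF u2(1)] ess_bounded_mem(1)[OF u3(1)]
    have eY: "e \<in> elems Y" by (intro ess_bounded_mem ess_bounded_indicator) simp
    note SZ = B_mem[OF X(1) eY] B_mem[OF X(2) eY] B_mem[OF X(3) eY]
    note mem = mem SZ u1(2) u2(2) u3(2)
    define w where "w = (\<lambda>x. (c1 * u1 x + c2 * u2 x) + (-1) * u3 x)"
    have w: "ess_bounded w" "w \<in> elems Z" unfolding w_def
      by (intro ess_bounded_add ess_bounded_scale u1 u2 u3) (intro mem)
    have "AE x in M. B w e x = B (\<lambda>x. c1 * u1 x + c2 * u2 x) e x + B (\<lambda>x. (-1) * u3 x) e x"
      unfolding w_def by (intro B_add_left X.add_mem X.scale_mem X eY)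
    moreover have "AE x in M. B (\<lambda>x. c1 * u1 x + c2 * u2 x) e x = B (\<lambda>x. c1 * u1 x) e x + B (\<lambda>x. c2 * u2 x) e x"
      by (intro B_add_left X.scale_mem X eY)
    ultimately have "AE x in M. B w e x = (c1 * B u1 e x + c2 * B u2 e x) - B u3 e x"
      using B_scale_left[OF X(1) eY, of c1] B_scale_left[OF X(2) eY, of c2] B_scale_left[OF X(3) eY, of "-1"]
      by eventually_elim simp
    then have Bw: "fnorm Z (B w e) = fnorm Z (\<lambda>x. (c1 * B u1 e x + c2 * B u2 e x) - B u3 e x)"
      by (intro Z_norm_cong B_mem ess_bounded_mem w mem) (rule ess_bounded_indicator, simp)
    have lin: "fnorm Z (\<lambda>x. (c1 * a x + c2 * b x) - c x) \<le> (\<bar>c1\<bar> + \<bar>c2\<bar> + 1) * d"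
      if "a \<in> elems Z" "b \<in> elems Z" "c \<in> elems Z" "fnorm Z a < d" "fnorm Z b < d" "fnorm Z c < d" for a b c
    proof -
      have "\<bar>c1\<bar> * fnorm Z a \<le> \<bar>c1\<bar> * d" "\<bar>c2\<bar> * fnorm Z b \<le> \<bar>c2\<bar> * d"
        using that by (intro mult_left_mono; simp)+
      then show ?thesis using Z.norm_lincomb[OF that(1-3), of c1 c2] that by (simp add: algebra_simps)
    qed
    \<comment> \<open>The products cancel by the assumed relation, so \<open>- w\<close> is a
      combination of approximation errors alone.\<close>
    have "fnorm Z w = fnorm Z (\<lambda>x. - w x)" using Z.norm_minus[OF w(2)] by simp
    also have "\<dots> = fnorm Z (\<lambda>x. (c1 * (f1 x * g1 x - u1 x) + c2 * (f2 x * g2 x - u2 x)) - (f3 x * g3 x - u3 x))"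
    proof (rule Z_norm_cong)
      show "(\<lambda>x. - w x) \<in> elems Z" by (rule Z.minus_mem[OF w(2)])
      show "AE x in M. - w x = (c1 * (f1 x * g1 x - u1 x) + c2 * (f2 x * g2 x - u2 x)) - (f3 x * g3 x - u3 x)"
        using eq by eventually_elim (simp add: w_def algebra_simps)
    qed (intro mem)
    also have "\<dots> \<le> (\<bar>c1\<bar> + \<bar>c2\<bar> + 1) * d" by (intro lin mem u1 u2 u3)
    finally have "C * fnorm Z w \<le> C * ((\<bar>c1\<bar> + \<bar>c2\<bar> + 1) * d)" using C(1) by (rule mult_left_mono)
    then have Sw: "fnorm Z (\<lambda>x. (c1 * B u1 e x + c2 * B u2 e x) - B u3 e x) \<le> C * ((\<bar>c1\<bar> + \<bar>c2\<bar> + 1) * d)"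
      using C(2)[OF w(2,1)] Bw by linarith
    have "fnorm Z ?k \<le> fnorm Z (\<lambda>x. (c1 * B u1 e x + c2 * B u2 e x) - B u3 e x)
        + fnorm Z (\<lambda>x. ?k x - ((c1 * B u1 e x + c2 * B u2 e x) - B u3 e x))"
      by (intro Z.norm_le_diff mem)
    also have "(\<lambda>x. ?k x - ((c1 * B u1 e x + c2 * B u2 e x) - B u3 e x)) =
        (\<lambda>x. (c1 * (B f1 g1 x - B u1 e x) + c2 * (B f2 g2 x - B u2 e x)) - (B f3 g3 x - B u3 e x))"
      by (simp add: algebra_simps)
    also have "fnorm Z \<dots> \<le> (\<bar>c1\<bar> + \<bar>c2\<bar> + 1) * d" by (intro lin mem u1 u2 u3)
    finally have "fnorm Z ?k \<le> D * d" using Sw by (simp add: D_def algebra_simps)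
    then show ?thesis using D by (simp add: d_def)
  qed
  then have "fnorm Z ?k \<le> 0" by (rule field_le_epsilon)
  then have "fnorm Z ?k = 0" using Z.norm_nonneg[OF kZ] by simp
  then show ?thesis using Z_zero_iff[OF kZ] by simp
qed

text \<open>The canonical factors define \<open>T\<close> without a choice of representatives; all
  its properties are then cases of \<open>B_lincomb\<close>, with a zero coefficient where only one
  product occurs.\<close>

lemma factorization:
  defines "T \<equiv> \<lambda>h. B (factor_X h) (factor_Y h)"
  obtains C where "Z.operator_mod_null T C"
    "\<And>f g. \<lbrakk>f \<in> elems X; g \<in> elems Y\<rbrakk> \<Longrightarrow> AE x in M. T (prod_map f g) x = B f g x"
proof -
  obtain C where C: "C \<ge> 0" "\<And>h. h \<in> elems Z \<Longrightarrow> fnorm Z (B (factor_X h) (factor_Y h)) \<le> C * fnorm Z h"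
    using B_ess_bounded_norm by blast
  note fX = factor(1) note fY = factor(2)
  have TZ: "T h \<in> elems Z" if "h \<in> elems Z" for h
    unfolding T_def using that by (intro B_mem factor)
  have add: "AE x in M. T (\<lambda>y. f y + g y) x = T f x + T g x" if "f \<in> elems Z" "g \<in> elems Z" for f g
    using B_lincomb[of "factor_X f" "factor_X g" "factor_X (\<lambda>y. f y + g y)"
        "factor_Y f" "factor_Y g" "factor_Y (\<lambda>y. f y + g y)" 1 1] that
    by (auto simp: factor_prod T_def fX fY Z.add_mem)
  have scale: "AE x in M. T (\<lambda>y. c * f y) x = c * T f x" if "f \<in> elems Z" for c f
    using B_lincomb[of "factor_X f" "factor_X f" "factor_X (\<lambda>y. c * f y)"
        "factor_Y f" "factor_Y f" "factor_Y (\<lambda>y. c * f y)" c 0] that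
    by (auto simp: factor_prod T_def fX fY Z.scale_mem)
  have "Z.operator_mod_null T C"
    unfolding Z.operator_mod_null_def
  proof (intro conjI ballI allI)
    show "fnorm Z (\<lambda>x. T (\<lambda>y. f y + g y) x - (T f x + T g x)) = 0" if "f \<in> elems Z" "g \<in> elems Z" for f g
      using add[OF that] Z_dist_zero_iff[OF TZ[OF Z.add_mem[OF that]] Z.add_mem[OF TZ TZ, OF that]] by simp
    show "fnorm Z (\<lambda>x. T (\<lambda>y. c * f y) x - c * T f x) = 0" if "f \<in> elems Z" for f c
      using scale[OF that] Z_dist_zero_iff[OF TZ[OF Z.scale_mem[OF that]] Z.scale_mem[OF TZ[OF that]]] by simp
    show "fnorm Z (T f) \<le> C * fnorm Z f" if "f \<in> elems Z" for f
      unfolding T_def by (rule C(2)[OF that])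
  qed (use TZ C(1) in auto)
  moreover have "AE x in M. T (prod_map f g) x = B f g x" if fg: "f \<in> elems X" "g \<in> elems Y" for f g
  proof -
    have h: "prod_map f g \<in> elems Z" unfolding prod_map_def by (rule prod_in_Z[OF fg])
    show ?thesis
      using B_lincomb[of f f "factor_X (prod_map f g)" g g "factor_Y (prod_map f g)" 1 0] fg h
      by (auto simp: factor_prod T_def fX fY prod_map_def)
  qed
  ultimately show ?thesis using that by blast
qed

end

section \<open>The equivalences\<close>

lemma rank_one_norm_bound:
  assumes "bounded_op M Z Z T"
  obtains C where "C \<ge> 0" "\<And>h. h \<in> elems Z \<Longrightarrow> fnorm Z (T h) \<le> C * fnorm Z h"
proof -
  obtain C where C: "\<forall>h\<in>elems Z. fnorm Z (T h) \<le> C * fnorm Z h" using assms by (auto simp: bounded_op_def)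
  have "fnorm Z (T h) \<le> \<bar>C\<bar> * fnorm Z h" if "h \<in> elems Z" for h
  proof -
    have "C * fnorm Z h \<le> \<bar>C\<bar> * fnorm Z h" using Z.norm_nonneg[OF that] by (intro mult_right_mono) auto
    then show ?thesis using C that by force
  qed
  then show ?thesis using that[of "\<bar>C\<bar>"] by simp
qed

lemma unit_in_Z: "e \<in> elems Z" "fnorm Z e \<noteq> 0"
proof -
  have "(\<lambda>x. e x * e x) \<in> elems Z"
    by (intro prod_in_Z ess_bounded_mem ess_bounded_indicator) auto
  then show eZ: "e \<in> elems Z" by (simp add: indicator_inter_arith[symmetric])
  show "fnorm Z e \<noteq> 0"
  proof
    assume "fnorm Z e = 0"
    then have "AE x in M. e x = 0" using Z_zero_iff[OF eZ] by simp
    then have "AE x in M. False" using AE_space by eventually_elim simp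
    then show False using nontrivial by (simp add: eventually_False ae_filter_eq_bot_iff)
  qed
qed

lemma SUP_prod_map:
  "(SUP (f, g)\<in>fball X \<times> fball Y. F (prod_map f g)) = (SUP h\<in>fball Z. F h)" for F :: "_ \<Rightarrow> real"
  unfolding prod_map_balls[symmetric] image_image by (simp add: case_prod_beta)

text \<open>Apply the Daugavet equation to the operator \<open>\<phi>\<close> times
  \<open>z\<close>, of norm one. If \<open>h + \<phi> h * z\<close> has norm above
  \<open>2 - \<epsilon>\<close> and \<open>\<phi> h \<ge> 0\<close>, then
  \<open>\<phi> h \<ge> 1 - \<epsilon>\<close>, and replacing \<open>\<phi> h * z\<close> by
  \<open>z\<close> costs at most another \<open>\<epsilon>\<close>.\<close>

lemma daugavet_imp_slice:
  assumes D: "daugavet_property M Z"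
  shows "Z.slice_condition"
  unfolding Z.slice_condition_def
proof (intro ballI allI impI)
  fix z \<phi> and \<epsilon> :: real
  assume z: "z \<in> fsphere Z" and \<phi>: "\<phi> \<in> dual_sphere Z" and \<epsilon>: "\<epsilon> > 0"
  have zV: "z \<in> elems Z" "fnorm Z z = 1" using z by (auto simp: fsphere_def)
  have \<phi>D: "\<phi> \<in> dual Z" "dual_norm Z \<phi> = 1" using \<phi> by (auto simp: dual_sphere_def)
  have \<phi>_le: "\<bar>\<phi> f\<bar> \<le> fnorm Z f" if "f \<in> elems Z" for f
    using Z.dual_norm_bound[OF \<phi>D(1) that] \<phi>D(2) by simp
  define Q where "Q f = (\<lambda>x. \<phi> f * z x)" for f
  have NQ: "fnorm Z (Q f) = \<bar>\<phi> f\<bar>" for f unfolding Q_def using Z.norm_scale[OF zV(1)] zV(2) by simp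
  have QV: "Q f \<in> elems Z" for f unfolding Q_def by (rule Z.scale_mem[OF zV(1)])
  have "bounded_op M Z Z Q"
    unfolding bounded_op_def
  proof (intro conjI ballI allI)
    fix f g c assume f: "f \<in> elems Z"
    show "AE x in M. Q (\<lambda>y. f y + g y) x = Q f x + Q g x" if "g \<in> elems Z"
      using Z.dual_add[OF \<phi>D(1) f that] by (simp add: Q_def distrib_right)
    show "AE x in M. Q (\<lambda>y. c * f y) x = c * Q f x"
      using Z.dual_scale[OF \<phi>D(1) f, of c] by (simp add: Q_def)
    show "Q f \<in> elems Z" by (rule QV)
  next
    show "\<exists>C. \<forall>f\<in>elems Z. fnorm Z (Q f) \<le> C * fnorm Z f"
      using \<phi>_le NQ by (intro exI[of _ 1]) simp
  qed
  moreover obtain f0 where f0: "f0 \<in> fball Z" "\<phi> f0 > 0"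
    using Z.dual_norm_less[OF \<phi>D(1), of 0] \<phi>D(2) by auto
  have "\<not> (AE x in M. Q f0 x = 0)"
    using Z_zero_iff[OF QV, of f0] NQ[of f0] f0(2) by simp
  then have "\<exists>f\<in>elems Z. \<not> (AE x in M. Q f x = 0)" using f0(1) Z.ball_memD by blast
  moreover have "\<exists>z\<in>elems Z. \<forall>f\<in>elems Z. \<exists>c. AE x in M. Q f x = c * z x"
  proof (intro bexI[OF _ zV(1)] ballI exI)
    show "AE x in M. Q f x = \<phi> f * z x" for f by (simp add: Q_def)
  qed
  ultimately have "rank_one_op M Z Z Q" unfolding rank_one_op_def by blast
  moreover have "op_norm Z Z Q = 1"
    using \<phi>D(2) unfolding op_norm_def dual_norm_def NQ .
  ultimately have "(SUP f\<in>fball Z. fnorm Z (\<lambda>x. f x + Q f x)) = 2"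
    using D unfolding daugavet_property_def op_norm_def by simp
  moreover have "bdd_above ((\<lambda>f. fnorm Z (\<lambda>x. f x + Q f x)) ` fball Z)"
  proof (rule bdd_aboveI2)
    fix f assume "f \<in> fball Z"
    from Z.ball_memD[OF this] show "fnorm Z (\<lambda>x. f x + Q f x) \<le> 2"
      using Z.norm_add[OF _ QV, of f f] NQ[of f] \<phi>_le[of f] by linarith
  qed
  ultimately obtain f where f: "f \<in> fball Z" "fnorm Z (\<lambda>x. f x + Q f x) > 2 - \<epsilon>"
    using less_cSUP_iff[of "fball Z" "\<lambda>f. fnorm Z (\<lambda>x. f x + Q f x)" "2 - \<epsilon>"] Z.zero_in_ball \<epsilon> by auto
  \<comment> \<open>The norm is unchanged under \<open>f \<mapsto> - f\<close>, so the sign of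
    \<open>\<phi> f\<close> can be chosen.\<close>
  have "\<exists>h\<in>fball Z. fnorm Z (\<lambda>x. h x + Q h x) > 2 - \<epsilon> \<and> \<phi> h \<ge> 0"
  proof (cases "\<phi> f \<ge> 0")
    case False
    have fV: "f \<in> elems Z" using f Z.ball_memD by blast
    have "(\<lambda>x. - f x) \<in> fball Z" using f by (simp add: fball_def Z.minus_mem Z.norm_minus)
    moreover have "(\<lambda>x. - f x + Q (\<lambda>x. - f x) x) = (\<lambda>x. - (f x + Q f x))"
      by (simp add: Q_def Z.dual_minus[OF \<phi>D(1) fV])
    moreover have "fnorm Z (\<lambda>x. - (f x + Q f x)) = fnorm Z (\<lambda>x. f x + Q f x)"
      by (rule Z.norm_minus[OF Z.add_mem[OF fV QV]])
    ultimately show ?thesis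
      using f(2) False Z.dual_minus[OF \<phi>D(1) fV] by (intro bexI[of _ "\<lambda>x. - f x"]) auto
  qed (use f in blast)
  then obtain h where h: "h \<in> fball Z" "fnorm Z (\<lambda>x. h x + Q h x) > 2 - \<epsilon>" "\<phi> h \<ge> 0" by blast
  note hV = Z.ball_memD[OF h(1)]
  have "fnorm Z (\<lambda>x. h x + Q h x) \<le> fnorm Z h + \<phi> h"
    using Z.norm_add[OF hV(1) QV, of h] NQ[of h] h(3) by simp
  then have \<phi>h: "\<phi> h \<ge> 1 - \<epsilon>" using h(2) hV(2) by linarith
  have "fnorm Z (\<lambda>x. h x + Q h x) \<le> fnorm Z (\<lambda>x. z x + h x) + fnorm Z (\<lambda>x. (h x + Q h x) - (z x + h x))"
    by (intro Z.norm_le_diff Z.add_mem hV QV zV)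
  also have "(\<lambda>x. (h x + Q h x) - (z x + h x)) = (\<lambda>x. (\<phi> h - 1) * z x)"
    by (simp add: Q_def left_diff_distrib)
  also have "fnorm Z \<dots> = \<bar>\<phi> h - 1\<bar>" using Z.norm_scale[OF zV(1)] zV(2) by simp
  also have "\<dots> = 1 - \<phi> h" using \<phi>_le[OF hV(1)] hV(2) by simp
  finally have "fnorm Z (\<lambda>x. z x + h x) \<ge> 2 - 2 * \<epsilon>" using h(2) \<phi>h by linarith
  with \<phi>h h(1) show "\<exists>h\<in>fball Z. \<phi> h \<ge> 1 - \<epsilon> \<and> fnorm Z (\<lambda>x. z x + h x) \<ge> 2 - 2 * \<epsilon>" by blast
qed

text \<open>Products of the two balls fill the ball of \<open>Z\<close>, so the normalizing constant
  is the dual norm, which is 1 on the dual sphere.\<close>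

lemma slice_condition_iff:
  "Z.slice_condition \<longleftrightarrow> (\<forall>z\<in>fsphere Z. \<forall>x'\<in>dual_sphere Z. \<forall>\<epsilon>>0.
     \<exists>(f, g) \<in> slice X Y (normalized_form X Y prod_map x') \<epsilon>.
       fnorm Z (\<lambda>x. z x + prod_map f g x) \<ge> 2 - 2 * \<epsilon>)"
proof -
  have "(\<exists>(f, g) \<in> slice X Y (normalized_form X Y prod_map \<phi>) \<epsilon>.
       fnorm Z (\<lambda>x. z x + prod_map f g x) \<ge> 2 - 2 * \<epsilon>) \<longleftrightarrow>
     (\<exists>h\<in>fball Z. \<phi> h \<ge> 1 - \<epsilon> \<and> fnorm Z (\<lambda>x. z x + h x) \<ge> 2 - 2 * \<epsilon>)"
    if "\<phi> \<in> dual_sphere Z" for z \<phi> \<epsilon>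
  proof -
    have "bilin_form_norm X Y (\<lambda>f g. \<phi> (prod_map f g)) = dual_norm Z \<phi>"
      unfolding bilin_form_norm_def dual_norm_def by (rule SUP_prod_map)
    then have "normalized_form X Y prod_map \<phi> f g = \<phi> (prod_map f g)" for f g
      using that by (simp add: normalized_form_def dual_sphere_def)
    then show ?thesis unfolding prod_map_balls[symmetric] slice_def by auto
  qed
  then show ?thesis unfolding Z.slice_condition_def by simp
qed

lemma slice_imp_bilinear_daugavet:
  assumes S: "Z.slice_condition" and B: "bounded_bilinear_map M X Y Z B" and sym: "symmetric_bilinear M B"
    and wc: "weakly_compact_bilinear X Y Z B"
  shows "bilin_norm X Y Z (\<lambda>f g x. prod_map f g x + B f g x) = 1 + bilin_norm X Y Z B"
proof -
  define T where "T h = B (factor_X h) (factor_Y h)" for h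
  obtain C where T: "Z.operator_mod_null T C"
    "\<And>f g. \<lbrakk>f \<in> elems X; g \<in> elems Y\<rbrakk> \<Longrightarrow> AE x in M. T (prod_map f g) x = B f g x"
    using factorization[OF B sym] unfolding T_def by blast
  have BZ: "B f g \<in> elems Z" if "f \<in> fball X" "g \<in> fball Y" for f g
    using that B_mem[OF B sym] by (simp add: fball_def)
  have PZ: "prod_map f g \<in> fball Z" if "f \<in> fball X" "g \<in> fball Y" for f g
    unfolding prod_map_balls[symmetric] using that by (intro image_eqI[of _ _ "(f, g)"]) auto
  have BT: "fnorm Z (B f g) = fnorm Z (T (prod_map f g))" if fg: "f \<in> fball X" "g \<in> fball Y" for f g
    using T(2)[of f g] fg BZ[OF fg] Z.op_mem[OF T(1)] Z.ball_memD(1)[OF PZ[OF fg]]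
    by (intro Z_norm_cong) (auto simp: fball_def)
  \<comment> \<open>By the definition of \<open>T\<close> its values are exact values of
    \<open>B\<close> at points of the balls, not merely a.e. equal ones; this places them in the
    weakly compact set.\<close>
  have factors: "\<exists>f\<in>fball X. \<exists>g\<in>fball Y. u = prod_map f g \<and> T u = B f g" if "u \<in> fball Z" for u
  proof -
    have u: "u \<in> elems Z" "fnorm Z u \<le> 1" using Z.ball_memD[OF that] by auto
    have "fnorm Z u powr (1 / p) \<le> 1" using u p Z.norm_nonneg[OF u(1)] by (intro powr_le1) auto
    then have "factor_X u \<in> fball X" "factor_Y u \<in> fball Y" using factor[OF u(1)] u(2) by (auto simp: fball_def)
    moreover have "u = prod_map (factor_X u) (factor_Y u)" by (simp add: prod_map_def factor_prod)
    ultimately show ?thesis unfolding T_def by blast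
  qed
  define K where "K = norm_closure Z {B f g |f g. f \<in> fball X \<and> g \<in> fball Y}"
  have K: "compactin (weak_topology Z) K" using wc by (simp add: weakly_compact_bilinear_def K_def)
  have TK: "T u \<in> K" if u: "u \<in> fball Z" for u
  proof -
    obtain f g where fg: "f \<in> fball X" "g \<in> fball Y" "T u = B f g" using factors[OF u] by blast
    then have "T u \<in> {B f g |f g. f \<in> fball X \<and> g \<in> fball Y}" by blast
    moreover have "fnorm Z (\<lambda>x. T u x - T u x) = 0" by (simp add: Z.norm_zero)
    ultimately have "\<exists>k\<in>{B f g |f g. f \<in> fball X \<and> g \<in> fball Y}. fnorm Z (\<lambda>x. T u x - k x) < r"
      if "r > 0" for r using that by (intro bexI[of _ "T u"]) simp_all
    then show ?thesis
      unfolding K_def norm_closure_def using BZ[OF fg(1,2)] fg(3) by simp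
  qed
  let ?J = "fball X \<times> fball Y"
  have ne: "?J \<noteq> {}"
    using prod_map_balls Z.zero_in_ball by force
  have B_le: "fnorm Z (B f g) \<le> C" if fg: "f \<in> fball X" "g \<in> fball Y" for f g
  proof -
    note PV = Z.ball_memD[OF PZ[OF fg]]
    have "C * fnorm Z (prod_map f g) \<le> C * 1" using PV(2) Z.op_const_nonneg[OF T(1)] by (rule mult_left_mono)
    then show ?thesis using BT[OF fg] Z.op_norm_bound[OF T(1) PV(1)] by linarith
  qed
  have bdd: "bdd_above ((\<lambda>(f, g). fnorm Z (B f g)) ` ?J)"
    using B_le by (intro bdd_aboveI2[of _ _ C]) auto
  have sum_le: "fnorm Z (\<lambda>x. prod_map f g x + B f g x) \<le> 1 + fnorm Z (B f g)"
    if fg: "f \<in> fball X" "g \<in> fball Y" for f g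
    using Z.norm_add[OF Z.ball_memD(1)[OF PZ[OF fg]] BZ[OF fg]] Z.ball_memD(2)[OF PZ[OF fg]] by linarith
  have sum_bdd: "bdd_above ((\<lambda>(f, g). fnorm Z (\<lambda>x. prod_map f g x + B f g x)) ` ?J)"
    using sum_le B_le by (intro bdd_aboveI2[of _ _ "1 + C"]) force
  show ?thesis
  proof (rule antisym)
    show "bilin_norm X Y Z (\<lambda>f g x. prod_map f g x + B f g x) \<le> 1 + bilin_norm X Y Z B"
      unfolding bilin_norm_def
    proof (rule cSUP_least[OF ne])
      fix q assume "q \<in> ?J"
      then obtain f g where q: "q = (f, g)" "f \<in> fball X" "g \<in> fball Y" by auto
      have "fnorm Z (B f g) \<le> (SUP (f, g)\<in>?J. fnorm Z (B f g))"
        using cSUP_upper[OF _ bdd, of "(f, g)"] q by simp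
      with sum_le[OF q(2,3)] show "(case q of (f, g) \<Rightarrow> fnorm Z (\<lambda>x. prod_map f g x + B f g x))
          \<le> 1 + (SUP (f, g)\<in>?J. fnorm Z (B f g))" by (simp add: q)
    qed
    show "1 + bilin_norm X Y Z B \<le> bilin_norm X Y Z (\<lambda>f g x. prod_map f g x + B f g x)"
    proof (rule field_le_epsilon)
      fix \<eta> :: real assume \<eta>: "\<eta> > 0"
      obtain f g where fg: "f \<in> fball X" "g \<in> fball Y" "fnorm Z (B f g) > bilin_norm X Y Z B - \<eta>/2"
        using less_cSUP_iff[OF ne bdd, of "bilin_norm X Y Z B - \<eta>/2"] \<eta> by (auto simp: bilin_norm_def)
      obtain u where u: "u \<in> fball Z" "fnorm Z (\<lambda>x. u x + T u x) \<ge> 1 + fnorm Z (T (prod_map f g)) - \<eta>/2"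
        using Z.weakly_compact_daugavet[OF S unit_in_Z T(1) K TK PZ[OF fg(1,2)], of "\<eta>/2"] \<eta> by auto
      obtain f' g' where f'g': "f' \<in> fball X" "g' \<in> fball Y" "u = prod_map f' g'" "T u = B f' g'"
        using factors[OF u(1)] by blast
      have "fnorm Z (\<lambda>x. u x + T u x) \<le> bilin_norm X Y Z (\<lambda>f g x. prod_map f g x + B f g x)"
        unfolding bilin_norm_def using cSUP_upper[OF _ sum_bdd, of "(f', g')"] f'g' by simp
      then show "1 + bilin_norm X Y Z B \<le> bilin_norm X Y Z (\<lambda>f g x. prod_map f g x + B f g x) + \<eta>"
        using u(2) BT[OF fg(1,2)] fg(3) by linarith
    qed
  qed
qed

text \<open>This makes (2) a special case of (4). Symmetry is the pointwise identity between the
  product of two indicators and that of their intersection and union, and weak compactness holds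
  because the range lies on a line.\<close>

lemma rank_one_bilinear:
  assumes T: "rank_one_op M Z Z T"
  defines "B \<equiv> \<lambda>f g. T (prod_map f g)"
  shows "bounded_bilinear_map M X Y Z B" "symmetric_bilinear M B" "weakly_compact_bilinear X Y Z B"
proof -
  have bop: "bounded_op M Z Z T" using T by (simp add: rank_one_op_def)
  have TV: "T f \<in> elems Z" if "f \<in> elems Z" for f
    using bop that by (simp add: bounded_op_def)
  have Tadd: "AE x in M. T (\<lambda>y. f y + g y) x = T f x + T g x" if "f \<in> elems Z" "g \<in> elems Z" for f g
    using bop that by (simp add: bounded_op_def)
  have Tscale: "AE x in M. T (\<lambda>y. c * f y) x = c * T f x" if "f \<in> elems Z" for c f
    using bop that by (simp add: bounded_op_def)
  obtain C where C: "C \<ge> 0" "\<And>h. h \<in> elems Z \<Longrightarrow> fnorm Z (T h) \<le> C * fnorm Z h"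
    using rank_one_norm_bound[OF bop] by blast
  show "bounded_bilinear_map M X Y Z B"
    unfolding bounded_bilinear_map_def B_def prod_map_def
  proof (intro conjI ballI allI)
    fix f g f' g' and c :: real assume f: "f \<in> elems X" and g: "g \<in> elems Y"
    note fg = prod_in_Z(1)[OF f g]
    show "T (\<lambda>x. f x * g x) \<in> elems Z" by (rule TV[OF fg])
    show "AE x in M. T (\<lambda>x. (f x + f' x) * g x) x = T (\<lambda>x. f x * g x) x + T (\<lambda>x. f' x * g x) x"
      if "f' \<in> elems X" using Tadd[OF fg prod_in_Z(1)[OF that g]] by (simp add: distrib_right)
    show "AE x in M. T (\<lambda>x. f x * (g x + g' x)) x = T (\<lambda>x. f x * g x) x + T (\<lambda>x. f x * g' x) x"
      if "g' \<in> elems Y" using Tadd[OF fg prod_in_Z(1)[OF f that]] by (simp add: distrib_left)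
    show "AE x in M. T (\<lambda>x. c * f x * g x) x = c * T (\<lambda>x. f x * g x) x"
      using Tscale[OF fg, of c] by (simp add: mult.assoc)
    show "AE x in M. T (\<lambda>x. f x * (c * g x)) x = c * T (\<lambda>x. f x * g x) x"
      using Tscale[OF fg, of c] by (simp add: mult.left_commute)
  next
    have "fnorm Z (T (\<lambda>x. f x * g x)) \<le> C * fnorm X f * fnorm Y g" if "f \<in> elems X" "g \<in> elems Y" for f g
      using C(2)[OF prod_in_Z(1)[OF that]] mult_left_mono[OF prod_in_Z(2)[OF that] C(1)]
      by (simp add: mult.assoc)
    then show "\<exists>C. \<forall>f\<in>elems X. \<forall>g\<in>elems Y. fnorm Z (T (\<lambda>x. f x * g x)) \<le> C * fnorm X f * fnorm Y g"
      by blast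
  qed
  have "prod_map (indicat_real A) (indicat_real D) = prod_map (indicat_real (A \<inter> D)) (indicat_real (A \<union> D))"
    for A D :: "'a set" by (auto simp: prod_map_def indicator_def)
  then have "T (prod_map (indicat_real A) (indicat_real D)) =
      T (prod_map (indicat_real (A \<inter> D)) (indicat_real (A \<union> D)))" for A D by metis
  then show "symmetric_bilinear M B" unfolding symmetric_bilinear_def B_def by simp
  obtain f0 z where f0: "f0 \<in> elems Z" "\<not> (AE x in M. T f0 x = 0)"
    and z: "z \<in> elems Z" "\<And>f. f \<in> elems Z \<Longrightarrow> \<exists>c. AE x in M. T f x = c * z x"
    using T unfolding rank_one_op_def by blast
  have Nz: "fnorm Z z \<noteq> 0"
  proof
    assume "fnorm Z z = 0"
    then have "AE x in M. z x = 0" using Z_zero_iff[OF z(1)] by simp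
    moreover obtain c where "AE x in M. T f0 x = c * z x" using z(2)[OF f0(1)] by blast
    ultimately have "AE x in M. T f0 x = 0" by eventually_elim simp
    with f0(2) show False by blast
  qed
  have set_eq: "{B f g |f g. f \<in> fball X \<and> g \<in> fball Y} = T ` fball Z"
  proof -
    have "{B f g |f g. f \<in> fball X \<and> g \<in> fball Y} = (\<lambda>q. B (fst q) (snd q)) ` (fball X \<times> fball Y)"
      by force
    then show ?thesis
      unfolding prod_map_balls[symmetric] image_image by (simp add: B_def case_prod_beta)
  qed
  have "compactin (weak_topology Z) (norm_closure Z (T ` fball Z))"
  proof (rule Z.compactin_weak_line[OF z(1) Nz])
    show "T ` fball Z \<subseteq> elems Z" using TV Z.ball_memD by blast
    fix s assume "s \<in> T ` fball Z"
    then obtain h where h: "h \<in> fball Z" "s = T h" by blast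
    note hV = Z.ball_memD[OF h(1)]
    obtain c where "AE x in M. T h x = c * z x" using z(2)[OF hV(1)] by blast
    then show "\<exists>c. fnorm Z (\<lambda>x. s x - c * z x) = 0"
      using Z_dist_zero_iff[OF TV[OF hV(1)] Z.scale_mem[OF z(1)], of c] h by auto
    show "fnorm Z s \<le> C" using C(2)[OF hV(1)] mult_left_mono[OF hV(2) C(1)] h(2) by simp
  qed
  then show "weakly_compact_bilinear X Y Z B" unfolding weakly_compact_bilinear_def set_eq .
qed

end

theorem proposition4p4:
  fixes M :: "'a measure" and X :: "'a fspace" and p :: real
  assumes "1 \<le> p"
    and "finite_measure M" and "emeasure M (space M) \<noteq> 0"
    and "banach_function_space M X" and "order_continuous M X" and "p_convex_const_1 p X"
  shows
    "let Y = fpower M X (p - 1);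
         Z = fpower M X p;
         B\<^sub>0 = prod_map;
         A1 = (\<forall>T. rank_one_op M Z Z T \<longrightarrow>
                (SUP f\<in>fball X.
                   fnorm X (\<lambda>x. \<bar>sign_powr f p x + T (sign_powr f p) x\<bar> powr (1 / p)) powr p)
                = 1 + op_norm Z Z T);
         A2 = (\<forall>T. rank_one_op M Z Z T \<longrightarrow>
                bilin_norm X Y Z (\<lambda>f g x. B\<^sub>0 f g x + T (B\<^sub>0 f g) x) = 1 + op_norm Z Z T);
         A3 = (\<forall>z\<in>fsphere Z. \<forall>x'\<in>dual_sphere Z. \<forall>\<epsilon>>0.
                \<exists>(f, g) \<in> slice X Y (normalized_form X Y B\<^sub>0 x') \<epsilon>.
                  fnorm Z (\<lambda>x. z x + B\<^sub>0 f g x) \<ge> 2 - 2 * \<epsilon>);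
         A4 = (\<forall>B. bounded_bilinear_map M X Y Z B \<and> symmetric_bilinear M B \<and>
                  weakly_compact_bilinear X Y Z B \<longrightarrow>
                bilin_norm X Y Z (\<lambda>f g x. B\<^sub>0 f g x + B f g x) = 1 + bilin_norm X Y Z B);
         A5 = daugavet_property M Z
     in (A1 \<longleftrightarrow> A2) \<and> (A2 \<longleftrightarrow> A3) \<and> (A3 \<longleftrightarrow> A4) \<and> (A4 \<longleftrightarrow> A5)"
proof -
  interpret pconvex_function_space M X p
    using assms by (simp add: pconvex_function_space_def pconvex_function_space_axioms_def)
  define A1 where "A1 \<longleftrightarrow> (\<forall>T. rank_one_op M Z Z T \<longrightarrow>
      (SUP f\<in>fball X. fnorm X (\<lambda>x. \<bar>sign_powr f p x + T (sign_powr f p) x\<bar> powr (1 / p)) powr p)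
        = 1 + op_norm Z Z T)"
  define A2 where "A2 \<longleftrightarrow> (\<forall>T. rank_one_op M Z Z T \<longrightarrow>
      bilin_norm X Y Z (\<lambda>f g x. prod_map f g x + T (prod_map f g) x) = 1 + op_norm Z Z T)"
  define A3 where "A3 \<longleftrightarrow> (\<forall>z\<in>fsphere Z. \<forall>x'\<in>dual_sphere Z. \<forall>\<epsilon>>0.
      \<exists>(f, g) \<in> slice X Y (normalized_form X Y prod_map x') \<epsilon>.
        fnorm Z (\<lambda>x. z x + prod_map f g x) \<ge> 2 - 2 * \<epsilon>)"
  define A4 where "A4 \<longleftrightarrow> (\<forall>B. bounded_bilinear_map M X Y Z B \<and> symmetric_bilinear M B \<and>
        weakly_compact_bilinear X Y Z B \<longrightarrow>
      bilin_norm X Y Z (\<lambda>f g x. prod_map f g x + B f g x) = 1 + bilin_norm X Y Z B)"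
  \<comment> \<open>The p-th power of the X-norm of a p-th root is by definition the norm in
    \<open>Z\<close>, so the supremum is only reparametrized by the sign preserving power.\<close>
  have "(SUP f\<in>fball X. fnorm X (\<lambda>x. \<bar>sign_powr f p x + T (sign_powr f p) x\<bar> powr (1 / p)) powr p)
      = op_norm Z Z (\<lambda>f x. f x + T f x)" for T
    unfolding op_norm_def sign_powr_ball[symmetric] image_image fnorm_Z ..
  then have "A1 \<longleftrightarrow> daugavet_property M Z"
    unfolding A1_def daugavet_property_def by simp
  moreover have "bilin_norm X Y Z (\<lambda>f g x. prod_map f g x + T (prod_map f g) x) =
      op_norm Z Z (\<lambda>f x. f x + T f x)" for T
    unfolding bilin_norm_def op_norm_def by (rule SUP_prod_map)
  then have "A2 \<longleftrightarrow> daugavet_property M Z"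
    unfolding A2_def daugavet_property_def by simp
  moreover have "daugavet_property M Z \<Longrightarrow> A3"
    unfolding A3_def slice_condition_iff[symmetric] by (rule daugavet_imp_slice)
  moreover have "A3 \<Longrightarrow> A4"
    unfolding A3_def A4_def slice_condition_iff[symmetric] by (simp add: slice_imp_bilinear_daugavet)
  moreover have "A4 \<Longrightarrow> A2"
  proof -
    assume A4: A4
    have norm: "bilin_norm X Y Z (\<lambda>f g. T (prod_map f g)) = op_norm Z Z T" for T
      unfolding bilin_norm_def op_norm_def by (rule SUP_prod_map)
    have "bilin_norm X Y Z (\<lambda>f g x. prod_map f g x + T (prod_map f g) x) = 1 + op_norm Z Z T"
      if "rank_one_op M Z Z T" for T
      using A4[unfolded A4_def, rule_format, of "\<lambda>f g. T (prod_map f g)"] rank_one_bilinear[OF that]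
      by (simp add: norm)
    then show A2 unfolding A2_def by blast
  qed
  ultimately have "(A1 \<longleftrightarrow> A2) \<and> (A2 \<longleftrightarrow> A3) \<and> (A3 \<longleftrightarrow> A4) \<and> (A4 \<longleftrightarrow> daugavet_property M Z)" by blast
  then show ?thesis unfolding Let_def A1_def A2_def A3_def A4_def .
qed

end
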